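(* Let $n\ge2$, let $\Omega\subset\mathbb R^n$ be a smooth bounded domain, and let $B,H,f$ satisfy the standing assumptions (i)–(viii) listed in the context (with $p>1$ and $k\in[0,1]$ as in (iii)). Let $u\in C^1(\overline\Omega)$, $u>0$ in $\Omega$, be a weak solution of $-\operatorname{div}\big(B'(H(\nabla u))\nabla H(\nabla u)\big)=f(u)$ in $\Omega$. Fix $t\in[0,p-1)$ and $\gamma<n-2$ if $n\ge3$, $\gamma=0$ if $n=2$. Then for any $\Omega'\subset\subset\Omega$ there exists $C$ such that $$\sup_{y\in\Omega}\int_{\Omega'}\frac{1}{(k+|\nabla u|)^t\,|x-y|^\gamma}\,dx\le C,$$ where $C=C(\Omega',t,\gamma,n,p,\|u\|_{W^{1,\infty}},f)$ (for fixed $\Omega,B,H$).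
   Context: Standing assumptions: (i) $B\in C^{3,\beta_0}_{loc}((0,+\infty))\cap C^1([0,+\infty))$ for some $\beta_0\in(0,1)$. (ii) $B(0)=B'(0)=0$ and $B(t),B'(t),B''(t)>0$ for all $t>0$. (iii) There exist $p>1$, $k\in[0,1]$, $\gamma_0>0$, $\Gamma_0>0$ such that for all $t>0$: $\gamma_0(k+t)^{p-2}t\le B'(t)\le\Gamma_0(k+t)^{p-2}t$ and $\gamma_0(k+t)^{p-2}\le B''(t)\le\Gamma_0(k+t)^{p-2}$. (iv) $H\in C^{3,\beta_0}_{loc}(\mathbb R^n\setminus\{0\})$ is even and $H(\xi)>0$ for all $\xi\ne0$ (and $H(0)=0$). (v) $H(t\xi)=tH(\xi)$ for all $\xi\in\mathbb R^n\setminus\{0\}$ and $t>0$. (vi) The set $\{H<1\}$ is uniformly convex: there is $\lambda>0$ with $\langle D^2H(\xi)v,v\rangle\ge\lambda|v|^2$ for all $\xi$ with $H(\xi)=1$ and all $v\in\nabla H(\xi)^\perp$. (vii) $f$ is a positive continuous function on $[0,\infty)$, locally Lipschitz continuous on $(0,\infty)$. (viii) There exist $\delta>0$ and $g\in C^0([0,+\infty))$, non-decreasing on $(0,\delta)$, with $g(0)=0$, $f+g\ge0$, and either $g=0$ on $[0,d]$ for some $d>0$, or $\int_0^\delta\frac{ds}{L^{-1}(G(s))}=+\infty$, where $G(s)=\int_0^s g(t)\,dt$ and $L(s)=sB'(s)-B(s)$. Weak solution: $\int_\Omega B'(H(\nabla u))\langle\nabla H(\nabla u),\nabla\psi\rangle\,dx=\int_\Omega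 f(u)\psi\,dx$ for all $\psi\in C^1_c(\Omega)$, where $B'(H(\nabla u))\nabla H(\nabla u)$ is understood to be $0$ where $\nabla u=0$. The integrand is understood as $+\infty$ at points where $k+|\nabla u|=0$ if $t>0$. $\Omega'\subset\subset\Omega$ means that $\overline{\Omega'}$ is a compact subset of $\Omega$. *)

theory Defs
  imports "HOL-Analysis.Analysis" "HOL-Probability.Essential_Supremum"
begin

text \<open>Regularity classes on an open set \<open>S\<close>. They are defined by recursion on the order through
  directional derivatives, so that no type of multilinear forms is needed.\<close>

fun Ck_on :: "nat \<Rightarrow> 'a::euclidean_space set \<Rightarrow> ('a \<Rightarrow> 'b::real_normed_vector) \<Rightarrow> bool" where
  "Ck_on 0 S f \<longleftrightarrow> continuous_on S f"
| "Ck_on (Suc m) S f \<longleftrightarrow> (\<forall>x\<in>S. f differentiable (at x)) \<and>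
     (\<forall>v. Ck_on m S (\<lambda>x. frechet_derivative f (at x) v))"

definition smooth_on :: "'a::euclidean_space set \<Rightarrow> ('a \<Rightarrow> 'b::real_normed_vector) \<Rightarrow> bool" where
  "smooth_on S f \<longleftrightarrow> (\<forall>m. Ck_on m S f)"

definition holder_on :: "real \<Rightarrow> 'a::metric_space set \<Rightarrow> ('a \<Rightarrow> 'b::metric_space) \<Rightarrow> bool" where
  "holder_on \<beta> K f \<longleftrightarrow> (\<exists>c. \<forall>x\<in>K. \<forall>y\<in>K. dist (f x) (f y) \<le> c * dist x y powr \<beta>)"

fun Ck_holder_loc ::
    "nat \<Rightarrow> real \<Rightarrow> 'a::euclidean_space set \<Rightarrow> ('a \<Rightarrow> 'b::real_normed_vector) \<Rightarrow> bool" where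
  "Ck_holder_loc 0 \<beta> S f \<longleftrightarrow> (\<forall>K. compact K \<and> K \<subseteq> S \<longrightarrow> holder_on \<beta> K f)"
| "Ck_holder_loc (Suc m) \<beta> S f \<longleftrightarrow> (\<forall>x\<in>S. f differentiable (at x)) \<and>
     (\<forall>v. Ck_holder_loc m \<beta> S (\<lambda>x. frechet_derivative f (at x) v))"

definition locally_lipschitz_on ::
    "'a::metric_space set \<Rightarrow> ('a \<Rightarrow> 'b::metric_space) \<Rightarrow> bool" where
  "locally_lipschitz_on S f \<longleftrightarrow> (\<forall>K. compact K \<and> K \<subseteq> S \<longrightarrow> (\<exists>L. L-lipschitz_on K f))"

definition gradient :: "('a::euclidean_space \<Rightarrow> real) \<Rightarrow> 'a \<Rightarrow> 'a" where
  "gradient f x = (\<Sum>b\<in>Basis. frechet_derivative f (at x) b *\<^sub>R b)"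

definition C1_closure :: "'a::euclidean_space set \<Rightarrow> ('a \<Rightarrow> real) \<Rightarrow> bool" where
  "C1_closure \<Omega> u \<longleftrightarrow> continuous_on (closure \<Omega>) u \<and> (\<forall>x\<in>\<Omega>. u differentiable (at x)) \<and>
     (\<exists>w. continuous_on (closure \<Omega>) w \<and> (\<forall>x\<in>\<Omega>. w x = gradient u x))"

text \<open>Functions in \<open>C\<^sup>1\<^sub>c(\<Omega>)\<close> are extended by zero outside \<open>\<Omega>\<close>.\<close>

definition C1c :: "'a::euclidean_space set \<Rightarrow> ('a \<Rightarrow> real) \<Rightarrow> bool" where
  "C1c \<Omega> \<psi> \<longleftrightarrow> Ck_on 1 UNIV \<psi> \<and> compact (closure {x. \<psi> x \<noteq> 0}) \<and> closure {x. \<psi> x \<noteq> 0} \<subseteq> \<Omega>"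

text \<open>The boundary is smooth if it can locally be straightened by a smooth diffeomorphism \<open>\<phi>\<close>
  (with inverse \<open>\<phi>'\<close>) that takes \<open>\<Omega>\<close> to one side of the hyperplane orthogonal to \<open>e\<close>.\<close>

definition smooth_boundary :: "'a::euclidean_space set \<Rightarrow> bool" where
  "smooth_boundary \<Omega> \<longleftrightarrow> (\<forall>x\<in>frontier \<Omega>. \<exists>U V \<phi> \<phi>' e.
     open U \<and> x \<in> U \<and> open V \<and> norm (e::'a) = 1 \<and> homeomorphism U V \<phi> \<phi>' \<and>
     smooth_on U \<phi> \<and> smooth_on V \<phi>' \<and>
     \<phi> ` (U \<inter> \<Omega>) = V \<inter> {z. 0 < z \<bullet> e} \<and> \<phi> ` (U \<inter> frontier \<Omega>) = V \<inter> {z. z \<bullet> e = 0})"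

definition smooth_bounded_domain :: "'a::euclidean_space set \<Rightarrow> bool" where
  "smooth_bounded_domain \<Omega> \<longleftrightarrow>
     open \<Omega> \<and> connected \<Omega> \<and> \<Omega> \<noteq> {} \<and> bounded \<Omega> \<and> smooth_boundary \<Omega>"

definition compactly_contained :: "'a::topological_space set \<Rightarrow> 'a set \<Rightarrow> bool" where
  "compactly_contained A S \<longleftrightarrow> compact (closure A) \<and> closure A \<subseteq> S"

text \<open>Derivative of a function on \<open>[0, \<infinity>)\<close>: one-sided at \<open>0\<close>, the ordinary one elsewhere.
  The values of the function on the negative half-line are irrelevant.\<close>

definition hderiv :: "(real \<Rightarrow> real) \<Rightarrow> real \<Rightarrow> real" where
  "hderiv B t = vector_derivative B (at t within {0..})"

definition C1_halfline :: "(real \<Rightarrow> real) \<Rightarrow> bool" where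
  "C1_halfline B \<longleftrightarrow> (\<forall>t\<ge>0. B differentiable (at t within {0..})) \<and> continuous_on {0..} (hderiv B)"

definition uniformly_convex_unit_ball :: "('a::euclidean_space \<Rightarrow> real) \<Rightarrow> bool" where
  "uniformly_convex_unit_ball H \<longleftrightarrow> (\<exists>c>0. \<forall>\<xi> v. H \<xi> = 1 \<and> v \<bullet> gradient H \<xi> = 0 \<longrightarrow>
     frechet_derivative (gradient H) (at \<xi>) v \<bullet> v \<ge> c * (norm v)\<^sup>2)"

definition L_fun :: "(real \<Rightarrow> real) \<Rightarrow> real \<Rightarrow> real" where
  "L_fun B s = s * hderiv B s - B s"

text \<open>The last integral is the extended one of \<open>1 / L\<^sup>-\<^sup>1(G(s))\<close>; \<open>inverse 0 = \<infinity>\<close> in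
  \<^typ>\<open>ennreal\<close>.\<close>

definition admissible_lower_bound :: "(real \<Rightarrow> real) \<Rightarrow> (real \<Rightarrow> real) \<Rightarrow> bool" where
  "admissible_lower_bound B f \<longleftrightarrow> (\<exists>\<delta> g. \<delta> > 0 \<and> continuous_on {0..} g \<and> mono_on {0<..<\<delta>} g \<and>
     g 0 = 0 \<and> (\<forall>s\<ge>0. f s + g s \<ge> 0) \<and>
     ((\<exists>d>0. \<forall>s\<in>{0..d}. g s = 0) \<or>
      (\<integral>\<^sup>+s\<in>{0<..<\<delta>}.
         inverse (ennreal (inv_into {0..} (L_fun B) (integral {0..s} g))) \<partial>lborel) = \<infinity>))"

definition stress :: "(real \<Rightarrow> real) \<Rightarrow> ('a::euclidean_space \<Rightarrow> real) \<Rightarrow> 'a \<Rightarrow> 'a" where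
  "stress B H \<xi> = (if \<xi> = 0 then 0 else hderiv B (H \<xi>) *\<^sub>R gradient H \<xi>)"

definition weak_solution :: "(real \<Rightarrow> real) \<Rightarrow> ('a::euclidean_space \<Rightarrow> real) \<Rightarrow> (real \<Rightarrow> real) \<Rightarrow>
    'a set \<Rightarrow> ('a \<Rightarrow> real) \<Rightarrow> bool" where
  "weak_solution B H f \<Omega> u \<longleftrightarrow> (\<forall>\<psi>. C1c \<Omega> \<psi> \<longrightarrow>
     (LINT x:\<Omega>|lebesgue. stress B H (gradient u x) \<bullet> gradient \<psi> x) =
     (LINT x:\<Omega>|lebesgue. f (u x) * \<psi> x))"

text \<open>For functions that are differentiable in \<open>\<Omega>\<close> with locally bounded gradient, the weak gradient is the
  classical one. Both essential suprema are finite for functions of class \<open>C1_closure\<close> on a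
  bounded set, so the conversion to \<^typ>\<open>real\<close> loses nothing.\<close>

definition W1inf_norm :: "'a::euclidean_space set \<Rightarrow> ('a \<Rightarrow> real) \<Rightarrow> real" where
  "W1inf_norm \<Omega> u =
     real_of_ereal (esssup (lebesgue_on \<Omega>) (\<lambda>x. ereal \<bar>u x\<bar>)) +
     real_of_ereal (esssup (lebesgue_on \<Omega>) (\<lambda>x. ereal (norm (gradient u x))))"

text \<open>\<open>1 / a\<^sup>s\<close> for \<open>a \<ge> 0\<close> with the extended values at \<open>a = 0\<close>; \<open>powr\<close> alone would give
  \<open>0 powr 0 = 0\<close> and \<open>1 / 0 = 0\<close>.\<close>

definition inv_pow :: "real \<Rightarrow> real \<Rightarrow> ennreal" where
  "inv_pow a s =
     (if a = 0 then (if s > 0 then \<infinity> else if s = 0 then 1 else 0) else ennreal (1 / a powr s))"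

end

theory Submission
  imports Defs
begin

text \<open>If \<open>k > 0\<close> the factor \<open>(k + \<bar>\<nabla>u\<bar>)\<^sup>-\<^sup>t\<close> is bounded, so let \<open>k = 0\<close>. By homogeneity
  of \<open>H\<close> the stress field \<open>a\<close> then satisfies
  \<open>(a \<xi> - a \<eta>) \<bullet> (\<xi> - \<eta>) \<ge> c (\<bar>\<xi>\<bar> + \<bar>\<eta>\<bar>)\<^sup>p\<^sup>-\<^sup>2 \<bar>\<xi> - \<eta>\<bar>\<^sup>2\<close> and the matching Lipschitz bound. We may increase \<open>t\<close>
  and assume \<open>\<beta> = t + 2 - p \<in> (0, 1)\<close>. Let \<open>\<Phi>\<close> be a cutoff times \<open>\<bar>x - y\<bar>\<^sup>-\<^sup>\<gamma>\<close>, regularised.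
  Formally, differentiating the equation in direction \<open>i\<close> and testing with \<open>\<bar>u\<^sub>i\<bar>\<^sup>-\<^sup>\<beta> u\<^sub>i \<Phi>\<close> bounds
  \<open>\<integral> \<bar>\<nabla>u\<bar>\<^sup>p\<^sup>-\<^sup>2 \<bar>\<nabla>u\<^sub>i\<bar>\<^sup>2 \<bar>u\<^sub>i\<bar>\<^sup>-\<^sup>\<beta> \<Phi>\<close>; testing the equation with \<open>\<bar>\<nabla>u\<bar>\<^sup>-\<^sup>t \<Phi>\<close> and absorbing
  then bounds \<open>\<integral> f(u) \<bar>\<nabla>u\<bar>\<^sup>-\<^sup>t \<Phi>\<close>, and \<open>f\<close> is bounded below. No Sobolev regularity is needed:
  derivatives of \<open>u\<close> are replaced by difference quotients, which are of class \<open>C\<^sup>1\<close>, hence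
  give admissible test functions, and all test functions are cut off where \<open>\<bar>u\<^sub>i\<bar>\<close> is small, so
  that for a small step the two gradients in a difference quotient are comparable. The Lipschitz
  constant of \<open>f\<close> along \<open>u\<close> is under control because \<open>u\<close> has a positive lower bound on compact
  sets that depends only on its \<open>W\<^sup>1\<^sup>,\<^sup>\<infinity>\<close> norm.\<close>

section \<open>Integrals of continuous functions and Riesz kernels\<close>

lemma continuous_on_zero_extension:
  fixes F :: "'a::t2_space \<Rightarrow> 'b::real_normed_vector"
  assumes "open \<Omega>" "compact K" "K \<subseteq> \<Omega>" "continuous_on \<Omega> F" "\<And>x. x \<notin> K \<Longrightarrow> F x = 0"
  shows "continuous_on UNIV F"
proof -
  have "open (- K)" using assms(2) compact_imp_closed by blast
  moreover have "continuous_on (- K) F"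
    using assms(5) by (subst continuous_on_cong[where g = "\<lambda>_. 0"]) auto
  ultimately have "continuous_on (\<Omega> \<union> - K) F"
    using assms(1,4) by (intro continuous_on_open_Un)
  moreover have "\<Omega> \<union> - K = UNIV" using assms(3) by auto
  ultimately show ?thesis by simp
qed

lemma integrable_continuous_compact_support:
  fixes F :: "'a::euclidean_space \<Rightarrow> 'b::{banach, second_countable_topology}"
  assumes "compact K" "continuous_on UNIV F" "\<And>x. x \<notin> K \<Longrightarrow> F x = 0"
  shows "integrable lborel F"
proof -
  have "integrable lborel (\<lambda>x. indicator K x *\<^sub>R F x)"
    using assms borel_integrable_compact continuous_on_subset by blast
  moreover have "(\<lambda>x. indicator K x *\<^sub>R F x) = F"
    using assms(3) by (auto simp: indicator_def fun_eq_iff)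
  ultimately show ?thesis by simp
qed

lemma integral_lborel_translate:
  fixes F :: "'a::euclidean_space \<Rightarrow> real"
  assumes "F \<in> borel_measurable borel"
  shows "integral\<^sup>L lborel (\<lambda>x. F (x + d)) = integral\<^sup>L lborel F"
proof -
  have "integral\<^sup>L lborel F = integral\<^sup>L (distr lborel borel ((+) d)) F"
    by (simp add: lborel_distr_plus)
  also have "\<dots> = integral\<^sup>L lborel (\<lambda>x. F (d + x))"
    using assms by (intro integral_distr) auto
  finally show ?thesis by (simp add: add.commute)
qed

lemma nn_integral_lborel_translate:
  fixes F :: "'a::euclidean_space \<Rightarrow> ennreal"
  assumes "F \<in> borel_measurable borel"
  shows "(\<integral>\<^sup>+x. F (x + d) \<partial>lborel) = (\<integral>\<^sup>+x. F x \<partial>lborel)"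
proof -
  have "(\<integral>\<^sup>+x. F x \<partial>lborel) = (\<integral>\<^sup>+x. F x \<partial>distr lborel borel ((+) d))"
    by (simp add: lborel_distr_plus)
  also have "\<dots> = (\<integral>\<^sup>+x. F (d + x) \<partial>lborel)"
    using assms by (intro nn_integral_distr) auto
  finally show ?thesis by (simp add: add.commute)
qed

text \<open>Dyadic decomposition of the ball into shells.\<close>

lemma riesz_kernel_bound:
  fixes D \<alpha> :: real
  assumes "D > 0" "\<alpha> < DIM('a::euclidean_space)"
  obtains C where "C \<ge> 0"
    "\<And>y::'a. (\<integral>\<^sup>+x. indicator (cball y D) x * ennreal (norm (x - y) powr (-\<alpha>)) \<partial>lborel) \<le> ennreal C"
proof -
  define n where "n = real DIM('a)"
  define b where "b = max \<alpha> 0"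
  have n: "n > 0" "b < n" "b \<ge> 0" using assms(2) by (auto simp: n_def b_def)
  define V where "V = unit_ball_vol n"
  have V: "V \<ge> 0" unfolding V_def using n by simp
  define S where "S j = cball (0::'a) (D / 2^j)" for j :: nat
  define q where "q = 2 powr (b - n)"
  have q: "0 \<le> q" "q < 1" using n by (auto simp: q_def powr_less_one)
  define A where "A = max (D powr (b - \<alpha>)) 1 * (D/2) powr (-b) * V * D powr n"
  have A: "A \<ge> 0" using V by (auto simp: A_def intro!: mult_nonneg_nonneg)
  define F where "F j x = ennreal (max (D powr (b - \<alpha>)) 1 * (D / 2^Suc j) powr (-b)) * indicator (S j) x" for j :: nat and x :: 'a
  have S_meas: "S j \<in> sets lborel" for j by (simp add: S_def)
  have F_int: "(\<integral>\<^sup>+x. F j x \<partial>lborel) = ennreal (A * q^j)" for j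
  proof -
    have "emeasure lborel (S j) = ennreal (V * (D / 2^j) ^ DIM('a))"
      unfolding S_def V_def n_def using assms(1) by (subst emeasure_cball) auto
    hence "(\<integral>\<^sup>+x. F j x \<partial>lborel) =
        ennreal (max (D powr (b - \<alpha>)) 1 * (D / 2^Suc j) powr (-b)) * ennreal (V * (D / 2^j) ^ DIM('a))"
      unfolding F_def using S_meas by (simp add: nn_integral_cmult_indicator)
    also have "\<dots> = ennreal (max (D powr (b - \<alpha>)) 1 * (D / 2^Suc j) powr (-b) * (V * (D / 2^j) ^ DIM('a)))"
      using V assms(1) by (subst ennreal_mult) (auto intro!: mult_nonneg_nonneg)
    also have "max (D powr (b - \<alpha>)) 1 * (D / 2^Suc j) powr (-b) * (V * (D / 2^j) ^ DIM('a)) = A * q^j"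
    proof -
      have e1: "(D / 2^j) ^ DIM('a) = D powr n * 2 powr (-(n * j))"
      proof -
        have "(D / 2^j) ^ DIM('a) = (D * 2 powr (- real j)) powr n"
          using assms(1) by (simp add: n_def powr_realpow[symmetric] powr_minus divide_inverse)
        also have "\<dots> = D powr n * 2 powr (- real j * n)"
          using assms(1) by (simp add: powr_mult powr_powr)
        finally show ?thesis by (simp add: mult.commute)
      qed
      have e2: "(D / 2^Suc j) powr (-b) = (D/2) powr (-b) * 2 powr (b * j)"
      proof -
        have "D / 2^Suc j = (D/2) * 2 powr (- real j)"
          by (simp add: powr_minus powr_realpow field_simps)
        hence "(D / 2^Suc j) powr (-b) = (D/2) powr (-b) * (2 powr (- real j)) powr (-b)"
          using assms(1) powr_mult[of "D/2" "2 powr (- real j)" "-b"] by presburger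
        thus ?thesis by (simp add: powr_powr mult.commute)
      qed
      have e3: "q^j = 2 powr (b*j) * 2 powr (-(n*j))"
      proof -
        have "q^j = 2 powr ((b-n) * j)" unfolding q_def by (simp add: powr_realpow[symmetric] powr_powr)
        also have "(b-n) * j = b*j + (-(n*j))" by (simp add: algebra_simps)
        finally show ?thesis by (simp only: powr_add)
      qed
      show ?thesis unfolding e1 e2 e3 A_def by simp
    qed
    finally show ?thesis .
  qed
  have "(\<integral>\<^sup>+x. (\<Sum>j. F j x) \<partial>lborel) = (\<Sum>j. (\<integral>\<^sup>+x. F j x \<partial>lborel))"
    unfolding F_def using S_meas by (intro nn_integral_suminf) auto
  also have "\<dots> = (\<Sum>j. ennreal (A * q^j))" by (simp add: F_int)
  also have "\<dots> = ennreal (\<Sum>j. A * q^j)"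
    using q A by (intro suminf_ennreal2) (auto intro!: summable_mult summable_geometric)
  finally have tot: "(\<integral>\<^sup>+x. (\<Sum>j. F j x) \<partial>lborel) = ennreal (\<Sum>j. A * q^j)" .
  have pt: "indicator (cball 0 D) x * ennreal (norm x powr (-\<alpha>)) \<le> (\<Sum>j. F j x)" for x :: 'a
  proof (cases "x = 0 \<or> norm x > D")
    case True thus ?thesis by (auto simp: indicator_def)
  next
    case False
    hence x: "x \<noteq> 0" "norm x \<le> D" "norm x > 0" by auto
    have "\<exists>j. D / 2^Suc j < norm x \<and> norm x \<le> D / 2^j"
    proof -
      have "\<exists>j. D / 2^j < norm x"
      proof -
        obtain j where "(1/2::real)^j < norm x / D"
          using real_arch_pow_inv[of "norm x / D" "1/2"] x assms(1) by auto
        thus ?thesis using assms(1) by (intro exI[of _ j]) (simp add: field_simps power_one_over)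
      qed
      define J where "J = (LEAST j. D / 2^j < norm x)"
      have J: "D / 2^J < norm x" unfolding J_def using \<open>\<exists>j. D / 2^j < norm x\<close> by (rule LeastI_ex)
      have "J \<noteq> 0" using J x by (cases J) auto
      then obtain i where i: "J = Suc i" by (cases J) auto
      have "\<not> D / 2^i < norm x" using not_less_Least[of i "\<lambda>j. D / 2^j < norm x"] i J_def by simp
      thus ?thesis using J i by (intro exI[of _ i]) auto
    qed
    then obtain j where j: "D / 2^Suc j < norm x" "norm x \<le> D / 2^j" by blast
    have "norm x powr (-\<alpha>) = norm x powr (b-\<alpha>) * norm x powr (-b)" using x by (simp flip: powr_add)
    also have "\<dots> \<le> max (D powr (b - \<alpha>)) 1 * (D / 2^Suc j) powr (-b)"
    proof (rule mult_mono)
      show "norm x powr (b-\<alpha>) \<le> max (D powr (b - \<alpha>)) 1"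
      proof -
        have "norm x powr (b-\<alpha>) \<le> D powr (b-\<alpha>)" using x by (intro powr_mono2) (auto simp: b_def)
        thus ?thesis by simp
      qed
      show "norm x powr - b \<le> (D / 2 ^ Suc j) powr - b"
        using j n x assms(1) by (intro powr_mono2') auto
    qed auto
    finally have "ennreal (norm x powr (-\<alpha>)) \<le> F j x"
      using j(2) unfolding F_def S_def by (auto simp: indicator_def intro!: ennreal_leI)
    also have "F j x \<le> (\<Sum>j. F j x)"
      using sum_le_suminf[of "\<lambda>j. F j x" "{j}"] by simp
    finally show ?thesis using x by (simp add: indicator_def)
  qed
  have "(\<integral>\<^sup>+x. indicator (cball y D) x * ennreal (norm (x - y) powr (-\<alpha>)) \<partial>lborel) \<le> ennreal (\<Sum>j. A * q^j)"
    for y :: 'a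
  proof -
    have "(\<integral>\<^sup>+x. indicator (cball y D) x * ennreal (norm (x - y) powr (-\<alpha>)) \<partial>lborel)
        = (\<integral>\<^sup>+x. indicator (cball 0 D) (x + -y) * ennreal (norm (x + -y) powr (-\<alpha>)) \<partial>lborel)"
      by (intro nn_integral_cong) (auto simp: indicator_def dist_norm norm_minus_commute)
    also have "\<dots> = (\<integral>\<^sup>+(x::'a). indicator (cball 0 D) x * ennreal (norm x powr (-\<alpha>)) \<partial>lborel)"
      by (rule nn_integral_lborel_translate
          [of "\<lambda>x::'a. indicator (cball 0 D) x * ennreal (norm x powr (-\<alpha>))"])
        (intro borel_measurable_times_ennreal borel_measurable_indicator; measurable)
    also have "\<dots> \<le> (\<integral>\<^sup>+x. (\<Sum>j. F j x) \<partial>lborel)" by (intro nn_integral_mono pt)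
    finally show ?thesis by (simp add: tot)
  qed
  moreover have "(\<Sum>j. A * q^j) \<ge> 0" using A q by (intro suminf_nonneg) (auto intro!: summable_mult summable_geometric)
  ultimately show ?thesis using that by blast
qed

section \<open>Ellipticity of the stress field\<close>

lemma powr_comparable:
  fixes a b K e :: real
  assumes "K \<ge> 1" "a > 0" "a / K \<le> b" "b \<le> K * a"
  shows "b powr e \<le> K powr \<bar>e\<bar> * a powr e"
proof (cases "e \<ge> 0")
  case True
  have "b powr e \<le> (K * a) powr e"
    using assms True by (intro powr_mono2) (auto intro: order_trans[OF _ assms(3)])
  thus ?thesis using True assms by (simp add: powr_mult)
next
  case False
  have "b powr e \<le> (a / K) powr e" using assms False by (intro powr_mono2') auto
  also have "\<dots> = K powr \<bar>e\<bar> * a powr e"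
    using False assms by (simp add: powr_divide powr_minus field_simps)
  finally show ?thesis .
qed

lemma stress_bounds_of_derivative:
  fixes A :: "'a::euclidean_space \<Rightarrow> 'a"
  assumes p: "p > 1" and c: "c > 0" and C: "C \<ge> 0"
    and deriv: "\<And>\<xi>. \<xi> \<noteq> 0 \<Longrightarrow> (A has_derivative A' \<xi>) (at \<xi>)"
    and elliptic: "\<And>\<xi> v. \<xi> \<noteq> 0 \<Longrightarrow> c * norm \<xi> powr (p - 2) * (norm v)^2 \<le> A' \<xi> v \<bullet> v"
    and bounded: "\<And>\<xi> v. \<xi> \<noteq> 0 \<Longrightarrow> norm (A' \<xi> v) \<le> C * norm \<xi> powr (p - 2) * norm v"
    and A0: "A 0 = 0" and growth: "\<And>\<xi>. norm (A \<xi>) \<le> C * norm \<xi> powr (p - 1)"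
  shows "\<exists>c' > 0. \<exists>C' > 0. \<forall>\<xi> \<eta>.
      c' * (norm \<xi> + norm \<eta>) powr (p - 2) * (norm (\<xi> - \<eta>))^2 \<le> (A \<xi> - A \<eta>) \<bullet> (\<xi> - \<eta>) \<and>
      norm (A \<xi> - A \<eta>) \<le> C' * (norm \<xi> + norm \<eta>) powr (p - 2) * norm (\<xi> - \<eta>)"
proof -
  define K where "K = 4 powr \<bar>p - 2\<bar>"
  have K: "K \<ge> 1" unfolding K_def by (intro ge_one_powr_ge_zero) auto
  have along: "((\<lambda>s. A (\<eta> + s *\<^sub>R d) \<bullet> d) has_real_derivative A' (\<eta> + s *\<^sub>R d) d \<bullet> d) (at s)"
    if "\<eta> + s *\<^sub>R d \<noteq> 0" for \<eta> d s
  proof -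
    have "((\<lambda>s. \<eta> + s *\<^sub>R d) has_derivative (\<lambda>h. h *\<^sub>R d)) (at s)"
      by (auto intro!: derivative_eq_intros)
    from diff_chain_at[OF this deriv[OF that]]
    have "((\<lambda>s. A (\<eta> + s *\<^sub>R d)) has_derivative (\<lambda>h. A' (\<eta> + s *\<^sub>R d) (h *\<^sub>R d))) (at s)"
      by (simp add: o_def)
    hence "((\<lambda>s. A (\<eta> + s *\<^sub>R d) \<bullet> d) has_derivative (\<lambda>h. A' (\<eta> + s *\<^sub>R d) (h *\<^sub>R d) \<bullet> d)) (at s)"
      by (rule has_derivative_inner_left)
    moreover have "A' (\<eta> + s *\<^sub>R d) (h *\<^sub>R d) = h *\<^sub>R A' (\<eta> + s *\<^sub>R d) d" for h
      using has_derivative_linear[OF deriv[OF that]] by (simp add: linear_scale)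
    ultimately show ?thesis
      unfolding has_field_derivative_def by (elim has_derivative_eq_rhs) (simp add: fun_eq_iff mult.commute)
  qed
  have mono_avoid: "(A (P + d) - A P) \<bullet> d \<ge> 0" if "\<And>s. 0 \<le> s \<Longrightarrow> s \<le> 1 \<Longrightarrow> P + s *\<^sub>R d \<noteq> 0" for P d
  proof -
    have "\<exists>z>0. z < 1 \<and> A (P + 1 *\<^sub>R d) \<bullet> d - A (P + 0 *\<^sub>R d) \<bullet> d = (1 - 0) * (A' (P + z *\<^sub>R d) d \<bullet> d)"
      by (rule MVT2[of 0 1 "\<lambda>s. A (P + s *\<^sub>R d) \<bullet> d" "\<lambda>s. A' (P + s *\<^sub>R d) d \<bullet> d"])
        (use that in \<open>auto intro!: along\<close>)
    then obtain z where "z > 0" "z < 1" "A (P + d) \<bullet> d - A P \<bullet> d = A' (P + z *\<^sub>R d) d \<bullet> d" by auto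
    moreover have "A' (P + z *\<^sub>R d) d \<bullet> d \<ge> 0"
      using c by (intro order_trans[OF _ elliptic] that mult_nonneg_nonneg)
        (use \<open>z > 0\<close> \<open>z < 1\<close> in auto)
    ultimately show ?thesis by (simp add: inner_diff_left)
  qed
  have radial: "A \<xi> \<bullet> \<xi> \<ge> 0" for \<xi>
  proof (cases "\<xi> = 0")
    case False
    have "((\<lambda>t. C * (t * norm \<xi>) powr (p - 1)) \<longlongrightarrow> C * (0 * norm \<xi>) powr (p - 1)) (at_right 0)"
      using p False
      by (intro tendsto_intros tendsto_powr') (auto simp: eventually_at_filter)
    hence "((\<lambda>t. C * (t * norm \<xi>) powr (p - 1)) \<longlongrightarrow> 0) (at_right 0)" by simp
    hence "((\<lambda>t. A (t *\<^sub>R \<xi>)) \<longlongrightarrow> 0) (at_right 0)"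
      by (rule Lim_null_comparison[rotated])
        (auto simp: eventually_at_filter intro!: always_eventually order_trans[OF growth])
    hence lim: "((\<lambda>t. (A \<xi> - A (t *\<^sub>R \<xi>)) \<bullet> \<xi>) \<longlongrightarrow> (A \<xi> - 0) \<bullet> \<xi>) (at_right 0)"
      by (intro tendsto_intros)
    have "eventually (\<lambda>t::real. 0 < t \<and> t < 1) (at_right 0)"
      using eventually_at_right_real[of 0 1] by (simp add: eventually_conj_iff)
    hence "eventually (\<lambda>t. 0 \<le> (A \<xi> - A (t *\<^sub>R \<xi>)) \<bullet> \<xi>) (at_right 0)"
    proof eventually_elim
      case (elim t)
      have "(A (t *\<^sub>R \<xi> + (1 - t) *\<^sub>R \<xi>) - A (t *\<^sub>R \<xi>)) \<bullet> ((1 - t) *\<^sub>R \<xi>) \<ge> 0"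
      proof (rule mono_avoid)
        fix s :: real assume s: "0 \<le> s" "s \<le> 1"
        have "t *\<^sub>R \<xi> + s *\<^sub>R (1 - t) *\<^sub>R \<xi> = (t + s * (1 - t)) *\<^sub>R \<xi>" by (simp add: scaleR_add_left)
        moreover have "t + s * (1 - t) > 0" using elim s by (intro add_pos_nonneg) auto
        ultimately show "t *\<^sub>R \<xi> + s *\<^sub>R (1 - t) *\<^sub>R \<xi> \<noteq> 0" using False by simp
      qed
      moreover have "t *\<^sub>R \<xi> + (1 - t) *\<^sub>R \<xi> = \<xi>" by (simp flip: scaleR_add_left)
      ultimately show ?case using elim by (simp add: zero_le_mult_iff)
    qed
    from tendsto_lowerbound[OF lim this] show ?thesis by simp
  qed simp
  have mono: "(A (P + d) - A P) \<bullet> d \<ge> 0" for P d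
  proof (cases "\<exists>s. 0 \<le> s \<and> s \<le> 1 \<and> P + s *\<^sub>R d = 0")
    case True
    then obtain s where s: "0 \<le> s" "s \<le> 1" "P + s *\<^sub>R d = 0" by blast
    have P: "P = -(s *\<^sub>R d)" using s(3) by (simp add: eq_neg_iff_add_eq_0)
    have Q: "P + d = (1 - s) *\<^sub>R d" unfolding P by (simp add: scaleR_left_diff_distrib)
    have 1: "A (P + d) \<bullet> d \<ge> 0"
    proof (cases "s = 1")
      case False
      thus ?thesis using radial[of "P + d"] s unfolding Q by (simp add: zero_le_mult_iff)
    qed (simp add: Q A0)
    have 2: "A P \<bullet> d \<le> 0"
    proof (cases "s = 0")
      case False
      thus ?thesis using radial[of P] s unfolding P by (simp add: mult_le_0_iff)
    qed (simp add: P A0)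
    show ?thesis using 1 2 by (simp add: inner_diff_left)
  qed (use mono_avoid in blast)
  have lower: "c / (4 * K) * (norm \<xi> + norm \<eta>) powr (p - 2) * (norm (\<xi> - \<eta>))^2 \<le> (A \<xi> - A \<eta>) \<bullet> (\<xi> - \<eta>)"
    if le: "norm \<xi> \<le> norm \<eta>" for \<xi> \<eta>
  proof (cases "\<eta> = 0")
    case False
    define d where "d = \<xi> - \<eta>"
    have nd: "norm d \<le> 2 * norm \<eta>" unfolding d_def using norm_triangle_ineq4[of \<xi> \<eta>] le by simp
    have near: "norm \<eta> / 2 \<le> norm (\<eta> + s *\<^sub>R d)" "norm (\<eta> + s *\<^sub>R d) \<le> 2 * norm \<eta>"
      if "0 \<le> s" "s \<le> 1/4" for s
    proof -
      have "norm (s *\<^sub>R d) \<le> norm \<eta> / 2"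
        using mult_mono[of s "1/4" "norm d" "2 * norm \<eta>"] that nd by simp
      thus "norm \<eta> / 2 \<le> norm (\<eta> + s *\<^sub>R d)" "norm (\<eta> + s *\<^sub>R d) \<le> 2 * norm \<eta>"
        using norm_triangle_ineq[of \<eta> "s *\<^sub>R d"] norm_diff_triangle_ineq[of \<eta> "s *\<^sub>R d" 0 0]
          norm_triangle_ineq2[of \<eta> "-(s *\<^sub>R d)"] norm_ge_zero[of \<eta>] by auto
    qed
    have "\<exists>z>0. z < 1/4 \<and> A (\<eta> + (1/4) *\<^sub>R d) \<bullet> d - A (\<eta> + 0 *\<^sub>R d) \<bullet> d = (1/4 - 0) * (A' (\<eta> + z *\<^sub>R d) d \<bullet> d)"
    proof (rule MVT2[of 0 "1/4" "\<lambda>s. A (\<eta> + s *\<^sub>R d) \<bullet> d" "\<lambda>s. A' (\<eta> + s *\<^sub>R d) d \<bullet> d"])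
      fix s :: real assume "0 \<le> s" "s \<le> 1/4"
      hence "\<eta> + s *\<^sub>R d \<noteq> 0" using near(1)[of s] False by auto
      thus "((\<lambda>s. A (\<eta> + s *\<^sub>R d) \<bullet> d) has_real_derivative A' (\<eta> + s *\<^sub>R d) d \<bullet> d) (at s)" by (rule along)
    qed simp
    then obtain z where z: "z > 0" "z < 1/4"
      "A (\<eta> + (1/4) *\<^sub>R d) \<bullet> d - A \<eta> \<bullet> d = (1/4) * (A' (\<eta> + z *\<^sub>R d) d \<bullet> d)" by auto
    have nz: "\<eta> + z *\<^sub>R d \<noteq> 0" using near(1)[of z] z False by auto
    have "(norm \<xi> + norm \<eta>) powr (p - 2) \<le> K * norm (\<eta> + z *\<^sub>R d) powr (p - 2)"
      unfolding K_def using near[of z] z le False norm_ge_zero[of \<xi>] zero_less_norm_iff[of \<eta>]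
      by (intro powr_comparable) linarith+
    hence "c / (4 * K) * (norm \<xi> + norm \<eta>) powr (p - 2) * (norm d)^2
        \<le> c / (4 * K) * (K * norm (\<eta> + z *\<^sub>R d) powr (p - 2)) * (norm d)^2"
      using c K by (intro mult_right_mono mult_left_mono) auto
    also have "\<dots> = (1/4) * (c * norm (\<eta> + z *\<^sub>R d) powr (p - 2) * (norm d)^2)" using K by simp
    also have "\<dots> \<le> (A (\<eta> + (1/4) *\<^sub>R d) - A \<eta>) \<bullet> d"
      using elliptic[OF nz, of d] z(3) by (simp add: inner_diff_left)
    also have "\<dots> \<le> (A \<xi> - A \<eta>) \<bullet> d"
    proof -
      have "(A ((\<eta> + (1/4) *\<^sub>R d) + (3/4) *\<^sub>R d) - A (\<eta> + (1/4) *\<^sub>R d)) \<bullet> ((3/4) *\<^sub>R d) \<ge> 0" by (rule mono)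
      moreover have "(\<eta> + (1/4) *\<^sub>R d) + (3/4) *\<^sub>R d = \<xi>"
        by (simp add: d_def algebra_simps flip: scaleR_add_left)
      ultimately have "(A \<xi> - A (\<eta> + (1/4) *\<^sub>R d)) \<bullet> d \<ge> 0" by simp
      thus ?thesis by (simp add: inner_diff_left)
    qed
    finally show ?thesis by (simp add: d_def)
  qed (use le in simp)
  have upper: "norm (A \<xi> - A \<eta>) \<le> 4 * K * (C + 1) * (norm \<xi> + norm \<eta>) powr (p - 2) * norm (\<xi> - \<eta>)"
    if le: "norm \<xi> \<le> norm \<eta>" for \<xi> \<eta>
  proof (cases "\<eta> = 0")
    case False
    hence \<eta>: "norm \<eta> > 0" by simp
    have cmp: "b powr (p - 2) \<le> K * (norm \<xi> + norm \<eta>) powr (p - 2)"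
      if "norm \<eta> / 2 \<le> b" "b \<le> 2 * norm \<eta>" for b
      unfolding K_def
    proof (rule powr_comparable)
      show "(norm \<xi> + norm \<eta>) / 4 \<le> b" "b \<le> 4 * (norm \<xi> + norm \<eta>)" "0 < norm \<xi> + norm \<eta>"
        using that le \<eta> norm_ge_zero[of \<xi>] by argo+
    qed simp
    show ?thesis
    proof (cases "norm (\<xi> - \<eta>) \<ge> norm \<eta> / 2")
      case True
      have "norm (A \<xi> - A \<eta>) \<le> C * norm \<xi> powr (p - 1) + C * norm \<eta> powr (p - 1)"
        by (rule order_trans[OF norm_triangle_ineq4]) (intro add_mono growth)
      also have "\<dots> \<le> C * norm \<eta> powr (p - 1) + C * norm \<eta> powr (p - 1)"
        using p C le by (intro add_mono mult_left_mono powr_mono2) auto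
      also have "\<dots> = 2 * C * (norm \<eta> powr (p - 2) * norm \<eta>)"
        using powr_add[of "norm \<eta>" "p - 2" 1] \<eta> by simp
      also have "\<dots> \<le> 2 * C * ((K * (norm \<xi> + norm \<eta>) powr (p - 2)) * (2 * norm (\<xi> - \<eta>)))"
        using C K cmp[of "norm \<eta>"] True by (intro mult_left_mono mult_mono) auto
      also have "\<dots> \<le> 4 * K * (C + 1) * (norm \<xi> + norm \<eta>) powr (p - 2) * norm (\<xi> - \<eta>)"
        using K by (simp add: algebra_simps)
      finally show ?thesis .
    next
      case False
      have seg: "norm \<eta> / 2 \<le> norm z" "norm z \<le> 2 * norm \<eta>" if "z \<in> closed_segment \<xi> \<eta>" for z
      proof -
        have "norm (z - \<eta>) \<le> norm (\<xi> - \<eta>)"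
          using segment_bound(2)[OF that] by (simp add: norm_minus_commute)
        hence "norm (z - \<eta>) \<le> norm \<eta> / 2" using False by simp
        thus "norm \<eta> / 2 \<le> norm z" "norm z \<le> 2 * norm \<eta>"
          using norm_triangle_ineq2[of \<eta> z] norm_triangle_ineq2[of z \<eta>]
          by (auto simp: norm_minus_commute)
      qed
      have "norm (A \<xi> - A \<eta>) \<le> (C * (K * (norm \<xi> + norm \<eta>) powr (p - 2))) * norm (\<xi> - \<eta>)"
      proof (rule differentiable_bound[of "closed_segment \<xi> \<eta>" A A'])
        fix z assume z: "z \<in> closed_segment \<xi> \<eta>"
        have nz: "z \<noteq> 0" using seg(1)[OF z] \<eta> by auto
        show "(A has_derivative A' z) (at z within closed_segment \<xi> \<eta>)"
          by (rule has_derivative_at_withinI[OF deriv[OF nz]])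
        show "onorm (A' z) \<le> C * (K * (norm \<xi> + norm \<eta>) powr (p - 2))"
        proof (rule onorm_bound)
          fix v
          have "norm (A' z v) \<le> C * norm z powr (p - 2) * norm v" by (rule bounded[OF nz])
          also have "\<dots> \<le> C * (K * (norm \<xi> + norm \<eta>) powr (p - 2)) * norm v"
            using C cmp[OF seg[OF z]] by (intro mult_right_mono mult_left_mono) auto
          finally show "norm (A' z v) \<le> C * (K * (norm \<xi> + norm \<eta>) powr (p - 2)) * norm v" .
        qed (use C K in auto)
      qed auto
      also have "\<dots> \<le> 4 * K * (C + 1) * (norm \<xi> + norm \<eta>) powr (p - 2) * norm (\<xi> - \<eta>)"
      proof -
        have "C * K \<le> 4 * K * (C + 1)" using C K by (simp add: algebra_simps)
        thus ?thesis using mult_right_mono[of "C * K" "4 * K * (C + 1)" "(norm \<xi> + norm \<eta>) powr (p - 2) * norm (\<xi> - \<eta>)"]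
          by (simp add: mult.assoc)
      qed
      finally show ?thesis .
    qed
  qed (use le in simp)
  have "c / (4 * K) * (norm \<xi> + norm \<eta>) powr (p - 2) * (norm (\<xi> - \<eta>))^2 \<le> (A \<xi> - A \<eta>) \<bullet> (\<xi> - \<eta>)" for \<xi> \<eta>
  proof (cases "norm \<xi> \<le> norm \<eta>")
    case False
    thus ?thesis using lower[of \<eta> \<xi>]
      by (simp add: add.commute norm_minus_commute inner_diff_left inner_diff_right)
  qed (rule lower)
  moreover have "norm (A \<xi> - A \<eta>) \<le> 4 * K * (C + 1) * (norm \<xi> + norm \<eta>) powr (p - 2) * norm (\<xi> - \<eta>)" for \<xi> \<eta>
  proof (cases "norm \<xi> \<le> norm \<eta>")
    case False
    thus ?thesis using upper[of \<eta> \<xi>] by (simp add: add.commute norm_minus_commute)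
  qed (rule upper)
  moreover have "c / (4 * K) > 0" "4 * K * (C + 1) > 0" using c C K by auto
  ultimately show ?thesis by blast
qed

lemma differentiable_iff_GDERIV_gradient:
  "(f differentiable (at x)) \<longleftrightarrow> GDERIV f x :> gradient f x"
proof
  assume "f differentiable (at x)"
  hence d: "(f has_derivative frechet_derivative f (at x)) (at x)" by (simp add: frechet_derivative_works)
  hence lin: "linear (frechet_derivative f (at x))" by (rule has_derivative_linear)
  have "frechet_derivative f (at x) h = h \<bullet> gradient f x" for h
  proof -
    have "frechet_derivative f (at x) h = frechet_derivative f (at x) (\<Sum>b\<in>Basis. (h \<bullet> b) *\<^sub>R b)"
      by (simp add: euclidean_representation)
    also have "\<dots> = (\<Sum>b\<in>Basis. (h \<bullet> b) * frechet_derivative f (at x) b)"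
      by (simp add: linear_sum[OF lin] linear_scale[OF lin])
    also have "\<dots> = h \<bullet> gradient f x"
      by (simp add: gradient_def inner_sum_right mult.commute)
    finally show ?thesis .
  qed
  thus "GDERIV f x :> gradient f x"
    using d unfolding gderiv_def by (elim has_derivative_eq_rhs) auto
qed (auto simp: gderiv_def differentiable_def)

lemma GDERIV_unique: "GDERIV f x :> a \<Longrightarrow> GDERIV f x :> b \<Longrightarrow> a = b"
  unfolding gderiv_def by (metis has_derivative_unique vector_eq_rdot inner_commute)

lemma gradient_eq: "GDERIV f x :> a \<Longrightarrow> gradient f x = a"
  using GDERIV_unique differentiable_iff_GDERIV_gradient by (metis differentiableI gderiv_def)

lemma frechet_derivative_GDERIV: "GDERIV f x :> a \<Longrightarrow> frechet_derivative f (at x) v = v \<bullet> a"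
  unfolding gderiv_def by (metis frechet_derivative_at)

lemma hderiv_eq_deriv:
  assumes "(B has_real_derivative D) (at s)" "s > 0"
  shows "hderiv B s = D"
proof -
  have "at s within {0..} = at s" using assms(2) by (intro at_within_interior) auto
  thus ?thesis unfolding hderiv_def using assms(1)
    by (simp add: has_real_derivative_iff_has_vector_derivative vector_derivative_at)
qed

lemma hderiv_has_derivative:
  assumes "Ck_holder_loc 3 \<beta> {0<..} (B :: real \<Rightarrow> real)" "s > 0"
  shows "(B has_real_derivative hderiv B s) (at s)"
    and "(hderiv B has_real_derivative hderiv (hderiv B) s) (at s)"
proof -
  have c3: "x > 0 \<Longrightarrow> B differentiable (at x)"
    "Ck_holder_loc 2 \<beta> {0<..} (\<lambda>x. frechet_derivative B (at x) 1)" for x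
    using assms(1) by (auto simp: eval_nat_numeral)
  have B1: "(B has_real_derivative hderiv B x) (at x)" "frechet_derivative B (at x) 1 = hderiv B x" if x: "x > 0" for x
  proof -
    obtain D where D: "(B has_real_derivative D) (at x)"
      using c3(1)[OF x] real_differentiable_def by blast
    show "(B has_real_derivative hderiv B x) (at x)" using D hderiv_eq_deriv[OF D x] by simp
    thus "frechet_derivative B (at x) 1 = hderiv B x"
      by (metis frechet_derivative_at has_field_derivative_def mult.right_neutral)
  qed
  show "(B has_real_derivative hderiv B s) (at s)" by (rule B1(1)[OF assms(2)])
  have "(\<lambda>x. frechet_derivative B (at x) 1) differentiable (at s)"
    using c3(2) assms(2) by (auto simp: eval_nat_numeral)
  then obtain D where "((\<lambda>x. frechet_derivative B (at x) 1) has_real_derivative D) (at s)"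
    using real_differentiable_def by blast
  hence D: "(hderiv B has_real_derivative D) (at s)"
    by (rule has_field_derivative_transform_within_open[where S = "{0<..}"])
      (use assms(2) B1(2) in auto)
  thus "(hderiv B has_real_derivative hderiv (hderiv B) s) (at s)"
    using hderiv_eq_deriv[OF D assms(2)] by simp
qed

lemma bounded_on_unit_sphere:
  fixes F :: "'a::euclidean_space \<Rightarrow> 'b::real_normed_vector"
  assumes "continuous_on (UNIV - {0}) F"
  obtains M where "M > 0" "\<And>\<xi>. norm \<xi> = 1 \<Longrightarrow> norm (F \<xi>) \<le> M"
proof -
  have "continuous_on (sphere 0 1) F" using assms by (rule continuous_on_subset) auto
  hence "bounded (F ` sphere 0 1)" by (intro compact_imp_bounded compact_continuous_image) auto
  then obtain M where "M > 0" "\<And>x. x \<in> F ` sphere 0 1 \<Longrightarrow> norm x \<le> M" using bounded_pos by metis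
  thus ?thesis using that by auto
qed

locale smooth_gauge =
  fixes H :: "'a::euclidean_space \<Rightarrow> real" and \<beta> :: real
  assumes regular: "Ck_holder_loc 3 \<beta> (UNIV - {0}) H"
    and pos: "\<And>\<xi>. \<xi> \<noteq> 0 \<Longrightarrow> H \<xi> > 0"
    and homogeneous: "\<And>\<xi> s. \<xi> \<noteq> 0 \<Longrightarrow> s > 0 \<Longrightarrow> H (s *\<^sub>R \<xi>) = s * H \<xi>"
    and convex: "uniformly_convex_unit_ball H"
begin

definition hess :: "'a \<Rightarrow> 'a \<Rightarrow> 'a" where
  "hess \<xi> = frechet_derivative (gradient H) (at \<xi>)"

lemma H_GDERIV: "\<xi> \<noteq> 0 \<Longrightarrow> GDERIV H \<xi> :> gradient H \<xi>"
  using regular differentiable_iff_GDERIV_gradient[of H \<xi>] by (auto simp: eval_nat_numeral)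

lemma partial_differentiable:
  "\<xi> \<noteq> 0 \<Longrightarrow> (\<lambda>x. frechet_derivative H (at x) b) differentiable (at \<xi>)"
  "\<xi> \<noteq> 0 \<Longrightarrow> (\<lambda>x. frechet_derivative (\<lambda>x. frechet_derivative H (at x) b) (at x) v) differentiable (at \<xi>)"
  using regular by (auto simp: eval_nat_numeral)

lemma gradient_has_derivative_partial:
  assumes "\<xi> \<noteq> 0"
  shows "(gradient H has_derivative (\<lambda>v. \<Sum>b\<in>Basis. frechet_derivative (\<lambda>x. frechet_derivative H (at x) b) (at \<xi>) v *\<^sub>R b)) (at \<xi>)"
  unfolding gradient_def[abs_def]
  using partial_differentiable(1)[OF assms]
  by (intro has_derivative_sum has_derivative_scaleR_left) (simp add: frechet_derivative_works)

lemma hess_eq: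
  assumes "\<xi> \<noteq> 0"
  shows "hess \<xi> v = (\<Sum>b\<in>Basis. frechet_derivative (\<lambda>x. frechet_derivative H (at x) b) (at \<xi>) v *\<^sub>R b)"
  unfolding hess_def by (simp add: frechet_derivative_at[OF gradient_has_derivative_partial[OF assms], symmetric])

lemma gradient_has_derivative: "\<xi> \<noteq> 0 \<Longrightarrow> (gradient H has_derivative hess \<xi>) (at \<xi>)"
  unfolding hess_def using gradient_has_derivative_partial differentiableI frechet_derivative_works by blast

lemma continuous_on_gradient: "continuous_on (UNIV - {0}) (gradient H)"
  by (intro continuous_at_imp_continuous_on ballI has_derivative_continuous[OF gradient_has_derivative]) auto

lemma continuous_on_hess: "continuous_on (UNIV - {0}) (\<lambda>\<xi>. hess \<xi> v)"
proof -
  have "continuous_on (UNIV - {0}) (\<lambda>\<xi>. \<Sum>b\<in>Basis. frechet_derivative (\<lambda>x. frechet_derivative H (at x) b) (at \<xi>) v *\<^sub>R b)"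
    by (intro continuous_intros continuous_at_imp_continuous_on ballI differentiable_imp_continuous_within
        partial_differentiable) auto
  thus ?thesis by (subst continuous_on_cong[OF refl hess_eq]) auto
qed

lemma continuous_on_H: "continuous_on (UNIV - {0}) H"
proof (intro continuous_at_imp_continuous_on ballI)
  fix x :: 'a assume "x \<in> UNIV - {0}"
  thus "isCont H x" using H_GDERIV[of x] unfolding gderiv_def by (auto intro: has_derivative_continuous)
qed

lemma gradient_scale:
  assumes "\<xi> \<noteq> 0" "s > 0"
  shows "gradient H (s *\<^sub>R \<xi>) = gradient H \<xi>"
proof -
  have "s *\<^sub>R \<xi> \<noteq> 0" using assms by simp
  hence "(H has_derivative (\<lambda>h. h \<bullet> gradient H (s *\<^sub>R \<xi>))) (at (s *\<^sub>R \<xi>))"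
    using H_GDERIV unfolding gderiv_def by blast
  from has_derivative_compose[OF bounded_linear.has_derivative[OF bounded_linear_scaleR_right has_derivative_ident] this]
  have "((\<lambda>x. H (s *\<^sub>R x)) has_derivative (\<lambda>h. (s *\<^sub>R h) \<bullet> gradient H (s *\<^sub>R \<xi>))) (at \<xi>)"
    .
  hence "((\<lambda>x. s * H x) has_derivative (\<lambda>h. (s *\<^sub>R h) \<bullet> gradient H (s *\<^sub>R \<xi>))) (at \<xi>)"
    by (rule has_derivative_transform_within_open[where s = "UNIV - {0}"])
      (use assms homogeneous in auto)
  hence 1: "((\<lambda>x. (1/s) * (s * H x)) has_derivative (\<lambda>h. (1/s) * ((s *\<^sub>R h) \<bullet> gradient H (s *\<^sub>R \<xi>)))) (at \<xi>)"
    by (rule has_derivative_mult_right)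
  have "GDERIV H \<xi> :> gradient H (s *\<^sub>R \<xi>)"
    using 1 assms unfolding gderiv_def by simp
  thus ?thesis using H_GDERIV[OF assms(1)] GDERIV_unique by blast
qed

lemma hess_scale:
  assumes "\<xi> \<noteq> 0" "s > 0"
  shows "hess (s *\<^sub>R \<xi>) v = (1 / s) *\<^sub>R hess \<xi> v"
proof -
  have "s *\<^sub>R \<xi> \<noteq> 0" using assms by simp
  hence "(gradient H has_derivative hess (s *\<^sub>R \<xi>)) (at (s *\<^sub>R \<xi>))" by (rule gradient_has_derivative)
  from has_derivative_compose[OF bounded_linear.has_derivative[OF bounded_linear_scaleR_right has_derivative_ident] this]
  have "((\<lambda>x. gradient H (s *\<^sub>R x)) has_derivative (\<lambda>h. hess (s *\<^sub>R \<xi>) (s *\<^sub>R h))) (at \<xi>)"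
    .
  hence "(gradient H has_derivative (\<lambda>h. hess (s *\<^sub>R \<xi>) (s *\<^sub>R h))) (at \<xi>)"
    by (rule has_derivative_transform_within_open[where s = "UNIV - {0}"])
      (use assms gradient_scale in auto)
  hence "hess \<xi> = (\<lambda>h. hess (s *\<^sub>R \<xi>) (s *\<^sub>R h))"
    using gradient_has_derivative[OF assms(1)] has_derivative_unique by blast
  moreover have "linear (hess (s *\<^sub>R \<xi>))"
    using gradient_has_derivative[OF \<open>s *\<^sub>R \<xi> \<noteq> 0\<close>] by (rule has_derivative_linear)
  ultimately show ?thesis using assms(2) by (simp add: linear_scale)
qed

lemma euler: "\<xi> \<noteq> 0 \<Longrightarrow> \<xi> \<bullet> gradient H \<xi> = H \<xi>"
proof -
  assume \<xi>: "\<xi> \<noteq> 0"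
  have ray: "((\<lambda>s::real. s *\<^sub>R \<xi>) has_derivative (\<lambda>h. h *\<^sub>R \<xi>)) (at 1)" by (auto intro!: derivative_eq_intros)
  have "(H has_derivative (\<lambda>h. h \<bullet> gradient H \<xi>)) (at (1 *\<^sub>R \<xi>))"
    using H_GDERIV[OF \<xi>] unfolding gderiv_def by simp
  from has_derivative_compose[OF ray this] have "((\<lambda>s. H (s *\<^sub>R \<xi>)) has_derivative (\<lambda>h. (h *\<^sub>R \<xi>) \<bullet> gradient H \<xi>)) (at 1)"
    .
  hence "((\<lambda>s. s * H \<xi>) has_derivative (\<lambda>h. (h *\<^sub>R \<xi>) \<bullet> gradient H \<xi>)) (at (1::real))"
    by (rule has_derivative_transform_within_open[where s = "{0<..}"]) (use \<xi> homogeneous in auto)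
  moreover have "((\<lambda>s. s * H \<xi>) has_derivative (\<lambda>h. h * H \<xi>)) (at (1::real))"
    by (auto intro!: derivative_eq_intros)
  ultimately have "(\<lambda>h::real. (h *\<^sub>R \<xi>) \<bullet> gradient H \<xi>) = (\<lambda>h. h * H \<xi>)" by (rule has_derivative_unique)
  from fun_cong[OF this, of 1] show ?thesis by simp
qed

text \<open>Differentiating Euler's relation replaces the symmetry of the Hessian.\<close>

lemma hess_inner_radial: "\<xi> \<noteq> 0 \<Longrightarrow> hess \<xi> v \<bullet> \<xi> = 0"
proof -
  assume \<xi>: "\<xi> \<noteq> 0"
  have "((\<lambda>x. x \<bullet> gradient H x) has_derivative (\<lambda>h. \<xi> \<bullet> hess \<xi> h + h \<bullet> gradient H \<xi>)) (at \<xi>)"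
    by (intro has_derivative_inner gradient_has_derivative \<xi> has_derivative_ident)
  hence "(H has_derivative (\<lambda>h. \<xi> \<bullet> hess \<xi> h + h \<bullet> gradient H \<xi>)) (at \<xi>)"
    by (rule has_derivative_transform_within_open[where s = "UNIV - {0}"]) (use \<xi> euler in auto)
  moreover have "(H has_derivative (\<lambda>h. h \<bullet> gradient H \<xi>)) (at \<xi>)"
    using H_GDERIV[OF \<xi>] unfolding gderiv_def .
  ultimately have "(\<lambda>h. \<xi> \<bullet> hess \<xi> h + h \<bullet> gradient H \<xi>) = (\<lambda>h. h \<bullet> gradient H \<xi>)"
    by (rule has_derivative_unique)
  from fun_cong[OF this, of v] show ?thesis by (simp add: inner_commute)
qed

lemma hess_radial: "\<xi> \<noteq> 0 \<Longrightarrow> hess \<xi> \<xi> = 0"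
proof -
  assume \<xi>: "\<xi> \<noteq> 0"
  have ray: "((\<lambda>s::real. s *\<^sub>R \<xi>) has_derivative (\<lambda>h. h *\<^sub>R \<xi>)) (at 1)" by (auto intro!: derivative_eq_intros)
  have "(gradient H has_derivative hess \<xi>) (at (1 *\<^sub>R \<xi>))"
    using gradient_has_derivative[OF \<xi>] by simp
  from has_derivative_compose[OF ray this] have "((\<lambda>s. gradient H (s *\<^sub>R \<xi>)) has_derivative (\<lambda>h. hess \<xi> (h *\<^sub>R \<xi>))) (at (1::real))"
    .
  hence "((\<lambda>s. gradient H \<xi>) has_derivative (\<lambda>h. hess \<xi> (h *\<^sub>R \<xi>))) (at (1::real))"
    by (rule has_derivative_transform_within_open[where s = "{0<..}"]) (use \<xi> gradient_scale in auto)
  moreover have "((\<lambda>s. gradient H \<xi>) has_derivative (\<lambda>h. 0)) (at (1::real))" by simp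
  ultimately have "(\<lambda>h::real. hess \<xi> (h *\<^sub>R \<xi>)) = (\<lambda>h. 0)" by (rule has_derivative_unique)
  from fun_cong[OF this, of 1] show ?thesis by simp
qed

lemma scale_to_sphere:
  assumes "\<xi> \<noteq> 0"
  shows "H \<xi> = norm \<xi> * H (sgn \<xi>)" "gradient H \<xi> = gradient H (sgn \<xi>)"
    "hess \<xi> v = (1 / norm \<xi>) *\<^sub>R hess (sgn \<xi>) v"
  using assms homogeneous[of "sgn \<xi>" "norm \<xi>"] gradient_scale[of "sgn \<xi>" "norm \<xi>"]
    hess_scale[of "sgn \<xi>" "norm \<xi>" v] by (auto simp: sgn_zero_iff sgn_div_norm)

lemma uniform_bounds:
  obtains K where "K \<ge> 1" "\<And>\<xi>. \<xi> \<noteq> 0 \<Longrightarrow> norm \<xi> / K \<le> H \<xi> \<and> H \<xi> \<le> K * norm \<xi>"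
    "\<And>\<xi>. \<xi> \<noteq> 0 \<Longrightarrow> norm (gradient H \<xi>) \<le> K"
    "\<And>\<xi> v. \<xi> \<noteq> 0 \<Longrightarrow> norm (hess \<xi> v) \<le> K * norm v / norm \<xi>"
proof -
  obtain K1 where K1: "K1 > 0" "\<And>\<xi>. norm \<xi> = 1 \<Longrightarrow> norm (H \<xi>) \<le> K1"
    using bounded_on_unit_sphere[OF continuous_on_H] by blast
  have "continuous_on (UNIV - {0}) (\<lambda>\<xi>. inverse (H \<xi>))"
    by (intro continuous_on_inverse continuous_on_H) (use pos in force)
  then obtain K2 where K2: "K2 > 0" "\<And>\<xi>. norm \<xi> = 1 \<Longrightarrow> norm (inverse (H \<xi>)) \<le> K2"
    using bounded_on_unit_sphere by blast
  obtain K3 where K3: "K3 > 0" "\<And>\<xi>. norm \<xi> = 1 \<Longrightarrow> norm (gradient H \<xi>) \<le> K3"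
    using bounded_on_unit_sphere[OF continuous_on_gradient] by blast
  have "\<exists>M>0. \<forall>\<xi>. norm \<xi> = 1 \<longrightarrow> norm (hess \<xi> b) \<le> M" for b
    using bounded_on_unit_sphere[OF continuous_on_hess[of b]] by metis
  then obtain M where M: "\<And>b. M b > 0" "\<And>b \<xi>. norm \<xi> = 1 \<Longrightarrow> norm (hess \<xi> b) \<le> M b" by metis
  define K4 where "K4 = (\<Sum>b\<in>Basis. M b)"
  have hess_sphere: "norm (hess \<xi> v) \<le> K4 * norm v" if "norm \<xi> = 1" for \<xi> v
  proof -
    have lin: "linear (hess \<xi>)" using gradient_has_derivative[of \<xi>] that has_derivative_linear by fastforce
    have "hess \<xi> v = hess \<xi> (\<Sum>b\<in>Basis. (v \<bullet> b) *\<^sub>R b)" by (simp add: euclidean_representation)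
    also have "\<dots> = (\<Sum>b\<in>Basis. (v \<bullet> b) *\<^sub>R hess \<xi> b)" by (simp add: linear_sum[OF lin] linear_scale[OF lin])
    also have "norm \<dots> \<le> (\<Sum>b\<in>Basis. norm v * M b)"
      by (rule sum_norm_le) (use M that in \<open>auto intro!: mult_mono Basis_le_norm\<close>)
    finally show ?thesis by (simp add: K4_def sum_distrib_right sum_distrib_left mult.commute)
  qed
  define K where "K = max (max (max K1 K2) (max K3 K4)) 1"
  have K: "K1 \<le> K" "K2 \<le> K" "K3 \<le> K" "K4 \<le> K" "1 \<le> K" by (auto simp: K_def)
  have n1: "norm (sgn \<xi>) = 1" if "\<xi> \<noteq> 0" for \<xi> :: 'a using that by (simp add: norm_sgn)
  show ?thesis
  proof (rule that[of K])
    fix \<xi> v :: 'a assume \<xi>: "\<xi> \<noteq> 0"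
    have p: "H (sgn \<xi>) > 0" using pos[of "sgn \<xi>"] \<xi> by (simp add: sgn_zero_iff)
    have 1: "H (sgn \<xi>) \<le> K" using K1(2)[OF n1[OF \<xi>]] K by simp
    have "inverse (H (sgn \<xi>)) \<le> K" using K2(2)[OF n1[OF \<xi>]] K p by simp
    hence 2: "1 / K \<le> H (sgn \<xi>)" using p K by (simp add: field_simps)
    show "norm \<xi> / K \<le> H \<xi> \<and> H \<xi> \<le> K * norm \<xi>"
      using mult_left_mono[OF 1, of "norm \<xi>"] mult_left_mono[OF 2, of "norm \<xi>"] scale_to_sphere(1)[OF \<xi>]
      by (simp add: mult.commute)
    show "norm (gradient H \<xi>) \<le> K"
      using K3(2)[OF n1[OF \<xi>]] K scale_to_sphere(2)[OF \<xi>] by simp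
    have "norm (hess (sgn \<xi>) v) \<le> K * norm v"
      using hess_sphere[OF n1[OF \<xi>], of v] K mult_right_mono[of K4 K "norm v"] by simp
    thus "norm (hess \<xi> v) \<le> K * norm v / norm \<xi>"
      using scale_to_sphere(3)[OF \<xi>, of v] by (simp add: divide_right_mono)
  qed (use K in auto)
qed

lemma hess_coercive:
  obtains c where "c > 0"
    "\<And>\<xi> v. \<xi> \<noteq> 0 \<Longrightarrow> c / H \<xi> * (norm (v - (v \<bullet> gradient H \<xi> / H \<xi>) *\<^sub>R \<xi>))^2 \<le> hess \<xi> v \<bullet> v"
proof -
  obtain c where c: "c > 0" "\<And>\<xi> v. H \<xi> = 1 \<Longrightarrow> v \<bullet> gradient H \<xi> = 0 \<Longrightarrow> \<xi> \<noteq> 0 \<Longrightarrow> c * (norm v)^2 \<le> hess \<xi> v \<bullet> v"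
    using convex unfolding uniformly_convex_unit_ball_def hess_def by blast
  show ?thesis
  proof (rule that[OF c(1)])
    fix \<xi> v :: 'a assume \<xi>: "\<xi> \<noteq> 0"
    define \<zeta> where "\<zeta> = (1 / H \<xi>) *\<^sub>R \<xi>"
    have Hp: "H \<xi> > 0" using pos[OF \<xi>] .
    have \<zeta>: "\<zeta> \<noteq> 0" "H \<zeta> = 1" "gradient H \<zeta> = gradient H \<xi>" "hess \<zeta> v = H \<xi> *\<^sub>R hess \<xi> v"
      using \<xi> Hp homogeneous[OF \<xi>, of "1 / H \<xi>"] gradient_scale[OF \<xi>, of "1 / H \<xi>"]
        hess_scale[OF \<xi>, of "1 / H \<xi>"] by (auto simp: \<zeta>_def)
    define w where "w = v - (v \<bullet> gradient H \<xi>) *\<^sub>R \<zeta>"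
    have "w \<bullet> gradient H \<zeta> = 0"
      using euler[OF \<zeta>(1)] \<zeta>(2,3) by (simp add: w_def inner_diff_left)
    from c(2)[OF \<zeta>(2) this \<zeta>(1)] have "c * (norm w)^2 \<le> hess \<zeta> w \<bullet> w" .
    also have "hess \<zeta> w = hess \<zeta> v"
    proof -
      have lin: "linear (hess \<zeta>)" using gradient_has_derivative[OF \<zeta>(1)] by (rule has_derivative_linear)
      show ?thesis unfolding w_def by (simp add: linear_diff[OF lin] linear_scale[OF lin] hess_radial[OF \<zeta>(1)])
    qed
    also have "hess \<zeta> v \<bullet> w = hess \<zeta> v \<bullet> v"
      unfolding w_def by (simp add: inner_diff_right hess_inner_radial[OF \<zeta>(1)])
    finally have "c * (norm w)^2 \<le> H \<xi> * (hess \<xi> v \<bullet> v)" by (simp add: \<zeta>(4))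
    hence "c / H \<xi> * (norm w)^2 \<le> hess \<xi> v \<bullet> v" using Hp by (simp add: field_simps)
    thus "c / H \<xi> * (norm (v - (v \<bullet> gradient H \<xi> / H \<xi>) *\<^sub>R \<xi>))^2 \<le> hess \<xi> v \<bullet> v"
      by (simp add: w_def \<zeta>_def)
  qed
qed

end

context smooth_gauge
begin

lemma stress_bounds:
  assumes p: "p > 1" and \<gamma>\<^sub>0: "\<gamma>\<^sub>0 > 0" and \<Gamma>\<^sub>0: "\<Gamma>\<^sub>0 > 0"
    and B_regular: "Ck_holder_loc 3 \<beta>' {0<..} B"
    and B1: "\<And>s. s > 0 \<Longrightarrow> \<gamma>\<^sub>0 * s powr (p - 2) * s \<le> hderiv B s \<and> hderiv B s \<le> \<Gamma>\<^sub>0 * s powr (p - 2) * s"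
    and B2: "\<And>s. s > 0 \<Longrightarrow> \<gamma>\<^sub>0 * s powr (p - 2) \<le> hderiv (hderiv B) s \<and> hderiv (hderiv B) s \<le> \<Gamma>\<^sub>0 * s powr (p - 2)"
  shows "\<exists>c > 0. \<exists>C > 0. \<forall>\<xi> \<eta>.
      c * (norm \<xi> + norm \<eta>) powr (p - 2) * (norm (\<xi> - \<eta>))^2 \<le> (stress B H \<xi> - stress B H \<eta>) \<bullet> (\<xi> - \<eta>) \<and>
      norm (stress B H \<xi> - stress B H \<eta>) \<le> C * (norm \<xi> + norm \<eta>) powr (p - 2) * norm (\<xi> - \<eta>)"
proof -
  obtain K where K: "K \<ge> 1" and HK: "\<And>\<xi>. \<xi> \<noteq> 0 \<Longrightarrow> norm \<xi> / K \<le> H \<xi> \<and> H \<xi> \<le> K * norm \<xi>"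
    and gK: "\<And>\<xi>. \<xi> \<noteq> 0 \<Longrightarrow> norm (gradient H \<xi>) \<le> K"
    and hK: "\<And>\<xi> v. \<xi> \<noteq> 0 \<Longrightarrow> norm (hess \<xi> v) \<le> K * norm v / norm \<xi>"
    using uniform_bounds by blast
  obtain c0 where c0: "c0 > 0"
    "\<And>\<xi> v. \<xi> \<noteq> 0 \<Longrightarrow> c0 / H \<xi> * (norm (v - (v \<bullet> gradient H \<xi> / H \<xi>) *\<^sub>R \<xi>))^2 \<le> hess \<xi> v \<bullet> v"
    using hess_coercive by blast
  define L where "L = K powr \<bar>p - 2\<bar>"
  have L: "L \<ge> 1" unfolding L_def using K by (intro ge_one_powr_ge_zero) auto
  have pow: "H \<xi> powr (p - 2) \<le> L * norm \<xi> powr (p - 2)" "norm \<xi> powr (p - 2) \<le> L * H \<xi> powr (p - 2)"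
    if "\<xi> \<noteq> 0" for \<xi>
    using HK[OF that] K that pos[OF that] unfolding L_def
    by (auto intro!: powr_comparable simp: field_simps)
  define A' where "A' \<xi> v = (hderiv (hderiv B) (H \<xi>) * (v \<bullet> gradient H \<xi>)) *\<^sub>R gradient H \<xi> + hderiv B (H \<xi>) *\<^sub>R hess \<xi> v" for \<xi> v
  have deriv: "(stress B H has_derivative A' \<xi>) (at \<xi>)" if \<xi>: "\<xi> \<noteq> 0" for \<xi>
  proof -
    have "((\<lambda>x. hderiv B (H x)) has_derivative (\<lambda>v. hderiv (hderiv B) (H \<xi>) * (v \<bullet> gradient H \<xi>))) (at \<xi>)"
      using has_derivative_compose[OF H_GDERIV[OF \<xi>, unfolded gderiv_def]
          hderiv_has_derivative(2)[OF B_regular pos[OF \<xi>], unfolded has_field_derivative_def]] .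
    from has_derivative_scaleR[OF this gradient_has_derivative[OF \<xi>]]
    have "((\<lambda>x. hderiv B (H x) *\<^sub>R gradient H x) has_derivative A' \<xi>) (at \<xi>)"
      by (rule has_derivative_eq_rhs) (auto simp: A'_def fun_eq_iff)
    thus ?thesis
      by (rule has_derivative_transform_within_open[where s = "UNIV - {0}"])
        (use \<xi> in \<open>auto simp: stress_def\<close>)
  qed
  define c1 where "c1 = min (1 / K^2) c0 / 2"
  have c1: "c1 > 0" unfolding c1_def using c0 K by simp
  have elliptic: "\<gamma>\<^sub>0 * c1 / L * norm \<xi> powr (p - 2) * (norm v)^2 \<le> A' \<xi> v \<bullet> v" if \<xi>: "\<xi> \<noteq> 0" for \<xi> v
  proof -
    define \<alpha> where "\<alpha> = v \<bullet> gradient H \<xi>"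
    define z where "z = (1 / H \<xi>) *\<^sub>R \<xi>"
    define w where "w = v - \<alpha> *\<^sub>R z"
    define P where "P = H \<xi> powr (p - 2)"
    have Hp: "H \<xi> > 0" using pos[OF \<xi>] .
    have P: "P > 0" using Hp by (simp add: P_def)
    have z: "norm z \<le> K" using HK[OF \<xi>] K Hp by (simp add: z_def field_simps)
    have "norm v \<le> norm w + \<bar>\<alpha>\<bar> * norm z" unfolding w_def
      using norm_triangle_ineq[of "v - \<alpha> *\<^sub>R z" "\<alpha> *\<^sub>R z"] by simp
    hence "norm v \<le> norm w + \<bar>\<alpha>\<bar> * K"
      using mult_left_mono[OF z, of "\<bar>\<alpha>\<bar>"] by simp
    hence "(norm v)^2 \<le> (norm w + \<bar>\<alpha>\<bar> * K)^2" by (intro power_mono) auto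
    also have "\<dots> \<le> 2 * (norm w)^2 + 2 * (\<alpha>^2 * K^2)"
      using sum_squares_bound[of "norm w" "\<bar>\<alpha>\<bar> * K"] by (simp only: power2_sum power_mult_distrib power2_abs)
    finally have v: "(norm v)^2 \<le> 2 * (norm w)^2 + 2 * (\<alpha>^2 * K^2)" .
    have "c1 * (norm v)^2 \<le> c1 * (2 * (norm w)^2 + 2 * (\<alpha>^2 * K^2))"
      using c1 v by (intro mult_left_mono) auto
    also have "\<dots> = (2 * c1) * (norm w)^2 + (2 * c1) * K^2 * \<alpha>^2" by (simp add: algebra_simps)
    also have "\<dots> \<le> c0 * (norm w)^2 + (1 / K^2) * K^2 * \<alpha>^2"
      by (intro add_mono mult_right_mono) (auto simp: c1_def)
    also have "\<dots> = c0 * (norm w)^2 + \<alpha>^2" using K by simp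
    finally have key: "c1 * (norm v)^2 \<le> c0 * (norm w)^2 + \<alpha>^2" .
    have hw: "c0 / H \<xi> * (norm w)^2 \<le> hess \<xi> v \<bullet> v"
      using c0(2)[OF \<xi>, of v] by (simp add: w_def z_def \<alpha>_def)
    have "\<gamma>\<^sub>0 * c1 / L * norm \<xi> powr (p - 2) * (norm v)^2 \<le> \<gamma>\<^sub>0 * c1 / L * (L * P) * (norm v)^2"
      unfolding P_def using \<gamma>\<^sub>0 c1 L pow(2)[OF \<xi>] by (intro mult_right_mono mult_left_mono) auto
    also have "\<dots> = \<gamma>\<^sub>0 * P * (c1 * (norm v)^2)" using L by simp
    also have "\<dots> \<le> \<gamma>\<^sub>0 * P * (c0 * (norm w)^2 + \<alpha>^2)" using \<gamma>\<^sub>0 P key by (intro mult_left_mono) auto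
    also have "\<dots> = \<gamma>\<^sub>0 * P * \<alpha>^2 + \<gamma>\<^sub>0 * P * H \<xi> * (c0 / H \<xi> * (norm w)^2)"
      using Hp by (simp add: algebra_simps)
    also have "\<dots> \<le> hderiv (hderiv B) (H \<xi>) * \<alpha>^2 + hderiv B (H \<xi>) * (hess \<xi> v \<bullet> v)"
    proof (intro add_mono mult_right_mono mult_mono hw)
      show "\<gamma>\<^sub>0 * P \<le> hderiv (hderiv B) (H \<xi>)" "\<gamma>\<^sub>0 * P * H \<xi> \<le> hderiv B (H \<xi>)"
        using B1[OF Hp] B2[OF Hp] by (auto simp: P_def)
      thus "0 \<le> hderiv B (H \<xi>)" using \<gamma>\<^sub>0 P Hp by (meson less_imp_le mult_pos_pos order_trans)
    qed (use c0 Hp in auto)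
    also have "\<dots> = A' \<xi> v \<bullet> v" by (simp add: A'_def \<alpha>_def inner_add_left power2_eq_square
          inner_commute[of "gradient H \<xi>" v])
    finally show ?thesis .
  qed
  have bounded: "norm (A' \<xi> v) \<le> (2 * \<Gamma>\<^sub>0 * L * K^2) * norm \<xi> powr (p - 2) * norm v" if \<xi>: "\<xi> \<noteq> 0" for \<xi> v
  proof -
    have Hp: "H \<xi> > 0" using pos[OF \<xi>] .
    define P where "P = norm \<xi> powr (p - 2)"
    have P: "P > 0" using \<xi> by (simp add: P_def)
    have b2: "\<bar>hderiv (hderiv B) (H \<xi>)\<bar> \<le> \<Gamma>\<^sub>0 * (L * P)"
    proof -
      have "0 \<le> \<gamma>\<^sub>0 * H \<xi> powr (p - 2)" using \<gamma>\<^sub>0 by simp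
      thus ?thesis using B2[OF Hp] pow(1)[OF \<xi>] \<Gamma>\<^sub>0 mult_left_mono[of "H \<xi> powr (p - 2)" "L * P" \<Gamma>\<^sub>0]
        unfolding P_def by linarith
    qed
    have b1: "\<bar>hderiv B (H \<xi>)\<bar> \<le> \<Gamma>\<^sub>0 * (L * P) * (K * norm \<xi>)"
    proof -
      have "0 \<le> \<gamma>\<^sub>0 * H \<xi> powr (p - 2) * H \<xi>" using \<gamma>\<^sub>0 Hp by simp
      moreover have "\<Gamma>\<^sub>0 * H \<xi> powr (p - 2) * H \<xi> \<le> \<Gamma>\<^sub>0 * (L * P) * (K * norm \<xi>)"
        using pow(1)[OF \<xi>] \<Gamma>\<^sub>0 HK[OF \<xi>] Hp L P unfolding P_def by (intro mult_mono mult_left_mono) auto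
      ultimately show ?thesis using B1[OF Hp] by linarith
    qed
    have g: "\<bar>v \<bullet> gradient H \<xi>\<bar> \<le> norm v * K"
      using Cauchy_Schwarz_ineq2[of v "gradient H \<xi>"] gK[OF \<xi>] by (meson mult_left_mono norm_ge_zero order_trans)
    have "norm (A' \<xi> v) \<le> \<bar>hderiv (hderiv B) (H \<xi>)\<bar> * \<bar>v \<bullet> gradient H \<xi>\<bar> * norm (gradient H \<xi>)
        + \<bar>hderiv B (H \<xi>)\<bar> * norm (hess \<xi> v)"
      unfolding A'_def by (rule order_trans[OF norm_triangle_ineq]) (simp add: abs_mult)
    also have "\<dots> \<le> \<Gamma>\<^sub>0 * (L * P) * (norm v * K) * K + \<Gamma>\<^sub>0 * (L * P) * (K * norm \<xi>) * (K * norm v / norm \<xi>)"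
      using b1 b2 g gK[OF \<xi>] hK[OF \<xi>, of v] \<Gamma>\<^sub>0 L P K by (intro add_mono mult_mono) auto
    also have "\<dots> = (2 * \<Gamma>\<^sub>0 * L * K^2) * P * norm v" using \<xi> by (simp add: power2_eq_square)
    finally show ?thesis by (simp add: P_def)
  qed
  have growth: "norm (stress B H \<xi>) \<le> (2 * \<Gamma>\<^sub>0 * L * K^2) * norm \<xi> powr (p - 1)" for \<xi>
  proof (cases "\<xi> = 0")
    case False
    have Hp: "H \<xi> > 0" using pos[OF False] .
    have "0 \<le> \<gamma>\<^sub>0 * H \<xi> powr (p - 2) * H \<xi>" using \<gamma>\<^sub>0 Hp by simp
    hence "norm (stress B H \<xi>) = hderiv B (H \<xi>) * norm (gradient H \<xi>)"
      using False B1[OF Hp] by (simp add: stress_def)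
    also have "\<dots> \<le> (\<Gamma>\<^sub>0 * H \<xi> powr (p - 2) * H \<xi>) * K"
      using B1[OF Hp] gK[OF False] K \<Gamma>\<^sub>0 Hp by (intro mult_mono) auto
    also have "\<dots> \<le> \<Gamma>\<^sub>0 * (L * norm \<xi> powr (p - 2)) * (K * norm \<xi>) * K"
      using pow(1)[OF False] \<Gamma>\<^sub>0 HK[OF False] Hp L K by (intro mult_mono mult_left_mono mult_right_mono) auto
    also have "\<dots> = \<Gamma>\<^sub>0 * L * K^2 * norm \<xi> powr (p - 1)"
      using powr_add[of "norm \<xi>" "p - 2" 1] False by (simp add: power2_eq_square mult_ac)
    also have "\<dots> \<le> (2 * \<Gamma>\<^sub>0 * L * K^2) * norm \<xi> powr (p - 1)"
      using \<Gamma>\<^sub>0 L K by (intro mult_right_mono) auto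
    finally show ?thesis .
  qed (simp add: stress_def)
  show ?thesis
  proof (rule stress_bounds_of_derivative[OF p _ _ deriv elliptic bounded _ growth])
    show "\<gamma>\<^sub>0 * c1 / L > 0" "0 \<le> 2 * \<Gamma>\<^sub>0 * L * K^2" using \<gamma>\<^sub>0 c1 L \<Gamma>\<^sub>0 by auto
  qed (auto simp: stress_def)
qed

end

section \<open>Test functions and weak solutions\<close>

lemma DERIV_max0_power:
  "((\<lambda>x::real. (max 0 x)^(Suc (Suc n))) has_real_derivative real (Suc (Suc n)) * (max 0 x)^(Suc n)) (at x)"
proof -
  consider "x > 0" | "x < 0" | "x = 0" by linarith
  thus ?thesis
  proof cases
    case 1
    have "((\<lambda>x::real. x^(Suc (Suc n))) has_real_derivative real (Suc (Suc n)) * x^(Suc n)) (at x)"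
      by (rule derivative_eq_intros refl | simp)+
    hence "((\<lambda>x::real. (max 0 x)^(Suc (Suc n))) has_real_derivative real (Suc (Suc n)) * x^(Suc n)) (at x)"
      by (rule has_field_derivative_transform_within_open[where S = "{0<..}"]) (use 1 in auto)
    thus ?thesis using 1 by simp
  next
    case 2
    have "((\<lambda>x::real. (max 0 x)^(Suc (Suc n))) has_real_derivative 0) (at x)"
      by (rule has_field_derivative_transform_within_open[where S = "{..<0}" and f = "\<lambda>_. 0"]) (use 2 in auto)
    thus ?thesis using 2 by simp
  next
    case 3
    have "((\<lambda>h. (max 0 h)^(Suc (Suc n)) / h) \<longlongrightarrow> 0) (at (0::real))"
    proof (rule Lim_null_comparison)
      show "\<forall>\<^sub>F h in at (0::real). norm ((max 0 h)^(Suc (Suc n)) / h) \<le> \<bar>h\<bar>^(Suc n)"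
      proof (intro always_eventually allI)
        fix h :: real
        show "norm ((max 0 h)^(Suc (Suc n)) / h) \<le> \<bar>h\<bar>^(Suc n)"
        proof (cases "h > 0")
          case False
          hence "norm ((max 0 h)^(Suc (Suc n)) / h) = 0" by (simp add: max_def)
          thus ?thesis by (metis abs_ge_zero zero_le_power)
        qed (simp add: abs_mult power_abs)
      qed
      show "((\<lambda>h::real. \<bar>h\<bar>^(Suc n)) \<longlongrightarrow> 0) (at 0)"
      proof -
        have "((\<lambda>h::real. \<bar>h\<bar>^(Suc n)) \<longlongrightarrow> \<bar>0\<bar>^(Suc n)) (at 0)" by (intro tendsto_intros)
        thus ?thesis by simp
      qed
    qed
    thus ?thesis using 3 by (simp add: DERIV_def)
  qed
qed

definition soft :: "real \<Rightarrow> real \<Rightarrow> real" where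
  "soft \<epsilon> v = max 0 (v - \<epsilon>) - max 0 (- v - \<epsilon>)"

lemma abs_soft: "\<epsilon> \<ge> 0 \<Longrightarrow> \<bar>soft \<epsilon> v\<bar> = max 0 (\<bar>v\<bar> - \<epsilon>)"
  by (auto simp: soft_def max_def abs_if)

lemma soft_powers:
  assumes "\<epsilon> \<ge> 0"
  shows "(soft \<epsilon> v)^2 = (max 0 (v - \<epsilon>))^2 + (max 0 (- v - \<epsilon>))^2"
    and "(soft \<epsilon> v)^3 = (max 0 (v - \<epsilon>))^3 - (max 0 (- v - \<epsilon>))^3"
proof -
  define a b where "a = max 0 (v - \<epsilon>)" "b = max 0 (- v - \<epsilon>)"
  have ab: "a * b = 0" using assms by (auto simp: a_b_def max_def)
  have "(a - b)^2 = a^2 + b^2 - 2 * (a * b)" "(a - b)^3 = a^3 - b^3 - 3 * (a * b) * (a - b)"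
    by (simp_all add: power2_eq_square power3_eq_cube algebra_simps)
  thus "(soft \<epsilon> v)^2 = (max 0 (v - \<epsilon>))^2 + (max 0 (- v - \<epsilon>))^2"
    and "(soft \<epsilon> v)^3 = (max 0 (v - \<epsilon>))^3 - (max 0 (- v - \<epsilon>))^3"
    using ab by (simp_all add: soft_def a_b_def)
qed

lemma DERIV_soft_square:
  assumes "\<epsilon> \<ge> 0"
  shows "((\<lambda>v. (soft \<epsilon> v)^2) has_real_derivative 2 * soft \<epsilon> v) (at v)"
proof -
  have "((\<lambda>v. (max 0 (v - \<epsilon>))^(Suc (Suc 0))) has_real_derivative (real (Suc (Suc 0)) * (max 0 (v - \<epsilon>))^(Suc 0)) * 1) (at v)"
    by (rule DERIV_chain2[OF DERIV_max0_power]) (auto intro!: derivative_eq_intros)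
  moreover have "((\<lambda>v. (max 0 (- v - \<epsilon>))^(Suc (Suc 0))) has_real_derivative (real (Suc (Suc 0)) * (max 0 (- v - \<epsilon>))^(Suc 0)) * (-1)) (at v)"
    by (rule DERIV_chain2[OF DERIV_max0_power]) (auto intro!: derivative_eq_intros)
  ultimately have "((\<lambda>v. (max 0 (v - \<epsilon>))^(Suc (Suc 0)) + (max 0 (- v - \<epsilon>))^(Suc (Suc 0))) has_real_derivative
      (real (Suc (Suc 0)) * (max 0 (v - \<epsilon>))^(Suc 0)) * 1 + (real (Suc (Suc 0)) * (max 0 (- v - \<epsilon>))^(Suc 0)) * (-1)) (at v)"
    by (rule DERIV_add)
  moreover have "(soft \<epsilon> v)^2 = (max 0 (v - \<epsilon>))^(Suc (Suc 0)) + (max 0 (- v - \<epsilon>))^(Suc (Suc 0))" for v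
    using soft_powers(1)[OF assms] by (simp add: numeral_2_eq_2)
  ultimately show ?thesis by (simp add: soft_def algebra_simps)
qed

lemma DERIV_soft_cube:
  assumes "\<epsilon> \<ge> 0"
  shows "((\<lambda>v. (soft \<epsilon> v)^3) has_real_derivative 3 * (soft \<epsilon> v)^2) (at v)"
proof -
  have "((\<lambda>v. (max 0 (v - \<epsilon>))^(Suc (Suc 1))) has_real_derivative (real (Suc (Suc 1)) * (max 0 (v - \<epsilon>))^(Suc 1)) * 1) (at v)"
    by (rule DERIV_chain2[OF DERIV_max0_power]) (auto intro!: derivative_eq_intros)
  moreover have "((\<lambda>v. (max 0 (- v - \<epsilon>))^(Suc (Suc 1))) has_real_derivative (real (Suc (Suc 1)) * (max 0 (- v - \<epsilon>))^(Suc 1)) * (-1)) (at v)"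
    by (rule DERIV_chain2[OF DERIV_max0_power]) (auto intro!: derivative_eq_intros)
  ultimately have "((\<lambda>v. (max 0 (v - \<epsilon>))^(Suc (Suc 1)) - (max 0 (- v - \<epsilon>))^(Suc (Suc 1))) has_real_derivative
      (real (Suc (Suc 1)) * (max 0 (v - \<epsilon>))^(Suc 1)) * 1 - (real (Suc (Suc 1)) * (max 0 (- v - \<epsilon>))^(Suc 1)) * (-1)) (at v)"
    by (rule DERIV_diff)
  moreover have "(soft \<epsilon> v)^3 = (max 0 (v - \<epsilon>))^(Suc (Suc 1)) - (max 0 (- v - \<epsilon>))^(Suc (Suc 1))" for v
    using soft_powers(2)[OF assms] by (simp add: numeral_3_eq_3)
  moreover have "3 * (soft \<epsilon> v)^2 = (real (Suc (Suc 1)) * (max 0 (v - \<epsilon>))^(Suc 1)) * 1 - (real (Suc (Suc 1)) * (max 0 (- v - \<epsilon>))^(Suc 1)) * (-1)"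
    using soft_powers(1)[OF assms, of v] by (simp add: numeral_2_eq_2)
  ultimately show ?thesis by simp
qed

lemma continuous_on_soft: "continuous_on S (soft \<epsilon>)"
  unfolding soft_def by (intro continuous_intros)

text \<open>Regularised versions of \<open>\<bar>v\<bar>\<^sup>-\<^sup>\<beta>\<close> and of its primitive. They vanish for \<open>\<bar>v\<bar> \<le> \<epsilon>\<close>, which keeps
  the testing away from the set where the equation degenerates.\<close>

definition wt :: "real \<Rightarrow> real \<Rightarrow> real \<Rightarrow> real" where
  "wt \<epsilon> \<beta> v = (soft \<epsilon> v)^2 * (\<epsilon>^2 + (soft \<epsilon> v)^2) powr (- (\<beta> + 2) / 2)"

definition prim :: "real \<Rightarrow> real \<Rightarrow> real \<Rightarrow> real" where
  "prim \<epsilon> \<beta> v = (soft \<epsilon> v)^3 * (\<epsilon>^2 + (soft \<epsilon> v)^2) powr (- (\<beta> + 2) / 2)"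

definition prim' :: "real \<Rightarrow> real \<Rightarrow> real \<Rightarrow> real" where
  "prim' \<epsilon> \<beta> v = wt \<epsilon> \<beta> v * (3 - (\<beta> + 2) * (soft \<epsilon> v)^2 / (\<epsilon>^2 + (soft \<epsilon> v)^2))"

lemma regularised_pos: "\<epsilon> > 0 \<Longrightarrow> \<epsilon>^2 + (x::real)^2 > 0"
  by (intro add_pos_nonneg) auto

lemma DERIV_prim:
  assumes "\<epsilon> > 0"
  shows "(prim \<epsilon> \<beta> has_real_derivative prim' \<epsilon> \<beta> v) (at v)"
proof -
  define A where "A = \<epsilon>^2 + (soft \<epsilon> v)^2"
  define e where "e = - (\<beta> + 2) / 2"
  have A: "A > 0" unfolding A_def using regularised_pos[OF assms] .
  have 1: "((\<lambda>v. \<epsilon>^2 + (soft \<epsilon> v)^2) has_real_derivative 2 * soft \<epsilon> v) (at v)"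
    using DERIV_add[OF DERIV_const DERIV_soft_square] assms by fastforce
  have 2: "((\<lambda>v. (\<epsilon>^2 + (soft \<epsilon> v)^2) powr e) has_real_derivative e * A powr (e - 1) * (2 * soft \<epsilon> v)) (at v)"
    using DERIV_fun_powr[OF 1, of e] A by (simp add: A_def mult.assoc)
  have "(prim \<epsilon> \<beta> has_real_derivative (3 * (soft \<epsilon> v)^2) * A powr e + (e * A powr (e - 1) * (2 * soft \<epsilon> v)) * (soft \<epsilon> v)^3) (at v)"
    using DERIV_mult[OF DERIV_soft_cube 2] assms unfolding prim_def[abs_def] A_def e_def by simp
  moreover have "(3 * (soft \<epsilon> v)^2) * A powr e + (e * A powr (e - 1) * (2 * soft \<epsilon> v)) * (soft \<epsilon> v)^3 = prim' \<epsilon> \<beta> v"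
  proof -
    have "A powr (e - 1) = A powr e / A" using A by (simp add: powr_diff)
    moreover have "\<beta> + 2 = - 2 * e" by (simp add: e_def)
    moreover have "(3 * s^2) * X + (e * (X / A) * (2 * s)) * s^3 = s^2 * X * (3 - (- 2 * e) * s^2 / A)" for s X
      using A by (simp add: field_simps power2_eq_square power3_eq_cube)
    ultimately show ?thesis unfolding prim'_def wt_def A_def[symmetric] e_def[symmetric] by simp
  qed
  ultimately show ?thesis by simp
qed

lemma wt_nonneg: "wt \<epsilon> \<beta> v \<ge> 0" by (simp add: wt_def)

lemma prim'_lower:
  assumes "\<epsilon> > 0" "\<beta> \<ge> -2"
  shows "(1 - \<beta>) * wt \<epsilon> \<beta> v \<le> prim' \<epsilon> \<beta> v"
proof -
  have "(\<beta> + 2) * ((soft \<epsilon> v)^2 / (\<epsilon>^2 + (soft \<epsilon> v)^2)) \<le> (\<beta> + 2) * 1"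
    using assms regularised_pos[OF assms(1), of "soft \<epsilon> v"] by (intro mult_left_mono) (auto simp: field_simps)
  hence "1 - \<beta> \<le> 3 - (\<beta> + 2) * (soft \<epsilon> v)^2 / (\<epsilon>^2 + (soft \<epsilon> v)^2)" by simp
  from mult_right_mono[OF this wt_nonneg] show ?thesis by (simp add: prim'_def mult.commute)
qed

lemma abs_prim: "\<bar>prim \<epsilon> \<beta> v\<bar> = \<bar>soft \<epsilon> v\<bar> * wt \<epsilon> \<beta> v"
  by (simp add: prim_def wt_def abs_mult power3_eq_cube power2_eq_square)

lemma wt_upper:
  assumes "\<epsilon> > 0" "\<beta> \<ge> 0"
  shows "wt \<epsilon> \<beta> v \<le> \<bar>soft \<epsilon> v\<bar> powr (- \<beta>)"
proof (cases "soft \<epsilon> v = 0")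
  case False
  define s where "s = \<bar>soft \<epsilon> v\<bar>"
  have s: "s > 0" using False by (simp add: s_def)
  have "(\<epsilon>^2 + s^2) powr (- (\<beta> + 2) / 2) \<le> (s^2) powr (- (\<beta> + 2) / 2)"
    using s assms by (intro powr_mono2') auto
  also have "\<dots> = s powr (2 * (- (\<beta> + 2) / 2))" using s powr_powr[of s 2] by simp
  also have "2 * (- (\<beta> + 2) / 2) = - \<beta> - 2" by simp
  finally have "s^2 * (\<epsilon>^2 + s^2) powr (- (\<beta> + 2) / 2) \<le> s powr 2 * s powr (- \<beta> - 2)"
    using s by (intro mult_mono) auto
  also have "\<dots> = s powr (- \<beta>)" by (simp flip: powr_add)
  finally show ?thesis by (simp add: s_def wt_def)
qed (simp add: wt_def)

lemma continuous_on_wt: "\<epsilon> > 0 \<Longrightarrow> continuous_on S (wt \<epsilon> \<beta>)"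
  unfolding wt_def using regularised_pos[of \<epsilon>]
  by (intro continuous_intros continuous_on_soft) (auto simp: less_imp_neq[THEN not_sym])

lemma continuous_on_prim': "\<epsilon> > 0 \<Longrightarrow> continuous_on S (prim' \<epsilon> \<beta>)"
  unfolding prim'_def using regularised_pos[of \<epsilon>]
  by (intro continuous_intros continuous_on_soft continuous_on_wt) (auto simp: less_imp_neq[THEN not_sym])

lemma C1c_GDERIV:
  fixes \<psi> :: "'a::euclidean_space \<Rightarrow> real"
  assumes "\<And>x. GDERIV \<psi> x :> D x" "continuous_on UNIV D" "compact K" "K \<subseteq> \<Omega>" "\<And>x. x \<notin> K \<Longrightarrow> \<psi> x = 0"
  shows "C1c \<Omega> \<psi>"
proof -
  have "closure {x. \<psi> x \<noteq> 0} \<subseteq> K"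
    using assms(3,5) by (intro closure_minimal) (auto intro: compact_imp_closed)
  moreover from this have "compact (closure {x. \<psi> x \<noteq> 0})"
    using assms(3) by (metis closed_closure closed_Int_compact inf.absorb2 inf_commute)
  moreover have "\<forall>x. \<psi> differentiable (at x)"
    using assms(1) unfolding gderiv_def by (meson differentiableI)
  moreover have "(\<lambda>x. frechet_derivative \<psi> (at x) v) = (\<lambda>x. v \<bullet> D x)" for v
    using frechet_derivative_GDERIV[OF assms(1)] by auto
  moreover have "continuous_on UNIV (\<lambda>x. v \<bullet> D x)" for v by (intro continuous_intros assms)
  ultimately show ?thesis using assms(4) by (auto simp: C1c_def)
qed

lemma GDERIV_eq_0:
  assumes "closed K" "\<And>x. x \<notin> K \<Longrightarrow> \<psi> x = 0" "GDERIV \<psi> x :> D" "x \<notin> K"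
  shows "D = 0"
proof -
  have "GDERIV \<psi> x :> 0"
    unfolding gderiv_def
    by (rule has_derivative_transform_within_open[where f = "\<lambda>_. 0" and s = "- K"])
      (use assms(1,2,4) in auto)
  thus ?thesis using GDERIV_unique assms(3) by blast
qed

lemma GDERIV_imp_isCont: "GDERIV F x :> D \<Longrightarrow> isCont F x"
  unfolding gderiv_def by (rule has_derivative_continuous)

lemma GDERIV_imp_continuous_on: "(\<And>x. x \<in> S \<Longrightarrow> GDERIV F x :> D x) \<Longrightarrow> continuous_on S F"
  by (blast intro: continuous_at_imp_continuous_on GDERIV_imp_isCont)

lemma GDERIV_mult_cutoff:
  fixes \<Phi> F :: "'a::euclidean_space \<Rightarrow> real"
  assumes \<Phi>: "\<And>x. GDERIV \<Phi> x :> D\<Phi> x" "continuous_on UNIV D\<Phi>" "compact K" "\<And>x. x \<notin> K \<Longrightarrow> \<Phi> x = 0"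
    and F: "open U" "K \<subseteq> U" "\<And>x. x \<in> U \<Longrightarrow> GDERIV F x :> DF x" "continuous_on U DF"
  shows "GDERIV (\<lambda>x. F x * \<Phi> x) x :> F x *\<^sub>R D\<Phi> x + \<Phi> x *\<^sub>R DF x"
    and "continuous_on UNIV (\<lambda>x. F x *\<^sub>R D\<Phi> x + \<Phi> x *\<^sub>R DF x)"
proof -
  have K: "closed K" using \<Phi>(3) by (rule compact_imp_closed)
  have D\<Phi>0: "x \<notin> K \<Longrightarrow> D\<Phi> x = 0" for x using GDERIV_eq_0[OF K \<Phi>(4) \<Phi>(1)] .
  show "GDERIV (\<lambda>x. F x * \<Phi> x) x :> F x *\<^sub>R D\<Phi> x + \<Phi> x *\<^sub>R DF x"
  proof (cases "x \<in> K")
    case True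
    thus ?thesis using GDERIV_mult F(2,3) \<Phi>(1) by blast
  next
    case False
    have "GDERIV (\<lambda>x. F x * \<Phi> x) x :> 0"
      unfolding gderiv_def
      by (rule has_derivative_transform_within_open[where f = "\<lambda>_. 0" and s = "- K"])
        (use K False \<Phi>(4) in auto)
    thus ?thesis using \<Phi>(4)[OF False] D\<Phi>0[OF False] by simp
  qed
  have "continuous_on U F" "continuous_on U \<Phi>"
    using GDERIV_imp_continuous_on F(3) \<Phi>(1) by blast+
  thus "continuous_on UNIV (\<lambda>x. F x *\<^sub>R D\<Phi> x + \<Phi> x *\<^sub>R DF x)"
    using \<Phi>(4) D\<Phi>0 F(4)
    by (intro continuous_on_zero_extension[OF F(1) \<Phi>(3) F(2)] continuous_intros)
      (auto intro: continuous_on_subset[OF \<Phi>(2)])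
qed

locale stress_field =
  fixes a :: "'a::euclidean_space \<Rightarrow> 'a" and p c C :: real
  assumes p: "p > 1" and c: "c > 0" and C: "C > 0"
    and a_0: "a 0 = 0"
    and coercive: "\<And>\<xi> \<eta>. c * (norm \<xi> + norm \<eta>) powr (p - 2) * (norm (\<xi> - \<eta>))^2 \<le> (a \<xi> - a \<eta>) \<bullet> (\<xi> - \<eta>)"
    and lipschitz: "\<And>\<xi> \<eta>. norm (a \<xi> - a \<eta>) \<le> C * (norm \<xi> + norm \<eta>) powr (p - 2) * norm (\<xi> - \<eta>)"
begin

lemma powr_mult_self: "norm \<xi> powr (p - 2) * norm \<xi> = norm (\<xi>::'a) powr (p - 1)"
  using powr_add[of "norm \<xi>" "p - 2" 1] by (cases "\<xi> = 0") auto

lemma growth: "norm (a \<xi>) \<le> C * norm \<xi> powr (p - 1)"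
  using lipschitz[of \<xi> 0] by (simp add: a_0 mult.assoc powr_mult_self)

lemma coercive_0: "c * norm \<xi> powr p \<le> a \<xi> \<bullet> \<xi>"
proof -
  have "norm \<xi> powr (p - 2) * (norm \<xi>)^2 = norm \<xi> powr p"
    using powr_add[of "norm \<xi>" "p - 2" 2] by (cases "\<xi> = 0") auto
  thus ?thesis using coercive[of \<xi> 0] by (simp add: a_0 mult.assoc)
qed

lemma isCont_a: "isCont a \<eta>"
proof -
  have "((\<lambda>\<xi>. norm (a \<xi> - a \<eta>)) \<longlongrightarrow> 0) (at \<eta>)"
  proof (cases "\<eta> = 0")
    case True
    have "((\<lambda>\<xi>::'a. C * norm \<xi> powr (p - 1)) \<longlongrightarrow> C * norm (0::'a) powr (p - 1)) (at 0)"
      using p by (intro tendsto_intros tendsto_powr') auto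
    hence "((\<lambda>\<xi>::'a. C * norm \<xi> powr (p - 1)) \<longlongrightarrow> 0) (at 0)" using p by simp
    thus ?thesis unfolding True
      by (rule Lim_null_comparison[rotated]) (auto simp: a_0 growth)
  next
    case False
    have "((\<lambda>\<xi>. C * (norm \<xi> + norm \<eta>) powr (p - 2) * norm (\<xi> - \<eta>)) \<longlongrightarrow>
        C * (norm \<eta> + norm \<eta>) powr (p - 2) * norm (\<eta> - \<eta>)) (at \<eta>)"
      using False by (intro tendsto_intros) auto
    hence "((\<lambda>\<xi>. C * (norm \<xi> + norm \<eta>) powr (p - 2) * norm (\<xi> - \<eta>)) \<longlongrightarrow> 0) (at \<eta>)" by simp
    thus ?thesis
      by (rule Lim_null_comparison[rotated]) (auto simp: lipschitz)
  qed
  thus ?thesis by (simp add: isCont_def tendsto_norm_zero_iff LIM_zero_iff)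
qed

lemma continuous_on_a: "continuous_on S w \<Longrightarrow> continuous_on S (\<lambda>x. a (w x))"
  by (rule continuous_on_compose2[where t = UNIV and g = a])
    (auto intro: continuous_at_imp_continuous_on isCont_a)

end

locale bounded_solution = stress_field a p c C
  for a :: "'a::euclidean_space \<Rightarrow> 'a" and p c C +
  fixes f :: "real \<Rightarrow> real" and f0 M :: real and \<Omega> :: "'a set" and u :: "'a \<Rightarrow> real" and w :: "'a \<Rightarrow> 'a"
  assumes open_\<Omega>: "open \<Omega>"
    and u_GDERIV: "\<And>x. x \<in> \<Omega> \<Longrightarrow> GDERIV u x :> w x"
    and w_cont: "continuous_on \<Omega> w"
    and w_bound: "\<And>x. x \<in> \<Omega> \<Longrightarrow> norm (w x) \<le> M"
    and u_pos: "\<And>x. x \<in> \<Omega> \<Longrightarrow> 0 < u x" and u_bound: "\<And>x. x \<in> \<Omega> \<Longrightarrow> u x \<le> M"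
    and f_cont: "continuous_on {0..} f"
    and f0: "f0 > 0" and f_lower: "\<And>s. 0 \<le> s \<Longrightarrow> s \<le> M \<Longrightarrow> f0 \<le> f s"
    and M: "M > 0"
    and weak: "\<And>\<psi> D K. (\<And>x. GDERIV \<psi> x :> D x) \<Longrightarrow> continuous_on UNIV D \<Longrightarrow> compact K \<Longrightarrow> K \<subseteq> \<Omega> \<Longrightarrow>
        (\<And>x. x \<notin> K \<Longrightarrow> \<psi> x = 0) \<Longrightarrow>
        (LBINT x. a (w x) \<bullet> D x) = (LBINT x. f (u x) * \<psi> x)"
begin

lemma u_cont: "continuous_on \<Omega> u"
  using u_GDERIV by (rule GDERIV_imp_continuous_on)

lemma fu_cont: "continuous_on \<Omega> (\<lambda>x. f (u x))"
  by (rule continuous_on_compose2[OF f_cont u_cont]) (use u_pos in force)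

lemma f_lower_u: "x \<in> \<Omega> \<Longrightarrow> f0 \<le> f (u x)"
  using f_lower[of "u x"] u_pos[of x] u_bound[of x] by simp

lemma weak_shift:
  assumes "\<And>x. GDERIV \<psi> x :> D x" "continuous_on UNIV D" "compact K" "(\<lambda>x. x + d) ` K \<subseteq> \<Omega>"
    "\<And>x. x \<notin> K \<Longrightarrow> \<psi> x = 0"
  shows "(LBINT x. a (w (x + d)) \<bullet> D x) = (LBINT x. f (u (x + d)) * \<psi> x)"
proof -
  define K' where "K' = (\<lambda>x. x + d) ` K"
  have K': "compact K'" unfolding K'_def using assms(3)
    by (intro compact_continuous_image) (auto intro: continuous_intros)
  have out: "x - d \<notin> K" if "x \<notin> K'" for x
    using that unfolding K'_def by (metis diff_add_cancel image_eqI)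
  have D0: "D x = 0" if "x \<notin> K" for x
    using GDERIV_eq_0[OF compact_imp_closed[OF assms(3)] assms(5) assms(1) that] .
  have D_shift: "continuous_on UNIV (\<lambda>x. D (x - d))"
    by (rule continuous_on_compose2[OF assms(2)]) (auto intro: continuous_intros)
  have \<psi>_shift: "continuous_on UNIV (\<lambda>x. \<psi> (x - d))"
  proof -
    have "continuous_on UNIV \<psi>" using assms(1) by (rule GDERIV_imp_continuous_on)
    thus ?thesis by (rule continuous_on_compose2) (auto intro: continuous_intros)
  qed
  have "(LBINT x. a (w x) \<bullet> D (x - d)) = (LBINT x. f (u x) * \<psi> (x - d))"
  proof (rule weak[OF _ D_shift K'])
    show "K' \<subseteq> \<Omega>" using assms(4) by (simp add: K'_def)
    show "\<psi> (x - d) = 0" if "x \<notin> K'" for x using out[OF that] assms(5) by simp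
    show "GDERIV (\<lambda>x. \<psi> (x - d)) x :> D (x - d)" for x
    proof -
      have "((\<lambda>x. x - d) has_derivative (\<lambda>h. h)) (at x)" by (auto intro!: derivative_eq_intros)
      from has_derivative_compose[OF this assms(1)[unfolded gderiv_def]]
      show ?thesis unfolding gderiv_def .
    qed
  qed
  moreover have "continuous_on UNIV (\<lambda>x. a (w x) \<bullet> D (x - d))"
    using D0 out assms(4) unfolding K'_def[symmetric]
    by (intro continuous_on_zero_extension[OF open_\<Omega> K'] continuous_intros continuous_on_a w_cont)
      (auto intro: continuous_on_subset[OF D_shift])
  hence "(LBINT x. a (w (x + d)) \<bullet> D (x + d - d)) = (LBINT x. a (w x) \<bullet> D (x - d))"
    by (intro integral_lborel_translate[of "\<lambda>x. a (w x) \<bullet> D (x - d)" d]) (rule borel_measurable_continuous_onI)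
  moreover have "continuous_on UNIV (\<lambda>x. f (u x) * \<psi> (x - d))"
    using assms(5) out assms(4) unfolding K'_def[symmetric]
    by (intro continuous_on_zero_extension[OF open_\<Omega> K'] continuous_intros fu_cont)
      (auto intro: continuous_on_subset[OF \<psi>_shift])
  hence "(LBINT x. f (u (x + d)) * \<psi> (x + d - d)) = (LBINT x. f (u x) * \<psi> (x - d))"
    by (intro integral_lborel_translate[of "\<lambda>x. f (u x) * \<psi> (x - d)" d]) (rule borel_measurable_continuous_onI)
  ultimately show ?thesis by simp
qed

end

text \<open>Test functions of the form \<open>F \<Phi>\<close>, where \<open>F\<close> is only defined near the support of the cutoff \<open>\<Phi>\<close>.\<close>

locale test_product = bounded_solution a p c C f f0 M \<Omega> u w
  for a :: "'a::euclidean_space \<Rightarrow> 'a" and p c C f f0 M \<Omega> u w +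
  fixes \<Phi> :: "'a \<Rightarrow> real" and D\<Phi> :: "'a \<Rightarrow> 'a" and K U :: "'a set"
  assumes \<Phi>_GDERIV: "\<And>x. GDERIV \<Phi> x :> D\<Phi> x" and D\<Phi>_cont: "continuous_on UNIV D\<Phi>"
    and K: "compact K" and \<Phi>_0: "\<And>x. x \<notin> K \<Longrightarrow> \<Phi> x = 0"
    and U: "open U" "K \<subseteq> U" "U \<subseteq> \<Omega>"
begin

lemma D\<Phi>_0: "x \<notin> K \<Longrightarrow> D\<Phi> x = 0"
  using GDERIV_eq_0[OF compact_imp_closed[OF K] \<Phi>_0 \<Phi>_GDERIV] .

lemma \<Phi>_cont: "continuous_on S \<Phi>"
  using \<Phi>_GDERIV by (rule GDERIV_imp_continuous_on)

lemma integrable_local: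
  fixes F :: "'a \<Rightarrow> real"
  assumes "continuous_on U F" "\<And>x. x \<notin> K \<Longrightarrow> F x = 0"
  shows "integrable lborel F"
  using assms U K by (intro integrable_continuous_compact_support[OF K] continuous_on_zero_extension[OF U(1) K])

lemma test_shift:
  assumes F: "\<And>x. x \<in> U \<Longrightarrow> GDERIV F x :> DF x" "continuous_on U DF" and d: "(\<lambda>x. x + d) ` K \<subseteq> \<Omega>"
  shows "(LBINT x. a (w (x + d)) \<bullet> (F x *\<^sub>R D\<Phi> x + \<Phi> x *\<^sub>R DF x)) = (LBINT x. f (u (x + d)) * (F x * \<Phi> x))"
  using GDERIV_mult_cutoff[OF \<Phi>_GDERIV D\<Phi>_cont K \<Phi>_0 U(1,2) F] \<Phi>_0
  by (intro weak_shift[OF _ _ K d]) auto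

lemma test:
  assumes F: "\<And>x. x \<in> U \<Longrightarrow> GDERIV F x :> DF x" "continuous_on U DF"
  shows "(LBINT x. a (w x) \<bullet> (F x *\<^sub>R D\<Phi> x + \<Phi> x *\<^sub>R DF x)) = (LBINT x. f (u x) * (F x * \<Phi> x))"
  using test_shift[OF F, of 0] U by auto

end

section \<open>Positive lower bound\<close>

definition bump :: "'a::euclidean_space \<Rightarrow> real \<Rightarrow> 'a \<Rightarrow> real" where
  "bump x0 r x = max 0 (1 - ((x - x0) \<bullet> (x - x0)) / r^2)"

lemma bump_bounds: "0 \<le> bump x0 r x" "bump x0 r x \<le> 1"
  by (auto simp: bump_def)

lemma bump_outside: "r > 0 \<Longrightarrow> x \<notin> cball x0 r \<Longrightarrow> bump x0 r x = 0"
proof -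
  assume r: "r > 0" "x \<notin> cball x0 r"
  hence "r < norm (x - x0)" by (simp add: dist_norm norm_minus_commute)
  hence "r^2 \<le> (norm (x - x0))^2" using r by (intro power_mono) auto
  thus ?thesis using r by (simp add: bump_def power2_norm_eq_inner max_def field_simps)
qed

lemma bump_inside: "r > 0 \<Longrightarrow> x \<in> cball x0 (r / 2) \<Longrightarrow> bump x0 r x \<ge> 3 / 4"
proof -
  assume r: "r > 0" "x \<in> cball x0 (r / 2)"
  hence "norm (x - x0) \<le> r / 2" by (simp add: dist_norm norm_minus_commute)
  hence "(norm (x - x0))^2 \<le> (r / 2)^2" using r by (intro power_mono) auto
  hence "((x - x0) \<bullet> (x - x0)) / r^2 \<le> 1 / 4"
    using r by (simp add: power2_norm_eq_inner power_divide field_simps)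
  hence "3 / 4 \<le> 1 - ((x - x0) \<bullet> (x - x0)) / r^2" by linarith
  thus ?thesis unfolding bump_def by (rule max.coboundedI2)
qed

lemma continuous_on_bump: "continuous_on S (bump x0 r)"
  unfolding bump_def divide_inverse by (intro continuous_intros)

lemma GDERIV_bump_power:
  "GDERIV (\<lambda>x. bump x0 r x ^ Suc (Suc n)) x :>
     (real (Suc (Suc n)) * bump x0 r x ^ Suc n) *\<^sub>R (- 2 / r^2) *\<^sub>R (x - x0)"
proof -
  have "((\<lambda>x. 1 - ((x - x0) \<bullet> (x - x0)) / r^2) has_derivative (\<lambda>h. h \<bullet> ((- 2 / r^2) *\<^sub>R (x - x0)))) (at x)"
    unfolding divide_inverse
    by (auto intro!: derivative_eq_intros simp: inner_commute algebra_simps)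
  hence "GDERIV (\<lambda>x. 1 - ((x - x0) \<bullet> (x - x0)) / r^2) x :> (- 2 / r^2) *\<^sub>R (x - x0)"
    unfolding gderiv_def .
  from GDERIV_DERIV_compose[OF this DERIV_max0_power] show ?thesis by (simp add: bump_def)
qed

lemma norm_bump_gradient:
  assumes "r > 0"
  shows "norm ((real (Suc (Suc n)) * bump x0 r x ^ Suc n) *\<^sub>R (- 2 / r^2) *\<^sub>R (x - x0))
    \<le> 2 * real (Suc (Suc n)) / r * bump x0 r x ^ Suc n"
proof (cases "x \<in> cball x0 r")
  case True
  hence "norm (x - x0) / r^2 \<le> 1 / r"
    using assms by (simp add: dist_norm norm_minus_commute field_simps power2_eq_square)
  hence le: "norm (x - x0) / r^2 \<le> 1 / r" .
  have "norm ((real (Suc (Suc n)) * bump x0 r x ^ Suc n) *\<^sub>R (- 2 / r^2) *\<^sub>R (x - x0))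
      = (2 * real (Suc (Suc n)) * bump x0 r x ^ Suc n) * (norm (x - x0) / r^2)"
    using bump_bounds(1)[of x0 r x] by (simp add: abs_mult)
  also have "\<dots> \<le> (2 * real (Suc (Suc n)) * bump x0 r x ^ Suc n) * (1 / r)"
    using bump_bounds(1)[of x0 r x] by (intro mult_left_mono le) auto
  finally show ?thesis by simp
next
  case False
  show ?thesis using bump_outside[OF assms False] by simp
qed

context bounded_solution
begin

lemma lipschitz_on_cball:
  assumes "cball x0 r \<subseteq> \<Omega>" "x \<in> cball x0 r" "y \<in> cball x0 r"
  shows "\<bar>u x - u y\<bar> \<le> M * norm (x - y)"
proof -
  have "norm (u x - u y) \<le> M * norm (x - y)"
  proof (rule differentiable_bound[of "cball x0 r" u "\<lambda>x h. h \<bullet> w x"])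
    fix z assume z: "z \<in> cball x0 r"
    hence z': "z \<in> \<Omega>" using assms(1) by blast
    show "(u has_derivative (\<lambda>h. h \<bullet> w z)) (at z within cball x0 r)"
      by (rule has_derivative_at_withinI[OF u_GDERIV[OF z', unfolded gderiv_def]])
    show "onorm (\<lambda>h. h \<bullet> w z) \<le> M"
    proof (rule onorm_bound)
      fix h
      have "norm (h \<bullet> w z) \<le> norm h * norm (w z)" using Cauchy_Schwarz_ineq2[of h "w z"] by simp
      also have "\<dots> \<le> norm h * M" using w_bound[OF z'] by (intro mult_left_mono) auto
      finally show "norm (h \<bullet> w z) \<le> M * norm h" by (simp add: mult.commute)
    qed (use M in simp)
  qed (use assms in auto)
  thus ?thesis by simp
qed

lemma small_values_step:
  assumes r: "r > 0" and sub: "cball x0 r \<subseteq> \<Omega>" and \<mu>: "\<mu> > 0" and l: "l \<ge> 1"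
  defines "P \<equiv> nat \<lceil>p\<rceil>"
  defines "\<kappa> \<equiv> 2 * real (P + l) * C / r"
  shows "f0 * (LBINT x. (max 0 (\<mu> - u x))^2 * bump x0 r x ^ (P + l))
    \<le> \<kappa> * (\<mu> * \<kappa> / (2 * c)) powr (p - 1) * (LBINT x. (max 0 (\<mu> - u x))^2 * bump x0 r x ^ l)"
proof -
  have "\<lceil>p\<rceil> \<ge> 2" using p by linarith
  hence "nat 2 \<le> P" unfolding P_def by (rule nat_mono)
  hence P: "P \<ge> 2" "p \<le> real P" unfolding P_def using real_nat_ceiling_ge[of p] by simp_all
  define n where "n = P + l - 2"
  have n: "P + l = Suc (Suc n)" using P(1) by (simp add: n_def)
  define q where "q x = max 0 (\<mu> - u x)" for x
  define b where "b = bump x0 r"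
  define D where "D x = (real (Suc (Suc n)) * b x ^ Suc n) *\<^sub>R (- 2 / r^2) *\<^sub>R (x - x0)" for x
  have \<kappa>: "\<kappa> > 0" unfolding \<kappa>_def using C r l by (intro divide_pos_pos mult_pos_pos) auto
  have q: "0 \<le> q x" "x \<in> \<Omega> \<Longrightarrow> q x \<le> \<mu>" for x using u_pos[of x] \<mu> by (auto simp: q_def)
  have b: "0 \<le> b x" "b x \<le> 1" for x using bump_bounds by (auto simp: b_def)
  interpret test_product a p c C f f0 M \<Omega> u w "\<lambda>x. b x ^ (P + l)" D "cball x0 r" \<Omega>
  proof
    show "GDERIV (\<lambda>x. b x ^ (P + l)) x :> D x" for x
      using GDERIV_bump_power[of x0 r n x] unfolding n D_def b_def .
    show "continuous_on UNIV D"
      unfolding D_def b_def by (intro continuous_intros continuous_on_bump)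
    show "b x ^ (P + l) = 0" if "x \<notin> cball x0 r" for x
      using bump_outside[OF r that] l by (simp add: b_def)
  qed (use open_\<Omega> sub in auto)
  have F: "GDERIV (\<lambda>x. (q x)^2) x :> (- 2 * q x) *\<^sub>R w x" if "x \<in> \<Omega>" for x
  proof -
    have "GDERIV (\<lambda>x. \<mu> - u x) x :> 0 - w x" by (intro GDERIV_diff GDERIV_const u_GDERIV that)
    from GDERIV_DERIV_compose[OF this DERIV_max0_power[of 0]]
    show ?thesis by (simp add: q_def numeral_2_eq_2)
  qed
  have q_cont: "continuous_on \<Omega> q" unfolding q_def by (intro continuous_intros u_cont)
  have b_cont: "continuous_on S b" for S unfolding b_def by (rule continuous_on_bump)
  have D_cont: "continuous_on S D" for S unfolding D_def by (intro continuous_intros b_cont)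
  have DF: "continuous_on \<Omega> (\<lambda>x. (- 2 * q x) *\<^sub>R w x)" by (intro continuous_intros q_cont w_cont)
  have b0: "x \<notin> cball x0 r \<Longrightarrow> b x = 0" for x using bump_outside[OF r] by (simp add: b_def)
  define R where "R = \<kappa> * (\<mu> * \<kappa> / (2 * c)) powr (p - 1)"
  have "f0 * (LBINT x. (q x)^2 * b x ^ (P + l)) = (LBINT x. f0 * ((q x)^2 * b x ^ (P + l)))"
    by simp
  also have "\<dots> \<le> (LBINT x. f (u x) * ((q x)^2 * b x ^ (P + l)))"
  proof (rule integral_mono)
    show "integrable lborel (\<lambda>x. f0 * ((q x)^2 * b x ^ (P + l)))"
      "integrable lborel (\<lambda>x. f (u x) * ((q x)^2 * b x ^ (P + l)))"
      using b0 P by (intro integrable_local continuous_intros q_cont b_cont fu_cont; simp)+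
    fix x
    show "f0 * ((q x)^2 * b x ^ (P + l)) \<le> f (u x) * ((q x)^2 * b x ^ (P + l))"
    proof (cases "x \<in> cball x0 r")
      case True
      thus ?thesis using f_lower_u[of x] sub b by (intro mult_right_mono) auto
    qed (use b0 P in \<open>simp add: power_0_left\<close>)
  qed
  also have "\<dots> = (LBINT x. a (w x) \<bullet> ((q x)^2 *\<^sub>R D x + b x ^ (P + l) *\<^sub>R (- 2 * q x) *\<^sub>R w x))"
    using test[OF F DF] by simp
  also have "\<dots> \<le> (LBINT x. R * ((q x)^2 * b x ^ l))"
  proof (rule integral_mono)
    show "integrable lborel (\<lambda>x. R * ((q x)^2 * b x ^ l))"
      using b0 l by (intro integrable_local continuous_intros q_cont b_cont; simp)
    show "integrable lborel (\<lambda>x. a (w x) \<bullet> ((q x)^2 *\<^sub>R D x + b x ^ (P + l) *\<^sub>R (- 2 * q x) *\<^sub>R w x))"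
      using b0 D\<Phi>_0 P
      by (intro integrable_local continuous_intros q_cont b_cont D_cont continuous_on_a w_cont; simp)
    fix x
    show "a (w x) \<bullet> ((q x)^2 *\<^sub>R D x + b x ^ (P + l) *\<^sub>R (- 2 * q x) *\<^sub>R w x) \<le> R * ((q x)^2 * b x ^ l)"
    proof (cases "b x = 0")
      case True
      thus ?thesis using P l by (simp add: D_def power_0_left)
    next
      case False
      hence bx: "b x > 0" using b(1)[of x] by simp
      have x: "x \<in> \<Omega>" using False b0 sub by blast
      define y where "y = norm (w x) * b x"
      define W where "W = norm (w x) powr (p - 1)"
      have W: "W \<ge> 0" by (simp add: W_def)
      have Wp: "norm (w x) powr p = W * norm (w x)"
        using powr_add[of "norm (w x)" "p - 1" 1] by (cases "w x = 0") (auto simp: W_def)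
      have "norm (D x) \<le> 2 * real (P + l) / r * b x ^ (P + l - 1)"
        using norm_bump_gradient[OF r, of n x0 x] n unfolding D_def b_def by simp
      hence "norm (a (w x)) * norm (D x) \<le> (C * W) * (2 * real (P + l) / r * b x ^ (P + l - 1))"
        using growth[of "w x"] W C unfolding W_def by (intro mult_mono) auto
      hence 1: "a (w x) \<bullet> D x \<le> \<kappa> * W * b x ^ (P + l - 1)"
        using norm_cauchy_schwarz[of "a (w x)" "D x"] by (simp add: \<kappa>_def mult_ac)
      have bb: "b x ^ (P + l) = b x ^ (P + l - 1) * b x"
        using P by (metis One_nat_def Suc_pred add_gr_0 less_le_trans mult.commute pos2 power_Suc)
      have "a (w x) \<bullet> ((q x)^2 *\<^sub>R D x + b x ^ (P + l) *\<^sub>R (- 2 * q x) *\<^sub>R w x)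
        = (q x)^2 * (a (w x) \<bullet> D x) - 2 * q x * b x ^ (P + l) * (a (w x) \<bullet> w x)"
        by (simp add: inner_add_right inner_diff_right)
      also have "\<dots> \<le> (q x)^2 * (\<kappa> * W * b x ^ (P + l - 1)) - 2 * q x * b x ^ (P + l) * (c * (W * norm (w x)))"
        using 1 q(1)[of x] bx coercive_0[of "w x"] Wp by (intro diff_mono mult_left_mono) auto
      also have "\<dots> = q x * (b x ^ (P + l - 1) * W) * (q x * \<kappa> - 2 * c * y)"
        unfolding bb y_def by (simp add: power2_eq_square algebra_simps)
      also have "\<dots> \<le> R * ((q x)^2 * b x ^ l)"
      proof (cases "q x * \<kappa> \<le> 2 * c * y")
        case True
        have "q x * (b x ^ (P + l - 1) * W) * (q x * \<kappa> - 2 * c * y) \<le> 0"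
          using True q(1)[of x] bx W by (intro mult_nonneg_nonpos) auto
        also have "0 \<le> R * ((q x)^2 * b x ^ l)" using \<kappa> bx by (simp add: R_def)
        finally show ?thesis .
      next
        case False
        hence "y \<le> q x * \<kappa> / (2 * c)" using c by (simp add: field_simps)
        also have "\<dots> \<le> \<mu> * \<kappa> / (2 * c)"
          using q(2)[OF x] \<kappa> c by (intro divide_right_mono mult_right_mono) auto
        finally have y: "y powr (p - 1) \<le> (\<mu> * \<kappa> / (2 * c)) powr (p - 1)"
          using p bx by (intro powr_mono2) (auto simp: y_def)
        have "b x ^ (P + l - 1) * W = b x powr (real (P + l) - p) * (b x powr (p - 1) * W)"
        proof -
          have "b x ^ (P + l - 1) = b x powr (real (P + l) - p + (p - 1))"
            using bx P by (simp add: powr_realpow[symmetric] of_nat_diff algebra_simps)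
          thus ?thesis by (simp only: powr_add mult.assoc)
        qed
        also have "b x powr (p - 1) * W = y powr (p - 1)"
          using bx by (simp add: y_def W_def powr_mult mult.commute)
        also have "b x powr (real (P + l) - p) * y powr (p - 1) \<le> b x ^ l * (\<mu> * \<kappa> / (2 * c)) powr (p - 1)"
        proof (rule mult_mono[OF _ y])
          have "b x powr (real (P + l) - p) \<le> b x powr real l"
            using P bx b(2)[of x] by (intro powr_mono') auto
          thus "b x powr (real (P + l) - p) \<le> b x ^ l" using bx by (simp add: powr_realpow)
        qed (use bx in auto)
        finally have A: "b x ^ (P + l - 1) * W \<le> b x ^ l * (\<mu> * \<kappa> / (2 * c)) powr (p - 1)" .
        have "q x * (b x ^ (P + l - 1) * W) * (q x * \<kappa> - 2 * c * y)
            \<le> q x * (b x ^ l * (\<mu> * \<kappa> / (2 * c)) powr (p - 1)) * (q x * \<kappa>)"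
          using q(1)[of x] bx c False
          by (intro mult_mono[OF mult_left_mono[OF A q(1)]] mult_nonneg_nonneg) (auto simp: y_def)
        also have "\<dots> = R * ((q x)^2 * b x ^ l)" by (simp add: R_def power2_eq_square mult_ac)
        finally show ?thesis .
      qed
      finally show ?thesis .
    qed
  qed
  also have "\<dots> = R * (LBINT x. (q x)^2 * b x ^ l)" by simp
  finally show ?thesis by (simp add: q_def b_def R_def)
qed

end

text \<open>Iterating the step \<open>J\<close> times gives \<open>\<integral> ((\<mu> - u)\<^sup>+)\<^sup>2 \<chi>\<^sup>N \<le> A' \<mu>\<^sup>(\<^sup>p\<^sup>-\<^sup>1\<^sup>)\<^sup>J\<^sup>+\<^sup>2\<close> with the bump \<open>\<chi>\<close>. If
  \<open>u\<close> were below \<open>\<mu>/4\<close> at the centre, its Lipschitz continuity would make the integral at least of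
  order \<open>\<mu>\<^sup>d\<^sup>+\<^sup>2\<close>, which is impossible for small \<open>\<mu>\<close> as soon as \<open>(p - 1) J > d\<close>.\<close>

lemma (in stress_field) positive_lower_bound:
  assumes r: "r > 0" and f0: "f0 > 0" and M: "M > 0"
  shows "\<exists>m>0. \<forall>f \<Omega> u w x0. bounded_solution a p c C f f0 M \<Omega> u w \<and> cball x0 r \<subseteq> \<Omega> \<longrightarrow> m \<le> u x0"
proof -
  define d where "d = DIM('a)"
  define P where "P = nat \<lceil>p\<rceil>"
  define J where "J = nat \<lceil>real (d + 1) / (p - 1)\<rceil>"
  define N where "N = J * P + 1"
  define \<kappa> where "\<kappa> = 2 * real N * C / r"
  define A where "A = \<kappa> * (\<kappa> / (2 * c)) powr (p - 1)"
  define A' where "A' = (A / f0)^J * r^d"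
  define B where "B = (1/4) * (3/4)^N / (4 * M)^d"
  define \<mu> where "\<mu> = min (min 1 (2 * M * r)) (B / (2 * (A' + 1)))"
  have "N > 0" by (simp add: N_def)
  hence \<kappa>: "\<kappa> > 0" unfolding \<kappa>_def using C r by (intro divide_pos_pos mult_pos_pos) auto
  have A: "A \<ge> 0" "A' \<ge> 0" "B > 0" using \<kappa> c f0 r M by (auto simp: A_def A'_def B_def)
  have \<mu>: "\<mu> > 0" "\<mu> \<le> 1" "\<mu> \<le> 2 * M * r" "A' * \<mu> < B"
  proof -
    show "\<mu> > 0" unfolding \<mu>_def using A M r by (simp add: mult_pos_pos divide_pos_pos)
    show "\<mu> \<le> 1" "\<mu> \<le> 2 * M * r" unfolding \<mu>_def by auto
    have "A' * \<mu> \<le> A' * (B / (2 * (A' + 1)))" using A by (intro mult_left_mono) (auto simp: \<mu>_def)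
    also have "\<dots> < B" using A by (simp add: field_simps add_nonneg_pos)
    finally show "A' * \<mu> < B" .
  qed
  have J: "real (d + 1) \<le> (p - 1) * real J"
  proof -
    have "real (d + 1) / (p - 1) \<le> real J" unfolding J_def by (rule real_nat_ceiling_ge)
    thus ?thesis using p by (simp add: field_simps)
  qed
  have "\<mu> / 4 \<le> u x0" if sol: "bounded_solution a p c C f f0 M \<Omega> u w" and sub: "cball x0 r \<subseteq> \<Omega>" for f \<Omega> u w x0
  proof (rule ccontr)
    assume "\<not> \<mu> / 4 \<le> u x0"
    hence small: "u x0 < \<mu> / 4" by simp
    interpret bounded_solution a p c C f f0 M \<Omega> u w by (rule sol)
    define I where "I l = (LBINT x. (max 0 (\<mu> - u x))^2 * bump x0 r x ^ l)" for l
    have x0: "x0 \<in> cball x0 r" using r by simp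
    have int: "integrable lborel (\<lambda>x. (max 0 (\<mu> - u x))^2 * bump x0 r x ^ l)" if "l \<ge> 1" for l
    proof -
      have "continuous_on UNIV (\<lambda>x. (max 0 (\<mu> - u x))^2 * bump x0 r x ^ l)"
        using bump_outside[OF r, of _ x0] that
        by (intro continuous_on_zero_extension[OF open_\<Omega> compact_cball sub] continuous_intros u_cont continuous_on_bump) simp
      thus ?thesis using bump_outside[OF r, of _ x0] that
        by (intro integrable_continuous_compact_support[of "cball x0 r"]) simp_all
    qed
    have I0: "I l \<ge> 0" for l unfolding I_def using bump_bounds by (intro Bochner_Integration.integral_nonneg mult_nonneg_nonneg zero_le_power) auto
    have step: "I (P + l) \<le> A * \<mu> powr (p - 1) / f0 * I l" if l: "l \<ge> 1" "P + l \<le> N" for l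
    proof -
      define k where "k = 2 * real (P + l) * C / r"
      have k: "0 \<le> k" "k \<le> \<kappa>" unfolding k_def \<kappa>_def using C r l
        by (auto intro!: divide_right_mono mult_right_mono)
      have "f0 * I (P + l) \<le> k * (\<mu> * k / (2 * c)) powr (p - 1) * I l"
        using small_values_step[OF r sub \<mu>(1) l(1)] unfolding I_def P_def k_def .
      also have "\<dots> \<le> \<kappa> * (\<mu> * \<kappa> / (2 * c)) powr (p - 1) * I l"
        using k \<mu> c p I0 by (intro mult_right_mono mult_mono powr_mono2 divide_right_mono mult_left_mono) auto
      also have "(\<mu> * \<kappa> / (2 * c)) powr (p - 1) = \<mu> powr (p - 1) * (\<kappa> / (2 * c)) powr (p - 1)"
        using \<mu> \<kappa> c by (simp flip: powr_mult)
      finally show ?thesis using f0 by (simp add: A_def field_simps)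
    qed
    have iter: "j \<le> J \<Longrightarrow> I (j * P + 1) \<le> (A * \<mu> powr (p - 1) / f0)^j * I 1" for j
    proof (induction j)
      case (Suc j)
      have "P + (j * P + 1) \<le> N" using mult_le_mono1[OF Suc.prems, of P] by (simp add: N_def)
      hence "I (P + (j * P + 1)) \<le> A * \<mu> powr (p - 1) / f0 * I (j * P + 1)" by (intro step) auto
      also have "\<dots> \<le> A * \<mu> powr (p - 1) / f0 * ((A * \<mu> powr (p - 1) / f0)^j * I 1)"
        using Suc A f0 by (intro mult_left_mono) auto
      finally show ?case by (simp add: add.assoc)
    qed simp
    define V where "V = unit_ball_vol (real d)"
    have V: "V > 0" by (simp add: V_def)
    have vol: "(LBINT x. K * indicator (cball x0 s) x) = K * (V * s^d)"
      "integrable lborel (\<lambda>x. K * indicator (cball x0 s) x :: real)" if "s \<ge> 0" for s K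
      using that content_cball[of s x0] emeasure_lborel_cball_finite[of x0 s] by (auto simp: V_def d_def)
    have "I 1 \<le> (LBINT x. \<mu>^2 * indicator (cball x0 r) x)"
      unfolding I_def
    proof (rule integral_mono[OF int])
      fix x
      show "(max 0 (\<mu> - u x))^2 * bump x0 r x ^ 1 \<le> \<mu>^2 * indicator (cball x0 r) x"
      proof (cases "x \<in> cball x0 r")
        case True
        hence "u x > 0" using u_pos sub by blast
        hence "(max 0 (\<mu> - u x))^2 \<le> \<mu>^2" using \<mu> by (intro power_mono) auto
        hence "(max 0 (\<mu> - u x))^2 * bump x0 r x ^ 1 \<le> \<mu>^2 * 1"
          using bump_bounds[of x0 r x] by (intro mult_mono) auto
        thus ?thesis using True by simp
      next
        case False
        show ?thesis using bump_outside[OF r False] by simp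
      qed
    qed (use vol r in auto)
    hence I1: "I 1 \<le> \<mu>^2 * (V * r^d)" unfolding vol(1)[OF less_imp_le[OF r]] .
    define \<rho> where "\<rho> = \<mu> / (4 * M)"
    have \<rho>: "\<rho> > 0" "\<rho> \<le> r / 2" using \<mu> M by (auto simp: \<rho>_def field_simps)
    have "(LBINT x. ((\<mu> / 2)^2 * (3/4)^N) * indicator (cball x0 \<rho>) x) \<le> I N"
      unfolding I_def
    proof (rule integral_mono)
      fix x
      show "((\<mu> / 2)^2 * (3/4)^N) * indicator (cball x0 \<rho>) x \<le> (max 0 (\<mu> - u x))^2 * bump x0 r x ^ N"
      proof (cases "x \<in> cball x0 \<rho>")
        case True
        hence x: "x \<in> cball x0 r" "x \<in> cball x0 (r/2)" "norm (x - x0) \<le> \<rho>"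
          using \<rho> r by (auto simp: dist_norm norm_minus_commute)
        have "u x \<le> u x0 + M * norm (x - x0)" using lipschitz_on_cball[OF sub x(1) x0] by linarith
        also have "\<dots> \<le> \<mu> / 4 + M * \<rho>" using small x(3) M by (intro add_mono mult_left_mono) auto
        also have "\<dots> = \<mu> / 2" using M by (simp add: \<rho>_def)
        finally have "(\<mu> / 2)^2 \<le> (max 0 (\<mu> - u x))^2" using \<mu> by (intro power_mono) auto
        moreover have "(3/4)^N \<le> bump x0 r x ^ N" using bump_inside[OF r x(2)] by (intro power_mono) auto
        ultimately have "(\<mu> / 2)^2 * (3/4)^N \<le> (max 0 (\<mu> - u x))^2 * bump x0 r x ^ N"
          by (intro mult_mono) auto
        thus ?thesis using True by simp
      next
        case False
        thus ?thesis using bump_bounds[of x0 r x] by simp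
      qed
    next
      show "integrable lborel (\<lambda>x. (max 0 (\<mu> - u x))^2 * bump x0 r x ^ N)"
        by (rule int) (simp add: N_def)
    qed (rule vol(2)[OF less_imp_le[OF \<rho>(1)]])
    hence "((\<mu> / 2)^2 * (3/4)^N) * (V * \<rho>^d) \<le> I N"
      unfolding vol(1)[OF less_imp_le[OF \<rho>(1)]] .
    also have "\<dots> \<le> (A * \<mu> powr (p - 1) / f0)^J * I 1" using iter[of J] by (simp add: N_def)
    also have "\<dots> \<le> (A * \<mu> powr (p - 1) / f0)^J * (\<mu>^2 * (V * r^d))"
      using A f0 by (intro mult_left_mono I1) auto
    also have "\<dots> = (\<mu> powr (p - 1))^J * A' * (\<mu>^2 * V)"
      by (simp add: A'_def power_mult_distrib power_divide)
    also have "\<dots> \<le> \<mu>^(d + 1) * A' * (\<mu>^2 * V)"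
    proof (intro mult_right_mono)
      have "(\<mu> powr (p - 1))^J = \<mu> powr ((p - 1) * real J)"
        using \<mu> by (simp add: powr_powr flip: powr_realpow)
      also have "\<dots> \<le> \<mu> powr real (d + 1)" using J \<mu> by (intro powr_mono') auto
      also have "\<dots> = \<mu>^(d + 1)" using \<mu> by (rule_tac powr_realpow)
      finally show "(\<mu> powr (p - 1))^J \<le> \<mu>^(d + 1)" .
    qed (use A V in auto)
    finally have "(\<mu>^2 * V * \<mu>^d) * B \<le> (\<mu>^2 * V * \<mu>^d) * (A' * \<mu>)"
      by (simp add: B_def \<rho>_def power_divide mult_ac)
    moreover have "\<mu>^2 * V * \<mu>^d > 0" using \<mu> V by simp
    ultimately have "B \<le> A' * \<mu>" by (rule mult_left_le_imp_le)
    thus False using \<mu>(4) by simp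
  qed
  moreover have "\<mu> / 4 > 0" using \<mu> by simp
  ultimately show ?thesis by blast
qed

section \<open>Estimates for difference quotients\<close>

lemma norm_square_Basis: "(norm v)^2 = (\<Sum>b\<in>Basis. (v \<bullet> b)^2)" for v :: "'a::euclidean_space"
  unfolding power2_norm_eq_inner euclidean_inner[of v v] by (simp add: power2_eq_square)

lemma powr_half_square: "(x powr (e / 2))^2 = x powr e" for x e :: real
  by (simp add: power2_eq_square flip: powr_add)

lemma square_powr_half: "x \<ge> 0 \<Longrightarrow> (x^2) powr (e / 2) = x powr e" for x e :: real
  using powr_powr[of x 2 "e / 2"] by (cases "x = 0") auto

lemma young_weighted:
  fixes X s y \<Phi> Z C \<delta> :: real
  assumes "\<delta> > 0" "\<Phi> \<ge> 0" "Z \<ge> 0" "y^2 \<le> \<Phi> * Z"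
  shows "C * X * s * y \<le> \<delta> * X^2 * \<Phi> + C^2 / (4 * \<delta>) * s^2 * Z"
proof -
  define A B where "A = \<delta> * X^2 * \<Phi>" "B = C^2 / (4 * \<delta>) * s^2 * Z"
  have AB: "A \<ge> 0" "B \<ge> 0" using assms by (auto simp: A_B_def)
  have "(C * X * s * y)^2 = (C * X * s)^2 * y^2" by (simp add: power_mult_distrib)
  also have "\<dots> \<le> (C * X * s)^2 * (\<Phi> * Z)" by (intro mult_left_mono assms) auto
  also have "\<dots> = 4 * A * B" using assms(1) by (simp add: A_B_def power_mult_distrib)
  also have "\<dots> \<le> (A + B)^2" using sum_squares_bound[of A B] by (simp add: power2_sum)
  finally have "\<bar>C * X * s * y\<bar> \<le> \<bar>A + B\<bar>" by (simp only: abs_le_square_iff)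
  thus ?thesis using AB by (simp add: A_B_def)
qed

text \<open>Difference quotients with step \<open>h\<close>; the step is small compared with \<open>\<epsilon>\<close>. The function \<open>Z\<close>
  dominates everything that the cutoff \<open>\<Phi>\<close> (which will contain the singular weight) produces.\<close>

locale difference_quotients =
  test_product a p c C f f0 M \<Omega> u w \<Phi> D\<Phi> "cball x0 r" "ball x0 (2 * r)"
  for a :: "'a::euclidean_space \<Rightarrow> 'a" and p c C f f0 M \<Omega> u w \<Phi> D\<Phi> x0 r +
  fixes Z :: "'a \<Rightarrow> real" and \<kappa> L \<beta> \<epsilon> h :: real
  assumes cball_\<Omega>: "cball x0 (3 * r) \<subseteq> \<Omega>"
    and \<Phi>_nonneg: "\<And>x. 0 \<le> \<Phi> x" and \<Phi>_le: "\<And>x. \<Phi> x \<le> Z x"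
    and D\<Phi>_le: "\<And>x. norm (D\<Phi> x) \<le> Z x" and D\<Phi>_sq: "\<And>x. (norm (D\<Phi> x))^2 \<le> \<Phi> x * Z x"
    and Z_int: "integrable lborel Z" "integral\<^sup>L lborel Z \<le> \<kappa>"
    and L: "L \<ge> 0" and f_lip: "\<And>x y. x \<in> cball x0 (3 * r) \<Longrightarrow> y \<in> cball x0 (3 * r) \<Longrightarrow>
        \<bar>f (u x) - f (u y)\<bar> \<le> L * \<bar>u x - u y\<bar>"
    and \<beta>: "0 \<le> \<beta>" "\<beta> < 1" and \<epsilon>: "0 < \<epsilon>" "\<epsilon> \<le> 1" and h: "0 < h" "h \<le> r"
    and w_diff: "\<And>x b. b \<in> Basis \<Longrightarrow> x \<in> ball x0 (2 * r) \<Longrightarrow> norm (w (x + h *\<^sub>R b) - w x) \<le> \<epsilon>"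
    and u_diff: "\<And>x b. b \<in> Basis \<Longrightarrow> x \<in> ball x0 (2 * r) \<Longrightarrow>
        \<bar>(u (x + h *\<^sub>R b) - u x) / h - w x \<bullet> b\<bar> \<le> \<epsilon> / 2"
begin

definition V :: "'a \<Rightarrow> 'a \<Rightarrow> real" where "V b x = (u (x + h *\<^sub>R b) - u x) / h"

abbreviation \<sigma> :: "'a \<Rightarrow> 'a \<Rightarrow> real" where "\<sigma> b x \<equiv> soft \<epsilon> (V b x)"

abbreviation B\<^sub>2 :: "'a set" where "B\<^sub>2 \<equiv> ball x0 (2 * r)"

definition DV :: "'a \<Rightarrow> 'a \<Rightarrow> 'a" where "DV b x = (1 / h) *\<^sub>R (w (x + h *\<^sub>R b) - w x)"

definition Da :: "'a \<Rightarrow> 'a \<Rightarrow> 'a" where "Da b x = (1 / h) *\<^sub>R (a (w (x + h *\<^sub>R b)) - a (w x))"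

definition S :: "'a \<Rightarrow> 'a \<Rightarrow> real" where "S b x = norm (w (x + h *\<^sub>R b)) + norm (w x)"

definition Q :: "'a \<Rightarrow> 'a \<Rightarrow> real" where "Q b x = (Da b x \<bullet> DV b x) * wt \<epsilon> \<beta> (V b x) * \<Phi> x"

lemma r: "r > 0" using h by simp

lemma shift_mem:
  assumes "b \<in> Basis"
  shows "x \<in> B\<^sub>2 \<Longrightarrow> x + h *\<^sub>R b \<in> cball x0 (3 * r)"
    "x \<in> B\<^sub>2 \<Longrightarrow> x \<in> cball x0 (3 * r)"
    "x \<in> B\<^sub>2 \<Longrightarrow> x + h *\<^sub>R b \<in> \<Omega>" "x \<in> B\<^sub>2 \<Longrightarrow> x \<in> \<Omega>"
    "x \<in> cball x0 r \<Longrightarrow> x \<in> B\<^sub>2"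
proof -
  show 1: "x \<in> B\<^sub>2 \<Longrightarrow> x + h *\<^sub>R b \<in> cball x0 (3 * r)"
  proof -
    assume "x \<in> B\<^sub>2"
    moreover have "dist x0 (x + h *\<^sub>R b) \<le> dist x0 x + dist x (x + h *\<^sub>R b)" by (rule dist_triangle)
    moreover have "dist x (x + h *\<^sub>R b) = h" using assms h by (simp add: dist_norm)
    ultimately show ?thesis using h by simp
  qed
  show 2: "x \<in> B\<^sub>2 \<Longrightarrow> x \<in> cball x0 (3 * r)" using r by simp
  show "x \<in> B\<^sub>2 \<Longrightarrow> x + h *\<^sub>R b \<in> \<Omega>" "x \<in> B\<^sub>2 \<Longrightarrow> x \<in> \<Omega>" using 1 2 cball_\<Omega> by blast+
  show "x \<in> cball x0 r \<Longrightarrow> x \<in> B\<^sub>2" using r by simp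
qed

lemma V_GDERIV:
  assumes b: "b \<in> Basis" and x: "x \<in> B\<^sub>2"
  shows "GDERIV (V b) x :> DV b x"
proof -
  have "((\<lambda>x. x + h *\<^sub>R b) has_derivative (\<lambda>h. h)) (at x)" by (auto intro!: derivative_eq_intros)
  from has_derivative_compose[OF this u_GDERIV[OF shift_mem(3)[OF b x], unfolded gderiv_def]]
  have "GDERIV (\<lambda>x. u (x + h *\<^sub>R b)) x :> w (x + h *\<^sub>R b)" unfolding gderiv_def .
  hence "GDERIV (\<lambda>x. u (x + h *\<^sub>R b) - u x) x :> w (x + h *\<^sub>R b) - w x"
    by (intro GDERIV_diff u_GDERIV shift_mem(4)[OF b x])
  from GDERIV_DERIV_compose[OF this, of "\<lambda>y. y / h" "1 / h"]
  show ?thesis unfolding V_def[abs_def] DV_def by (simp add: DERIV_cdivide[OF DERIV_ident])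
qed

lemma shift_cont:
  assumes "b \<in> Basis" "continuous_on \<Omega> F"
  shows "continuous_on B\<^sub>2 (\<lambda>x. F (x + h *\<^sub>R b))" "continuous_on B\<^sub>2 F"
proof -
  show "continuous_on B\<^sub>2 (\<lambda>x. F (x + h *\<^sub>R b))"
    by (rule continuous_on_compose2[OF assms(2)]) (use shift_mem[OF assms(1)] in \<open>auto intro!: continuous_intros\<close>)
  show "continuous_on B\<^sub>2 F"
    by (rule continuous_on_subset[OF assms(2)]) (use shift_mem[OF assms(1)] in auto)
qed

lemma difference_quotients_cont:
  assumes "b \<in> Basis"
  shows "continuous_on B\<^sub>2 (V b)" "continuous_on B\<^sub>2 (DV b)"
    "continuous_on B\<^sub>2 (Da b)"
    "continuous_on B\<^sub>2 (\<lambda>x. (f (u (x + h *\<^sub>R b)) - f (u x)) / h)"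
  unfolding V_def[abs_def] DV_def[abs_def] Da_def[abs_def]
  using shift_cont[OF assms u_cont] shift_cont[OF assms w_cont] shift_cont[OF assms fu_cont]
    shift_cont[OF assms continuous_on_a[OF w_cont]] h
  by (auto intro!: continuous_intros)

lemma Da_bounds:
  shows "c * S b x powr (p - 2) * (norm (DV b x))^2 \<le> Da b x \<bullet> DV b x"
    and "norm (Da b x) \<le> C * S b x powr (p - 2) * norm (DV b x)"
proof -
  define \<xi> \<eta> where "\<xi> = w (x + h *\<^sub>R b)" "\<eta> = w x"
  have "(1/h)^2 * (c * (norm \<xi> + norm \<eta>) powr (p - 2) * (norm (\<xi> - \<eta>))^2) \<le> (1/h)^2 * ((a \<xi> - a \<eta>) \<bullet> (\<xi> - \<eta>))"
    by (intro mult_left_mono coercive) auto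
  thus "c * S b x powr (p - 2) * (norm (DV b x))^2 \<le> Da b x \<bullet> DV b x"
    using h by (simp add: S_def DV_def Da_def \<xi>_\<eta>_def power_divide power2_eq_square)
  have "(1/h) * norm (a \<xi> - a \<eta>) \<le> (1/h) * (C * (norm \<xi> + norm \<eta>) powr (p - 2) * norm (\<xi> - \<eta>))"
    using h by (intro mult_left_mono lipschitz) auto
  thus "norm (Da b x) \<le> C * S b x powr (p - 2) * norm (DV b x)"
    using h by (simp add: S_def DV_def Da_def \<xi>_\<eta>_def)
qed

lemma Da_nonneg: "Da b x \<bullet> DV b x \<ge> 0"
  using c by (intro order_trans[OF _ Da_bounds(1)]) auto

lemma abs_V_le: "b \<in> Basis \<Longrightarrow> x \<in> B\<^sub>2 \<Longrightarrow> \<bar>V b x\<bar> \<le> M"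
proof -
  assume b: "b \<in> Basis" and x: "x \<in> B\<^sub>2"
  have "\<bar>u (x + h *\<^sub>R b) - u x\<bar> \<le> M * h"
    using lipschitz_on_cball[OF cball_\<Omega> shift_mem(1)[OF b x] shift_mem(2)[OF b x]] b h by simp
  thus ?thesis using h by (simp add: V_def field_simps)
qed

lemma soft_V_le:
  assumes b: "b \<in> Basis" and x: "x \<in> B\<^sub>2"
  shows "\<bar>\<sigma> b x\<bar> \<le> \<bar>w x \<bullet> b\<bar>" "\<bar>w x \<bullet> b\<bar> \<le> \<bar>\<sigma> b x\<bar> + 2 * \<epsilon>"
    "\<bar>\<sigma> b x\<bar> \<le> M" "\<bar>\<sigma> b x\<bar> \<le> S b x" "\<sigma> b x \<noteq> 0 \<Longrightarrow> \<epsilon> / 2 \<le> norm (w x)"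
    "S b x \<le> 2 * M"
proof -
  have s: "\<bar>\<sigma> b x\<bar> = max 0 (\<bar>V b x\<bar> - \<epsilon>)" using \<epsilon> by (intro abs_soft) auto
  have d: "\<bar>V b x - w x \<bullet> b\<bar> \<le> \<epsilon> / 2" using u_diff[OF b x] by (simp add: V_def)
  have n: "\<bar>w x \<bullet> b\<bar> \<le> norm (w x)" using b by (rule Basis_le_norm)
  show 1: "\<bar>\<sigma> b x\<bar> \<le> \<bar>w x \<bullet> b\<bar>" using s d \<epsilon> by linarith
  show "\<bar>w x \<bullet> b\<bar> \<le> \<bar>\<sigma> b x\<bar> + 2 * \<epsilon>" using s d \<epsilon> by linarith
  show "\<bar>\<sigma> b x\<bar> \<le> M" using 1 n w_bound[OF shift_mem(4)[OF b x]] by linarith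
  show "\<bar>\<sigma> b x\<bar> \<le> S b x" using 1 n norm_ge_zero[of "w (x + h *\<^sub>R b)"] unfolding S_def by linarith
  show "S b x \<le> 2 * M"
    using w_bound[OF shift_mem(4)[OF b x]] w_bound[OF shift_mem(3)[OF b x]] unfolding S_def by linarith
  assume "\<sigma> b x \<noteq> 0"
  hence "\<bar>V b x\<bar> > \<epsilon>" using s by (simp add: max_def split: if_splits)
  thus "\<epsilon> / 2 \<le> norm (w x)" using d n by linarith
qed

definition K3 :: real where "K3 = (2 * M) powr (p - 2) * M powr (2 - \<beta>) + M powr (p - \<beta>)"

lemma K3_nonneg: "K3 \<ge> 0" by (simp add: K3_def)

lemma weight_bound:
  assumes b: "b \<in> Basis" and x: "x \<in> B\<^sub>2"
  shows "S b x powr (p - 2) * wt \<epsilon> \<beta> (V b x) * (\<sigma> b x)^2 \<le> K3"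
proof (cases "\<sigma> b x = 0")
  case False
  define s where "s = \<bar>\<sigma> b x\<bar>"
  have s: "s > 0" "s \<le> M" "s \<le> S b x" "S b x \<le> 2 * M" using False soft_V_le[OF b x] by (auto simp: s_def)
  have "S b x powr (p - 2) * wt \<epsilon> \<beta> (V b x) * s^2 \<le> S b x powr (p - 2) * s powr (- \<beta>) * s^2"
    using wt_upper[OF \<epsilon>(1) \<beta>(1)] unfolding s_def by (intro mult_right_mono mult_left_mono) auto
  also have "\<dots> = S b x powr (p - 2) * s powr (2 - \<beta>)"
    using s(1) powr_add[of s "-\<beta>" 2] by simp
  also have "\<dots> \<le> K3"
  proof (cases "p \<ge> 2")
    case True
    have "S b x powr (p - 2) * s powr (2 - \<beta>) \<le> (2 * M) powr (p - 2) * M powr (2 - \<beta>)"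
      using True s \<beta> by (intro mult_mono powr_mono2) auto
    thus ?thesis by (simp add: K3_def add_increasing2)
  next
    case False
    have "S b x powr (p - 2) * s powr (2 - \<beta>) \<le> s powr (p - 2) * s powr (2 - \<beta>)"
      using False s by (intro mult_right_mono powr_mono2') auto
    also have "\<dots> = s powr (p - \<beta>)" by (simp flip: powr_add)
    also have "\<dots> \<le> M powr (p - \<beta>)" using s p \<beta> by (intro powr_mono2) auto
    finally show ?thesis by (simp add: K3_def add_increasing)
  qed
  finally show ?thesis by (simp add: s_def)
qed (simp add: K3_nonneg)

definition C1 :: real where
  "C1 = 2 / (1 - \<beta>) * (C^2 / (2 * (1 - \<beta>) * c) * K3 + L * M powr (2 - \<beta>))"

lemma Z_nonneg: "Z x \<ge> 0" using \<Phi>_nonneg[of x] \<Phi>_le[of x] by simp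

lemma Q_integrable: "b \<in> Basis \<Longrightarrow> integrable lborel (Q b)"
proof (rule integrable_local)
  assume b: "b \<in> Basis"
  have "continuous_on B\<^sub>2 (\<lambda>x. wt \<epsilon> \<beta> (V b x))"
    by (rule continuous_on_compose2[OF continuous_on_wt[OF \<epsilon>(1), of UNIV] difference_quotients_cont(1)[OF b]]) auto
  thus "continuous_on B\<^sub>2 (Q b)"
    unfolding Q_def[abs_def] by (intro continuous_intros difference_quotients_cont b \<Phi>_cont)
qed (simp add: Q_def \<Phi>_0)

text \<open>The differenced equation is tested with \<open>prim \<epsilon> \<beta> (V b) \<Phi>\<close>; since \<open>\<beta> < 1\<close>, the term with
  \<open>prim'\<close> is coercive and absorbs the one with \<open>D\<Phi>\<close>.\<close>

lemma caccioppoli: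
  assumes b: "b \<in> Basis"
  shows "integral\<^sup>L lborel (Q b) \<le> C1 * \<kappa>"
proof -
  define F where "F x = prim \<epsilon> \<beta> (V b x)" for x
  define DF where "DF x = prim' \<epsilon> \<beta> (V b x) *\<^sub>R DV b x" for x
  define f' where "f' x = (f (u (x + h *\<^sub>R b)) - f (u x)) / h" for x
  have F_GD: "GDERIV F x :> DF x" if "x \<in> B\<^sub>2" for x
    unfolding F_def[abs_def] DF_def by (rule GDERIV_DERIV_compose[OF V_GDERIV[OF b that] DERIV_prim[OF \<epsilon>(1)]])
  have DF_cont: "continuous_on B\<^sub>2 DF"
  proof -
    have "continuous_on B\<^sub>2 (\<lambda>x. prim' \<epsilon> \<beta> (V b x))"
      by (rule continuous_on_compose2[OF continuous_on_prim'[OF \<epsilon>(1), of UNIV] difference_quotients_cont(1)[OF b]]) auto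
    thus ?thesis unfolding DF_def[abs_def] by (intro continuous_intros difference_quotients_cont b)
  qed
  have F_cont: "continuous_on B\<^sub>2 F" using F_GD by (rule GDERIV_imp_continuous_on)
  have im: "(\<lambda>x. x + h *\<^sub>R b) ` cball x0 r \<subseteq> \<Omega>" using shift_mem[OF b] by auto
  define T where "T x = F x *\<^sub>R D\<Phi> x + \<Phi> x *\<^sub>R DF x" for x
  have T_cont: "continuous_on B\<^sub>2 T" unfolding T_def[abs_def]
    by (intro continuous_intros F_cont DF_cont \<Phi>_cont continuous_on_subset[OF D\<Phi>_cont]) auto
  have T0: "x \<notin> cball x0 r \<Longrightarrow> T x = 0" for x using D\<Phi>_0 \<Phi>_0 by (simp add: T_def)
  note sc = shift_cont[OF b continuous_on_a[OF w_cont]] shift_cont[OF b fu_cont]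
  have i1: "integrable lborel (\<lambda>x. Da b x \<bullet> T x)"
    using T0 by (intro integrable_local continuous_intros difference_quotients_cont b T_cont) simp_all
  have i2: "integrable lborel (\<lambda>x. f' x * (F x * \<Phi> x))"
    using \<Phi>_0 difference_quotients_cont(4)[OF b] unfolding f'_def[symmetric]
    by (intro integrable_local continuous_intros F_cont \<Phi>_cont) simp_all
  have eq: "(LBINT x. Da b x \<bullet> T x) = (LBINT x. f' x * (F x * \<Phi> x))"
  proof -
    have j: "integrable lborel (\<lambda>x. a (w (x + h *\<^sub>R b)) \<bullet> T x)" "integrable lborel (\<lambda>x. a (w x) \<bullet> T x)"
      using T0 by (intro integrable_local continuous_intros sc T_cont; simp)+
    have k: "integrable lborel (\<lambda>x. f (u (x + h *\<^sub>R b)) * (F x * \<Phi> x))" "integrable lborel (\<lambda>x. f (u x) * (F x * \<Phi> x))"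
      using \<Phi>_0 by (intro integrable_local continuous_intros sc F_cont \<Phi>_cont; simp)+
    have "(LBINT x. Da b x \<bullet> T x) = (LBINT x. (1/h) * (a (w (x + h *\<^sub>R b)) \<bullet> T x - a (w x) \<bullet> T x))"
      by (intro Bochner_Integration.integral_cong) (auto simp: Da_def inner_diff_left)
    also have "\<dots> = (1/h) * ((LBINT x. a (w (x + h *\<^sub>R b)) \<bullet> T x) - (LBINT x. a (w x) \<bullet> T x))"
      using j by simp
    also have "\<dots> = (1/h) * ((LBINT x. f (u (x + h *\<^sub>R b)) * (F x * \<Phi> x)) - (LBINT x. f (u x) * (F x * \<Phi> x)))"
      using test_shift[OF F_GD DF_cont im] test[OF F_GD DF_cont] by (simp add: T_def)
    also have "\<dots> = (LBINT x. (1/h) * (f (u (x + h *\<^sub>R b)) * (F x * \<Phi> x) - f (u x) * (F x * \<Phi> x)))"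
      using k by simp
    also have "\<dots> = (LBINT x. f' x * (F x * \<Phi> x))"
      by (intro Bochner_Integration.integral_cong) (auto simp: f'_def algebra_simps diff_divide_distrib)
    finally show ?thesis .
  qed
  define K2 where "K2 = C^2 / (2 * (1 - \<beta>) * c) * K3 + L * M powr (2 - \<beta>)"
  have K2: "K2 \<ge> 0" using c \<beta> L K3_nonneg by (simp add: K2_def)
  have pt: "(1 - \<beta>) / 2 * Q b x \<le> (Da b x \<bullet> T x - f' x * (F x * \<Phi> x)) + K2 * Z x" for x
  proof (cases "x \<in> cball x0 r")
    case False
    thus ?thesis using T0 \<Phi>_0 K2 Z_nonneg[of x] by (simp add: Q_def)
  next
    case True
    hence x: "x \<in> B\<^sub>2" using shift_mem[OF b] by blast
    define s g P X where "s = \<bar>\<sigma> b x\<bar>" "g = wt \<epsilon> \<beta> (V b x)" "P = S b x powr (p - 2)" "X = norm (DV b x)"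
    note defs = s_g_P_X_def
    have nn: "s \<ge> 0" "g \<ge> 0" "P \<ge> 0" "X \<ge> 0" by (auto simp: defs wt_nonneg)
    have absF: "\<bar>F x\<bar> = s * g" by (simp add: F_def abs_prim defs)
    define \<delta> where "\<delta> = (1 - \<beta>) / 2 * c"
    have \<delta>: "\<delta> > 0" using \<beta> c by (simp add: \<delta>_def)
    have \<delta>4: "4 * \<delta> = 2 * (1 - \<beta>) * c" by (simp add: \<delta>_def)
    have A: "(1 - \<beta>) * Q b x \<le> Da b x \<bullet> (\<Phi> x *\<^sub>R DF x)"
    proof -
      have "((1 - \<beta>) * g) * ((Da b x \<bullet> DV b x) * \<Phi> x) \<le> prim' \<epsilon> \<beta> (V b x) * ((Da b x \<bullet> DV b x) * \<Phi> x)"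
        unfolding defs using \<epsilon> \<beta> by (intro mult_right_mono prim'_lower mult_nonneg_nonneg Da_nonneg \<Phi>_nonneg) auto
      thus ?thesis by (simp add: Q_def DF_def defs mult_ac)
    qed
    have B: "- (Da b x \<bullet> (F x *\<^sub>R D\<Phi> x)) \<le> (1 - \<beta>) / 2 * Q b x + C^2 / (2 * (1 - \<beta>) * c) * K3 * Z x"
    proof -
      have "- (Da b x \<bullet> (F x *\<^sub>R D\<Phi> x)) \<le> norm (Da b x) * norm (F x *\<^sub>R D\<Phi> x)"
        using Cauchy_Schwarz_ineq2[of "Da b x" "F x *\<^sub>R D\<Phi> x"] by linarith
      also have "\<dots> \<le> (C * P * X) * (s * g * norm (D\<Phi> x))"
        using Da_bounds(2)[of b x] absF unfolding defs by (simp add: mult_right_mono)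
      also have "\<dots> = (P * g) * (C * X * s * norm (D\<Phi> x))" by simp
      also have "\<dots> \<le> (P * g) * (\<delta> * X^2 * \<Phi> x + C^2 / (4 * \<delta>) * s^2 * Z x)"
        using nn by (intro mult_left_mono young_weighted \<delta> \<Phi>_nonneg Z_nonneg D\<Phi>_sq) auto
      also have "\<dots> = (1 - \<beta>) / 2 * ((c * P * X^2) * g * \<Phi> x) + C^2 / (4 * \<delta>) * (P * g * s^2) * Z x"
        by (simp add: \<delta>_def algebra_simps)
      also have "\<dots> \<le> (1 - \<beta>) / 2 * Q b x + C^2 / (4 * \<delta>) * K3 * Z x"
      proof (intro add_mono mult_left_mono mult_right_mono)
        show "(c * P * X^2) * g * \<Phi> x \<le> Q b x"
          unfolding Q_def defs by (intro mult_right_mono Da_bounds wt_nonneg \<Phi>_nonneg)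
        show "P * g * s^2 \<le> K3" using weight_bound[OF b x] by (simp add: defs)
      qed (use \<beta> \<delta> Z_nonneg in auto)
      finally show ?thesis unfolding \<delta>4 .
    qed
    have D: "f' x * (F x * \<Phi> x) \<le> L * M powr (2 - \<beta>) * Z x"
    proof -
      have "\<bar>f (u (x + h *\<^sub>R b)) - f (u x)\<bar> \<le> L * \<bar>u (x + h *\<^sub>R b) - u x\<bar>"
        using f_lip shift_mem[OF b] x by blast
      hence "\<bar>f' x\<bar> \<le> L * \<bar>V b x\<bar>"
        using h divide_right_mono[of _ _ h] by (fastforce simp: f'_def V_def)
      also have "\<dots> \<le> L * M" using abs_V_le[OF b x] L by (intro mult_left_mono) auto
      finally have 1: "\<bar>f' x\<bar> \<le> L * M" .
      have 2: "s * g \<le> M powr (1 - \<beta>)"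
      proof (cases "s = 0")
        case False
        have "s * g \<le> s * s powr (- \<beta>)"
          using wt_upper[OF \<epsilon>(1) \<beta>(1), of "V b x"] nn unfolding defs by (intro mult_left_mono) auto
        also have "\<dots> = s powr (1 - \<beta>)" using powr_add[of s 1 "-\<beta>"] nn False by simp
        also have "\<dots> \<le> M powr (1 - \<beta>)" using soft_V_le(3)[OF b x] \<beta> nn by (intro powr_mono2) (auto simp: defs)
        finally show ?thesis .
      qed simp
      have "f' x * (F x * \<Phi> x) \<le> \<bar>f' x\<bar> * (\<bar>F x\<bar> * \<Phi> x)"
        using abs_ge_self[of "f' x * (F x * \<Phi> x)"] \<Phi>_nonneg[of x] by (simp add: abs_mult)
      also have "\<dots> \<le> (L * M) * (M powr (1 - \<beta>) * Z x)"
        using 1 2 absF L M \<Phi>_le[of x] \<Phi>_nonneg[of x] by (intro mult_mono) auto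
      also have "\<dots> = L * M powr (2 - \<beta>) * Z x"
        using M powr_add[of M 1 "1 - \<beta>"] by simp
      finally show ?thesis .
    qed
    have "Da b x \<bullet> T x = Da b x \<bullet> (F x *\<^sub>R D\<Phi> x) + Da b x \<bullet> (\<Phi> x *\<^sub>R DF x)"
      unfolding T_def by (rule inner_add_right)
    moreover have "K2 * Z x = C^2 / (2 * (1 - \<beta>) * c) * K3 * Z x + L * M powr (2 - \<beta>) * Z x"
      unfolding K2_def by (rule distrib_right)
    moreover have "(1 - \<beta>) * Q b x = (1 - \<beta>) / 2 * Q b x + (1 - \<beta>) / 2 * Q b x" by simp
    ultimately show ?thesis using A B D by linarith
  qed
  have "(1 - \<beta>) / 2 * integral\<^sup>L lborel (Q b) = (LBINT x. (1 - \<beta>) / 2 * Q b x)" by simp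
  also have "\<dots> \<le> (LBINT x. ((Da b x \<bullet> T x - f' x * (F x * \<Phi> x)) + K2 * Z x))"
    using i1 i2 Z_int Q_integrable[OF b] by (intro integral_mono pt) auto
  also have "\<dots> = K2 * integral\<^sup>L lborel Z" using i1 i2 Z_int eq by simp
  also have "\<dots> \<le> K2 * \<kappa>" using K2 Z_int by (intro mult_left_mono) auto
  finally show ?thesis using \<beta> unfolding C1_def K2_def[symmetric] by (simp add: field_simps)
qed

definition N :: "'a \<Rightarrow> real" where "N x = \<epsilon>^2 + (\<Sum>b\<in>Basis. (\<sigma> b x)^2)"

lemma N_ge: "\<epsilon>^2 \<le> N x" "b \<in> Basis \<Longrightarrow> \<epsilon>^2 + (\<sigma> b x)^2 \<le> N x"
  unfolding N_def by (auto intro!: sum_nonneg member_le_sum)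

lemma N_pos: "N x > 0"
  using N_ge(1)[of x] \<epsilon> zero_less_power[of \<epsilon> 2] by linarith

lemma N_upper:
  assumes x: "x \<in> B\<^sub>2"
  shows "N x \<le> \<epsilon>^2 + (norm (w x))^2"
proof -
  have "(\<Sum>b\<in>Basis. (\<sigma> b x)^2) \<le> (\<Sum>b\<in>Basis. (w x \<bullet> b)^2)"
    using soft_V_le(1)[OF _ x] by (intro sum_mono) (simp add: abs_le_square_iff)
  thus ?thesis by (simp add: N_def norm_square_Basis)
qed

lemma N_lower:
  assumes x: "x \<in> B\<^sub>2"
  shows "(norm (w x))^2 \<le> 8 * real DIM('a) * N x"
proof -
  have "(w x \<bullet> b)^2 \<le> 8 * N x" if b: "b \<in> Basis" for b
  proof -
    define s where "s = \<bar>\<sigma> b x\<bar>"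
    have "\<bar>w x \<bullet> b\<bar> \<le> s + 2 * \<epsilon>" using soft_V_le(2)[OF b x] by (simp add: s_def)
    hence "\<bar>w x \<bullet> b\<bar>^2 \<le> (s + 2 * \<epsilon>)^2" by (intro power_mono) auto
    also have "\<dots> \<le> 2 * s^2 + 8 * \<epsilon>^2"
      using sum_squares_bound[of s "2 * \<epsilon>"] by (simp add: power2_sum power_mult_distrib)
    also have "\<dots> \<le> 8 * (\<epsilon>^2 + s^2)" by simp
    also have "\<dots> \<le> 8 * N x" using N_ge(2)[OF b, of x] by (simp add: s_def)
    finally show ?thesis by simp
  qed
  hence "(\<Sum>b\<in>Basis. (w x \<bullet> b)^2) \<le> (\<Sum>b\<in>(Basis::'a set). 8 * N x)" by (intro sum_mono)
  thus ?thesis by (simp add: norm_square_Basis mult_ac)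
qed

lemma N_comparable_S:
  assumes b: "b \<in> Basis" and x: "x \<in> B\<^sub>2" and s: "\<sigma> b x \<noteq> 0"
  shows "N x powr ((p - 2) / 2) \<le> (12 * real DIM('a)) powr \<bar>p - 2\<bar> * S b x powr (p - 2)"
proof -
  define d where "d = real DIM('a)"
  have d: "d \<ge> 1" unfolding d_def using DIM_positive[where 'a = 'a] by linarith
  have w: "\<epsilon> / 2 \<le> norm (w x)" using soft_V_le(5)[OF b x s] .
  have w': "norm (w (x + h *\<^sub>R b)) \<le> norm (w x) + \<epsilon>"
    using w_diff[OF b x] norm_triangle_ineq2[of "w (x + h *\<^sub>R b)" "w x"] by linarith
  have S: "norm (w x) \<le> S b x" "S b x \<le> 4 * norm (w x)" using w w' by (auto simp: S_def)
  have up: "sqrt (N x) \<le> 3 * norm (w x)"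
  proof (rule real_le_lsqrt)
    have "\<epsilon>^2 \<le> (2 * norm (w x))^2" using w \<epsilon> by (intro power_mono) auto
    hence "N x \<le> (2 * norm (w x))^2 + (norm (w x))^2" using N_upper[OF x] by linarith
    also have "\<dots> \<le> (3 * norm (w x))^2" by (simp add: power_mult_distrib)
    finally show "N x \<le> (3 * norm (w x))^2" .
  qed auto
  have lo: "norm (w x) \<le> 3 * d * sqrt (N x)"
  proof (rule power2_le_imp_le)
    have "(norm (w x))^2 \<le> 8 * d * N x" using N_lower[OF x] by (simp add: d_def)
    also have "\<dots> \<le> 9 * (d * d) * N x" using d N_pos[of x] by (intro mult_right_mono) (auto simp: mult_le_cancel_left1 intro: mult_mono)
    also have "\<dots> = (3 * d * sqrt (N x))^2" using N_pos[of x] by (simp add: power_mult_distrib power2_eq_square)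
    finally show "(norm (w x))^2 \<le> (3 * d * sqrt (N x))^2" .
  qed (use d N_pos[of x] in auto)
  have "sqrt (N x) powr (p - 2) \<le> (12 * d) powr \<bar>p - 2\<bar> * S b x powr (p - 2)"
  proof (rule powr_comparable)
    show "S b x / (12 * d) \<le> sqrt (N x)" using S lo d by (simp add: field_simps)
    have "sqrt (N x) \<le> 3 * S b x" using up S by linarith
    also have "\<dots> \<le> 12 * d * S b x" using d S w \<epsilon> norm_ge_zero[of "w x"] by (intro mult_right_mono) auto
    finally show "sqrt (N x) \<le> 12 * d * S b x" .
  qed (use d S w \<epsilon> in auto)
  also have "sqrt (N x) powr (p - 2) = N x powr ((p - 2) / 2)"
    using N_pos[of x] by (simp add: powr_half_sqrt[symmetric] powr_powr)
  finally show ?thesis by (simp add: d_def)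
qed

definition K4 :: "real \<Rightarrow> real" where
  "K4 t = C * (8 * real DIM('a)) powr ((p - 1) / 2) * (1 + M^2) powr ((p - 1 - t) / 2)"

definition K5 :: "real \<Rightarrow> real" where
  "K5 t = t^2 * C^2 * (8 * real DIM('a)) powr (p - 1) / (4 * (f0 / (2 * real DIM('a)))) * (12 * real DIM('a)) powr \<bar>p - 2\<bar> / c"

lemma growth_N:
  assumes x: "x \<in> B\<^sub>2"
  shows "norm (a (w x)) \<le> C * (8 * real DIM('a)) powr ((p - 1) / 2) * N x powr ((p - 1) / 2)"
proof -
  have "norm (a (w x)) \<le> C * norm (w x) powr (p - 1)" by (rule growth)
  also have "norm (w x) powr (p - 1) = ((norm (w x))^2) powr ((p - 1) / 2)"
    by (simp add: square_powr_half)
  also have "C * \<dots> \<le> C * (8 * real DIM('a) * N x) powr ((p - 1) / 2)"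
    using C p N_lower[OF x] by (intro mult_left_mono powr_mono2) auto
  also have "\<dots> = C * (8 * real DIM('a)) powr ((p - 1) / 2) * N x powr ((p - 1) / 2)"
    using N_pos[of x] by (simp add: powr_mult)
  finally show ?thesis .
qed

lemma hessian_term:
  assumes b: "b \<in> Basis" and x: "x \<in> cball x0 r" and t: "t \<ge> 0" "\<beta> = t + 2 - p"
  shows "t * N x powr (- t / 2 - 1) * \<bar>\<sigma> b x\<bar> * norm (a (w x)) * norm (DV b x) * \<Phi> x
    \<le> f0 / (2 * real DIM('a)) * (N x powr (- t / 2) * \<Phi> x) + K5 t * Q b x"
proof (cases "\<sigma> b x = 0")
  case True
  thus ?thesis using f0 \<Phi>_nonneg[of x] by (simp add: Q_def wt_def)
next
  case False
  have x': "x \<in> B\<^sub>2" using shift_mem[OF b] x by blast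
  define d where "d = real DIM('a)"
  have d: "d \<ge> 1" unfolding d_def using DIM_positive[where 'a = 'a] by linarith
  define \<theta> where "\<theta> = f0 / (2 * d)"
  have \<theta>: "\<theta> > 0" using f0 d by (simp add: \<theta>_def)
  define n s A X where "n = N x" "s = \<bar>\<sigma> b x\<bar>" "A = norm (a (w x))" "X = norm (DV b x)"
  note defs = n_s_A_X_def
  have n: "n > 0" using N_pos by (simp add: defs)
  have A2: "A^2 \<le> C^2 * (8 * d) powr (p - 1) * n powr (p - 1)"
  proof -
    have "A^2 \<le> (C * (8 * d) powr ((p - 1) / 2) * n powr ((p - 1) / 2))^2"
      unfolding defs d_def using growth_N[OF x'] by (intro power_mono) auto
    also have "\<dots> = C^2 * (8 * d) powr (p - 1) * n powr (p - 1)"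
      by (simp only: power_mult_distrib powr_half_square)
    finally show ?thesis .
  qed
  have young: "t * n powr (- t / 2 - 1) * s * A * X \<le> \<theta> * n powr (- t / 2) + t^2 / (4 * \<theta>) * (n powr (- t / 2 - 2) * s^2 * A^2 * X^2)"
  proof -
    define U W where "U = n powr (- t / 4)" "W = t * (n powr (- t / 4 - 1) * s * A * X)"
    have "2 * (sqrt \<theta> * U) * (W / (2 * sqrt \<theta>)) \<le> (sqrt \<theta> * U)^2 + (W / (2 * sqrt \<theta>))^2"
      by (rule sum_squares_bound)
    hence "U * W \<le> \<theta> * U^2 + W^2 / (4 * \<theta>)"
      using \<theta> by (simp add: power_mult_distrib power_divide)
    moreover have "U * W = t * n powr (- t / 2 - 1) * s * A * X"
    proof -
      have "n powr (- t / 4) * n powr (- t / 4 - 1) = n powr (- t / 2 - 1)" by (simp flip: powr_add)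
      thus ?thesis unfolding U_W_def by (metis (no_types, opaque_lifting) mult.assoc mult.left_commute)
    qed
    moreover have "U^2 = n powr (- t / 2)" by (simp add: U_W_def power2_eq_square flip: powr_add)
    moreover have "W^2 = t^2 * (n powr (- t / 2 - 2) * s^2 * A^2 * X^2)"
    proof -
      have "(n powr (- t / 4 - 1))^2 = n powr (- t / 2 - 2)" by (simp add: power2_eq_square flip: powr_add)
      thus ?thesis by (simp add: U_W_def power_mult_distrib)
    qed
    ultimately show ?thesis by simp
  qed
  define P g where "P = S b x powr (p - 2)" "g = wt \<epsilon> \<beta> (V b x)"
  have "n powr (- t / 2 - 2) * s^2 * A^2 * X^2 \<le> n powr (- t / 2 - 2) * s^2 * (C^2 * (8 * d) powr (p - 1) * n powr (p - 1)) * X^2"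
    by (intro mult_right_mono mult_left_mono A2) auto
  also have "\<dots> = C^2 * (8 * d) powr (p - 1) * (n powr (- t / 2 - 2) * n powr (p - 1)) * s^2 * X^2" by simp
  also have "n powr (- t / 2 - 2) * n powr (p - 1) = n powr ((p - 2) / 2) * n powr (- (\<beta> + 2) / 2)"
  proof -
    have "- t / 2 - 2 + (p - 1) = (p - 2) / 2 + - (\<beta> + 2) / 2" unfolding t(2) by (simp add: field_simps)
    thus ?thesis by (simp only: powr_add[symmetric])
  qed
  also have "C^2 * (8 * d) powr (p - 1) * (n powr ((p - 2) / 2) * n powr (- (\<beta> + 2) / 2)) * s^2 * X^2
      = C^2 * (8 * d) powr (p - 1) * (n powr ((p - 2) / 2) * X^2 * (s^2 * n powr (- (\<beta> + 2) / 2)))" by simp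
  also have "\<dots> \<le> C^2 * (8 * d) powr (p - 1) * (((12 * d) powr \<bar>p - 2\<bar> * P) * X^2 * g)"
  proof (intro mult_left_mono mult_mono mult_right_mono)
    show "n powr ((p - 2) / 2) \<le> (12 * d) powr \<bar>p - 2\<bar> * P"
      using N_comparable_S[OF b x' False] by (simp add: defs d_def P_g_def)
    have "n powr (- (\<beta> + 2) / 2) \<le> (\<epsilon>^2 + s^2) powr (- (\<beta> + 2) / 2)"
      using N_ge(2)[OF b, of x] \<beta> \<epsilon> by (intro powr_mono2') (auto simp: defs add_pos_nonneg)
    thus "s^2 * n powr (- (\<beta> + 2) / 2) \<le> g"
      unfolding P_g_def wt_def defs by (simp add: mult_left_mono)
  qed (auto simp: P_g_def)
  also have "\<dots> = C^2 * (8 * d) powr (p - 1) * (12 * d) powr \<bar>p - 2\<bar> / c * ((c * P * X^2) * g)"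
    using c by simp
  also have "\<dots> \<le> C^2 * (8 * d) powr (p - 1) * (12 * d) powr \<bar>p - 2\<bar> / c * ((Da b x \<bullet> DV b x) * g)"
    using c unfolding P_g_def defs by (intro mult_left_mono mult_right_mono Da_bounds wt_nonneg) auto
  finally have "t * n powr (- t / 2 - 1) * s * A * X \<le> \<theta> * n powr (- t / 2)
      + t^2 / (4 * \<theta>) * (C^2 * (8 * d) powr (p - 1) * (12 * d) powr \<bar>p - 2\<bar> / c * ((Da b x \<bullet> DV b x) * g))"
    using \<theta> by (intro order_trans[OF young] add_left_mono mult_left_mono) auto
  from mult_right_mono[OF this \<Phi>_nonneg[of x]]
  show ?thesis
    by (simp add: K5_def Q_def defs P_g_def \<theta>_def d_def algebra_simps)
qed

text \<open>The equation itself is tested with \<open>N\<^sup>-\<^sup>t\<^sup>/\<^sup>2 \<Phi>\<close>; the second-order terms that appear carry the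
  factor \<open>soft \<epsilon> (V b)\<close>, so they are controlled by \<open>Q b\<close>.\<close>

lemma negative_power_estimate:
  assumes t: "t \<ge> 0" "t < p - 1" "\<beta> = t + 2 - p"
  shows "(LBINT x. (\<epsilon>^2 + (norm (w x))^2) powr (- t / 2) * \<Phi> x)
    \<le> 2 / f0 * (K4 t + real DIM('a) * K5 t * C1) * \<kappa>"
proof -
  define d where "d = real DIM('a)"
  have d: "d \<ge> 1" unfolding d_def using DIM_positive[where 'a = 'a] by linarith
  define F where "F x = N x powr (- t / 2)" for x
  define G where "G x = (\<Sum>b\<in>Basis. (2 * \<sigma> b x) *\<^sub>R DV b x)" for x
  define DF where "DF x = (- t / 2 * N x powr (- t / 2 - 1)) *\<^sub>R G x" for x
  have N_GD: "GDERIV N x :> G x" if x: "x \<in> B\<^sub>2" for x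
  proof -
    have "GDERIV (\<lambda>x. (\<sigma> b x)^2) x :> (2 * \<sigma> b x) *\<^sub>R DV b x" if b: "b \<in> Basis" for b
      by (rule GDERIV_DERIV_compose[OF V_GDERIV[OF b x] DERIV_soft_square]) (use \<epsilon> in auto)
    hence "((\<lambda>x. \<Sum>b\<in>Basis. (\<sigma> b x)^2) has_derivative (\<lambda>h. \<Sum>b\<in>Basis. h \<bullet> ((2 * \<sigma> b x) *\<^sub>R DV b x))) (at x)"
      unfolding gderiv_def by (intro has_derivative_sum)
    hence "GDERIV (\<lambda>x. \<Sum>b\<in>Basis. (\<sigma> b x)^2) x :> G x"
      unfolding gderiv_def G_def inner_sum_right .
    from GDERIV_add[OF GDERIV_const this] show ?thesis unfolding N_def[abs_def] by simp
  qed
  have F_GD: "GDERIV F x :> DF x" if x: "x \<in> B\<^sub>2" for x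
  proof -
    have "((\<lambda>y. y powr (- t / 2)) has_real_derivative (- t / 2) * N x powr (- t / 2 - 1)) (at (N x))"
      by (rule has_real_derivative_powr) (rule N_pos)
    from GDERIV_DERIV_compose[OF N_GD[OF x] this] show ?thesis by (simp add: F_def[abs_def] DF_def)
  qed
  have N_cont: "continuous_on B\<^sub>2 N" using N_GD by (rule GDERIV_imp_continuous_on)
  have F_cont: "continuous_on B\<^sub>2 F" using F_GD by (rule GDERIV_imp_continuous_on)
  have DF_cont: "continuous_on B\<^sub>2 DF"
  proof -
    have "continuous_on B\<^sub>2 (\<lambda>x. \<sigma> b x)" if "b \<in> Basis" for b
      by (rule continuous_on_compose2[OF continuous_on_soft[of UNIV] difference_quotients_cont(1)[OF that]]) auto
    moreover have "N x \<noteq> 0" for x using N_pos[of x] by simp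
    ultimately show ?thesis unfolding DF_def[abs_def] G_def[abs_def]
      by (intro continuous_intros N_cont difference_quotients_cont) auto
  qed
  have sub: "B\<^sub>2 \<subseteq> \<Omega>" using cball_\<Omega> r by (auto simp: subset_iff)
  have aw: "continuous_on B\<^sub>2 (\<lambda>x. a (w x))" "continuous_on B\<^sub>2 (\<lambda>x. f (u x))"
    "continuous_on B\<^sub>2 w"
    using continuous_on_subset[OF _ sub] continuous_on_a[OF w_cont] fu_cont w_cont by blast+
  define T where "T x = F x *\<^sub>R D\<Phi> x + \<Phi> x *\<^sub>R DF x" for x
  have T_int: "integrable lborel (\<lambda>x. a (w x) \<bullet> T x)"
    unfolding T_def using D\<Phi>_0 \<Phi>_0
    by (intro integrable_local continuous_intros aw F_cont DF_cont \<Phi>_cont continuous_on_subset[OF D\<Phi>_cont]) auto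
  have F_int: "integrable lborel (\<lambda>x. F x * \<Phi> x)" "integrable lborel (\<lambda>x. f (u x) * (F x * \<Phi> x))"
    using \<Phi>_0 by (intro integrable_local continuous_intros aw F_cont \<Phi>_cont; simp)+
  have pt: "a (w x) \<bullet> T x \<le> K4 t * Z x + (f0 / 2 * (F x * \<Phi> x) + K5 t * (\<Sum>b\<in>Basis. Q b x))" for x
  proof (cases "x \<in> cball x0 r")
    case False
    thus ?thesis using D\<Phi>_0 \<Phi>_0 Z_nonneg[of x] C by (simp add: T_def Q_def K4_def)
  next
    case True
    hence x: "x \<in> B\<^sub>2" using r by simp
    have 1: "a (w x) \<bullet> (F x *\<^sub>R D\<Phi> x) \<le> K4 t * Z x"
    proof -
      have "norm (a (w x)) * F x \<le> C * (8 * d) powr ((p - 1) / 2) * N x powr ((p - 1) / 2) * N x powr (- t / 2)"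
        unfolding F_def d_def by (intro mult_right_mono growth_N x) auto
      also have "\<dots> = C * (8 * d) powr ((p - 1) / 2) * N x powr ((p - 1 - t) / 2)"
        by (simp add: mult.assoc diff_divide_distrib flip: powr_add)
      also have "\<dots> \<le> K4 t"
      proof -
        have "N x \<le> 1 + M^2"
          using N_upper[OF x] power_mono[of \<epsilon> 1 2] power_mono[of "norm (w x)" M 2] w_bound[of x] sub x \<epsilon> by fastforce
        thus ?thesis unfolding K4_def d_def using C t N_pos[of x] by (intro mult_left_mono powr_mono2) auto
      qed
      finally have 1: "norm (a (w x)) * F x \<le> K4 t" .
      have "a (w x) \<bullet> (F x *\<^sub>R D\<Phi> x) \<le> norm (a (w x)) * norm (F x *\<^sub>R D\<Phi> x)" by (rule norm_cauchy_schwarz)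
      also have "\<dots> = (norm (a (w x)) * F x) * norm (D\<Phi> x)" by (simp add: F_def)
      also have "\<dots> \<le> K4 t * Z x" using 1 D\<Phi>_le[of x] C by (intro mult_mono) (auto simp: K4_def)
      finally show ?thesis .
    qed
    have 2: "a (w x) \<bullet> (\<Phi> x *\<^sub>R DF x) \<le> (\<Sum>b\<in>Basis. f0 / (2 * d) * (N x powr (- t / 2) * \<Phi> x) + K5 t * Q b x)"
    proof -
      have "a (w x) \<bullet> (\<Phi> x *\<^sub>R DF x) = (\<Sum>b\<in>Basis. - (t * N x powr (- t / 2 - 1) * \<Phi> x * \<sigma> b x * (a (w x) \<bullet> DV b x)))"
        unfolding DF_def G_def
        by (simp add: inner_sum_right sum_distrib_left sum_negf mult_ac)
      also have "\<dots> \<le> (\<Sum>b\<in>Basis. f0 / (2 * d) * (N x powr (- t / 2) * \<Phi> x) + K5 t * Q b x)"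
      proof (rule sum_mono)
        fix b :: 'a assume b: "b \<in> Basis"
        have "- (t * N x powr (- t / 2 - 1) * \<Phi> x * \<sigma> b x * (a (w x) \<bullet> DV b x))
            \<le> (t * N x powr (- t / 2 - 1) * \<Phi> x) * (\<bar>\<sigma> b x\<bar> * \<bar>a (w x) \<bullet> DV b x\<bar>)"
          using abs_ge_minus_self[of "t * N x powr (- t / 2 - 1) * \<Phi> x * \<sigma> b x * (a (w x) \<bullet> DV b x)"]
            t(1) \<Phi>_nonneg[of x] by (simp add: abs_mult mult.assoc)
        also have "\<dots> \<le> (t * N x powr (- t / 2 - 1) * \<Phi> x) * (\<bar>\<sigma> b x\<bar> * (norm (a (w x)) * norm (DV b x)))"
          using t(1) \<Phi>_nonneg[of x] by (intro mult_left_mono Cauchy_Schwarz_ineq2) auto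
        also have "\<dots> = t * N x powr (- t / 2 - 1) * \<bar>\<sigma> b x\<bar> * norm (a (w x)) * norm (DV b x) * \<Phi> x" by simp
        also have "\<dots> \<le> f0 / (2 * d) * (N x powr (- t / 2) * \<Phi> x) + K5 t * Q b x"
          unfolding d_def by (rule hessian_term[OF b True t(1,3)])
        finally show "- (t * N x powr (- t / 2 - 1) * \<Phi> x * \<sigma> b x * (a (w x) \<bullet> DV b x)) \<le> \<dots>" .
      qed
      finally show ?thesis .
    qed
    also have "\<dots> = f0 / 2 * (F x * \<Phi> x) + K5 t * (\<Sum>b\<in>Basis. Q b x)"
      using d by (simp add: sum.distrib F_def d_def sum_distrib_left)
    finally show ?thesis using 1 by (simp add: T_def inner_add_right)
  qed
  have "f0 * (LBINT x. F x * \<Phi> x) = (LBINT x. f0 * (F x * \<Phi> x))" by simp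
  also have "\<dots> \<le> (LBINT x. f (u x) * (F x * \<Phi> x))"
  proof (rule integral_mono[OF _ F_int(2)])
    fix x show "f0 * (F x * \<Phi> x) \<le> f (u x) * (F x * \<Phi> x)"
    proof (cases "x \<in> cball x0 r")
      case True
      hence "x \<in> \<Omega>" using r sub by auto
      thus ?thesis using f_lower_u[of x] \<Phi>_nonneg[of x] by (intro mult_right_mono) (auto simp: F_def)
    qed (use \<Phi>_0 in simp)
  qed (use F_int in simp)
  also have "\<dots> = (LBINT x. a (w x) \<bullet> T x)" using test[OF F_GD DF_cont] by (simp add: T_def)
  also have "\<dots> \<le> (LBINT x. (K4 t * Z x + (f0 / 2 * (F x * \<Phi> x) + K5 t * (\<Sum>b\<in>Basis. Q b x))))"
    using T_int F_int Z_int Q_integrable by (intro integral_mono pt) auto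
  also have "\<dots> = K4 t * integral\<^sup>L lborel Z + (f0 / 2 * (LBINT x. F x * \<Phi> x) + K5 t * (\<Sum>b\<in>Basis. integral\<^sup>L lborel (Q b)))"
    using F_int Z_int Q_integrable by simp
  also have "\<dots> \<le> K4 t * \<kappa> + (f0 / 2 * (LBINT x. F x * \<Phi> x) + K5 t * (\<Sum>b\<in>(Basis::'a set). C1 * \<kappa>))"
    using Z_int(2) C f0 c by (intro add_mono mult_left_mono sum_mono caccioppoli) (auto simp: K4_def K5_def)
  finally have main: "(LBINT x. F x * \<Phi> x) \<le> 2 / f0 * (K4 t + d * K5 t * C1) * \<kappa>"
    using f0 by (simp add: d_def field_simps)
  have le: "(\<epsilon>^2 + (norm (w x))^2) powr (- t / 2) * \<Phi> x \<le> F x * \<Phi> x" for x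
  proof (cases "x \<in> cball x0 r")
    case True
    hence "x \<in> B\<^sub>2" using r by simp
    thus ?thesis unfolding F_def using N_upper[of x] N_pos[of x] t(1)
      by (intro mult_right_mono powr_mono2' \<Phi>_nonneg) auto
  qed (use \<Phi>_0 in simp)
  have "(LBINT x. (\<epsilon>^2 + (norm (w x))^2) powr (- t / 2) * \<Phi> x) \<le> (LBINT x. F x * \<Phi> x)"
  proof (rule integral_mono[OF _ F_int(1) le])
    have "\<epsilon>^2 + (norm (w x))^2 \<noteq> 0" for x using regularised_pos[OF \<epsilon>(1), of "norm (w x)"] by (metis less_irrefl)
    thus "integrable lborel (\<lambda>x. (\<epsilon>^2 + (norm (w x))^2) powr (- t / 2) * \<Phi> x)"
      using \<Phi>_0 by (intro integrable_local continuous_intros aw \<Phi>_cont) auto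
  qed
  thus ?thesis using main by (simp add: d_def)
qed

end

section \<open>Singular weights and the limit\<close>

definition reg_kernel :: "real \<Rightarrow> real \<Rightarrow> 'a::real_inner \<Rightarrow> 'a \<Rightarrow> real" where
  "reg_kernel \<tau> \<gamma> y x = (\<tau> + (x - y) \<bullet> (x - y)) powr (- \<gamma> / 2)"

lemma reg_kernel_base_pos: "\<tau> > 0 \<Longrightarrow> \<tau> + (z \<bullet> z) > 0"
  by (intro add_pos_nonneg) auto

lemma continuous_on_reg_kernel:
  assumes "\<tau> > 0"
  shows "continuous_on A (reg_kernel \<tau> \<gamma> y)"
proof -
  have "\<tau> + (x - y) \<bullet> (x - y) \<noteq> 0" for x using reg_kernel_base_pos[OF assms, of "x - y"] by linarith
  thus ?thesis unfolding reg_kernel_def by (intro continuous_intros) auto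
qed

lemma GDERIV_reg_kernel:
  assumes "\<tau> > 0"
  shows "GDERIV (reg_kernel \<tau> \<gamma> y) x :> (- \<gamma> * reg_kernel \<tau> (\<gamma> + 2) y x) *\<^sub>R (x - y)"
proof -
  have "((\<lambda>x. \<tau> + (x - y) \<bullet> (x - y)) has_derivative (\<lambda>h. h \<bullet> (2 *\<^sub>R (x - y)))) (at x)"
    by (auto intro!: derivative_eq_intros simp: inner_commute algebra_simps)
  hence 1: "GDERIV (\<lambda>x. \<tau> + (x - y) \<bullet> (x - y)) x :> 2 *\<^sub>R (x - y)" unfolding gderiv_def .
  have "((\<lambda>s. s powr (- \<gamma> / 2)) has_real_derivative (- \<gamma> / 2) * (\<tau> + (x - y) \<bullet> (x - y)) powr (- \<gamma> / 2 - 1))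
      (at (\<tau> + (x - y) \<bullet> (x - y)))"
    by (rule has_real_derivative_powr) (rule reg_kernel_base_pos[OF assms])
  from GDERIV_DERIV_compose[OF 1 this] show ?thesis
    by (simp add: reg_kernel_def[abs_def] add_divide_distrib)
qed

lemma reg_kernel_le:
  assumes "\<tau> > 0" "\<gamma> \<ge> 0" "x \<noteq> y"
  shows "reg_kernel \<tau> \<gamma> y x \<le> norm (x - y) powr (- \<gamma>)"
proof -
  have "reg_kernel \<tau> \<gamma> y x \<le> ((norm (x - y))^2) powr (- \<gamma> / 2)"
    unfolding reg_kernel_def power2_norm_eq_inner using assms by (intro powr_mono2') auto
  thus ?thesis by (simp only: square_powr_half[OF norm_ge_zero])
qed

lemma reg_kernel_gradient:
  fixes x y :: "'a::real_inner"
  assumes "\<tau> > 0" "\<gamma> \<ge> 0"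
  defines "q \<equiv> reg_kernel \<tau> (\<gamma> + 2) y x" and "w \<equiv> reg_kernel \<tau> \<gamma> y x"
  shows "(norm ((- \<gamma> * q) *\<^sub>R (x - y)))^2 \<le> \<gamma>^2 * (w * q)"
proof -
  define A where "A = \<tau> + (x - y) \<bullet> (x - y)"
  have A: "A > 0" unfolding A_def by (rule reg_kernel_base_pos[OF assms(1)])
  have "(norm (x - y))^2 * q \<le> A * q"
    using assms(1) by (intro mult_right_mono) (auto simp: A_def power2_norm_eq_inner q_def reg_kernel_def)
  also have "A * q = w"
  proof -
    have "A powr 1 * A powr (- (\<gamma> + 2) / 2) = A powr (- \<gamma> / 2)"
      unfolding powr_add[symmetric] by (simp add: field_simps)
    thus ?thesis using A by (simp add: q_def w_def reg_kernel_def A_def)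
  qed
  finally have "\<gamma>^2 * ((norm (x - y))^2 * q) * q \<le> \<gamma>^2 * w * q"
    by (intro mult_right_mono mult_left_mono) (auto simp: q_def reg_kernel_def)
  moreover have "(norm ((- \<gamma> * q) *\<^sub>R (x - y)))^2 = \<gamma>^2 * ((norm (x - y))^2 * q) * q"
    by (simp only: norm_scaleR power_mult_distrib power2_abs power2_minus) (simp add: power2_eq_square)
  ultimately show ?thesis by (simp add: mult.assoc)
qed

definition admissible_cutoff :: "('a::euclidean_space \<Rightarrow> real) \<Rightarrow> real \<Rightarrow> bool" where
  "admissible_cutoff \<Phi> \<kappa> \<longleftrightarrow> (\<exists>D\<Phi> Z. (\<forall>x. GDERIV \<Phi> x :> D\<Phi> x) \<and> continuous_on UNIV D\<Phi> \<and>
     (\<forall>x. \<Phi> x \<le> Z x) \<and> (\<forall>x. norm (D\<Phi> x) \<le> Z x) \<and> (\<forall>x. (norm (D\<Phi> x))^2 \<le> \<Phi> x * Z x) \<and>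
     integrable lborel Z \<and> integral\<^sup>L lborel Z \<le> \<kappa>)"

lemma weighted_cutoff:
  fixes r D \<gamma> :: real
  assumes r: "r > 0" and D: "D > 0" and \<gamma>: "0 \<le> \<gamma>" "\<gamma> < DIM('a::euclidean_space)" "\<gamma> = 0 \<or> \<gamma> + 2 < DIM('a)"
  shows "\<exists>\<kappa>\<ge>0. \<forall>(x0::'a) y \<tau>. cball x0 r \<subseteq> cball y D \<and> \<tau> > 0 \<longrightarrow>
    admissible_cutoff (\<lambda>x. bump x0 r x ^ 4 * reg_kernel \<tau> \<gamma> y x) \<kappa>"
proof -
  obtain C1 where C1: "C1 \<ge> 0"
    "\<And>y::'a. (\<integral>\<^sup>+x. indicator (cball y D) x * ennreal (norm (x - y) powr (-\<gamma>)) \<partial>lborel) \<le> ennreal C1"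
    using riesz_kernel_bound[OF D \<gamma>(2)] by blast
  have "\<exists>C2\<ge>0. \<forall>y::'a. (\<integral>\<^sup>+x. indicator (cball y D) x * ennreal (\<gamma> * norm (x - y) powr (-(\<gamma> + 2))) \<partial>lborel) \<le> ennreal C2"
  proof (cases "\<gamma> = 0")
    case False
    hence \<gamma>2: "\<gamma> + 2 < DIM('a)" using \<gamma>(3) by simp
    then obtain C2 where C2: "C2 \<ge> 0"
      "\<And>y::'a. (\<integral>\<^sup>+x. indicator (cball y D) x * ennreal (norm (x - y) powr (-(\<gamma>+2))) \<partial>lborel) \<le> ennreal C2"
      using riesz_kernel_bound[OF D \<gamma>2] by blast
    have meas: "(\<lambda>x. indicator (cball y D) x * ennreal (norm (x - y) powr (-(\<gamma>+2)))) \<in> borel_measurable lborel" for y :: 'a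
      by (intro borel_measurable_times_ennreal borel_measurable_indicator; measurable)
    have "(\<integral>\<^sup>+x. indicator (cball y D) x * ennreal (\<gamma> * norm (x - y) powr (-(\<gamma> + 2))) \<partial>lborel) \<le> ennreal (\<gamma> * C2)" for y :: 'a
    proof -
      have "(\<integral>\<^sup>+x. indicator (cball y D) x * ennreal (\<gamma> * norm (x - y) powr (-(\<gamma> + 2))) \<partial>lborel)
        = (\<integral>\<^sup>+x. ennreal \<gamma> * (indicator (cball y D) x * ennreal (norm (x - y) powr (-(\<gamma> + 2)))) \<partial>lborel)"
        using \<gamma>(1) by (intro nn_integral_cong) (simp add: ennreal_mult mult_ac)
      also have "\<dots> = ennreal \<gamma> * (\<integral>\<^sup>+x. indicator (cball y D) x * ennreal (norm (x - y) powr (-(\<gamma> + 2))) \<partial>lborel)"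
        by (rule nn_integral_cmult[OF meas])
      also have "\<dots> \<le> ennreal \<gamma> * ennreal C2" by (intro mult_left_mono C2) auto
      finally show ?thesis using \<gamma>(1) C2(1) by (simp add: ennreal_mult)
    qed
    thus ?thesis using \<gamma>(1) C2(1) by (intro exI[of _ "\<gamma> * C2"]) auto
  qed (auto intro: exI[of _ 0])
  then obtain C2 where C2: "C2 \<ge> 0"
    "\<And>y::'a. (\<integral>\<^sup>+x. indicator (cball y D) x * ennreal (\<gamma> * norm (x - y) powr (-(\<gamma> + 2))) \<partial>lborel) \<le> ennreal C2"
    by blast
  define A where "A = 1 + 8 / r + 2 * \<gamma> + 128 / r^2"
  have A: "A \<ge> 0" "1 \<le> A" "8 / r + \<gamma> \<le> A" "2 * \<gamma> \<le> A" "128 / r^2 \<le> A" using r \<gamma> by (auto simp: A_def)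
  define \<kappa> where "\<kappa> = A * (C1 + C2)"
  have "admissible_cutoff (\<lambda>x. bump x0 r x ^ 4 * reg_kernel \<tau> \<gamma> y x) \<kappa>"
    if sub: "cball x0 r \<subseteq> cball y D" and \<tau>: "\<tau> > 0" for x0 y :: 'a and \<tau> :: real
  proof -
    define b W q where "b = bump x0 r" "W = reg_kernel \<tau> \<gamma> y" "q = reg_kernel \<tau> (\<gamma> + 2) y"
    define Db where "Db x = (4 * b x ^ 3) *\<^sub>R (- 2 / r^2) *\<^sub>R (x - x0)" for x
    define DW where "DW x = (- \<gamma> * q x) *\<^sub>R (x - y)" for x
    define D\<Phi> where "D\<Phi> x = b x ^ 4 *\<^sub>R DW x + W x *\<^sub>R Db x" for x
    define Z where "Z x = A * (indicator (cball x0 r) x * (W x + \<gamma> * q x))" for x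
    note bWq = b_W_q_def
    have pos: "W x \<ge> 0" "q x \<ge> 0" for x by (auto simp: bWq reg_kernel_def)
    have b: "0 \<le> b x" "b x \<le> 1" for x using bump_bounds by (auto simp: bWq)
    have b4: "b x ^ 4 \<le> 1" for x using b by (simp add: power_le_one)
    have b0: "b x = 0" if "x \<notin> cball x0 r" for x using bump_outside[OF r that] by (simp add: bWq)
    have GD: "GDERIV (\<lambda>x. b x ^ 4 * W x) x :> D\<Phi> x" for x
    proof -
      have "GDERIV (\<lambda>x. b x ^ 4) x :> Db x"
        using GDERIV_bump_power[of x0 r 2 x] by (simp add: Db_def bWq eval_nat_numeral)
      moreover have "GDERIV W x :> DW x"
        unfolding DW_def bWq by (rule GDERIV_reg_kernel[OF \<tau>])
      ultimately show ?thesis unfolding D\<Phi>_def by (rule GDERIV_mult)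
    qed
    have cont: "continuous_on UNIV W" "continuous_on UNIV q" "continuous_on UNIV b"
      unfolding bWq by (intro continuous_on_reg_kernel[OF \<tau>] continuous_on_bump)+
    have cD: "continuous_on UNIV D\<Phi>" unfolding D\<Phi>_def DW_def Db_def by (intro continuous_intros cont)
    have nDb: "norm (Db x) \<le> 8 / r * b x ^ 3" for x
      using norm_bump_gradient[OF r, of 2 x0 x] by (simp add: Db_def bWq eval_nat_numeral)
    have nDW: "(norm (DW x))^2 \<le> \<gamma>^2 * (W x * q x)" for x
      unfolding DW_def bWq by (rule reg_kernel_gradient[OF \<tau> \<gamma>(1)])
    have nDW': "norm (DW x) \<le> \<gamma> * (W x + q x)" for x
    proof (rule power2_le_imp_le)
      have "W x * q x \<le> (W x + q x)^2" using pos[of x] by (simp add: power2_sum)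
      hence "\<gamma>^2 * (W x * q x) \<le> \<gamma>^2 * (W x + q x)^2" by (intro mult_left_mono) auto
      thus "(norm (DW x))^2 \<le> (\<gamma> * (W x + q x))^2" using nDW[of x] by (simp add: power_mult_distrib)
    qed (use pos \<gamma> in auto)
    have 1: "b x ^ 4 * W x \<le> Z x" for x
    proof (cases "x \<in> cball x0 r")
      case True
      have "b x ^ 4 * W x \<le> 1 * W x" using b4 pos by (intro mult_right_mono) auto
      also have "\<dots> \<le> A * (W x + \<gamma> * q x)" using A pos[of x] \<gamma> by (intro mult_mono) auto
      finally show ?thesis using True by (simp add: Z_def)
    qed (use b0 in \<open>simp add: Z_def\<close>)
    have 2: "norm (D\<Phi> x) \<le> Z x" for x
    proof (cases "x \<in> cball x0 r")
      case True
      have "norm (D\<Phi> x) \<le> b x ^ 4 * norm (DW x) + W x * norm (Db x)"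
        unfolding D\<Phi>_def using norm_triangle_ineq[of "b x ^ 4 *\<^sub>R DW x" "W x *\<^sub>R Db x"] b(1)[of x] pos[of x] by simp
      also have "\<dots> \<le> 1 * (\<gamma> * (W x + q x)) + W x * (8 / r * 1)"
      proof (intro add_mono mult_mono mult_left_mono nDW' b4)
        have "8 / r * b x ^ 3 \<le> 8 / r * 1" using b[of x] r by (intro mult_left_mono power_le_one) auto
        thus "norm (Db x) \<le> 8 / r * 1" using nDb[of x] by linarith
      qed (use pos b in auto)
      also have "\<dots> = (8 / r + \<gamma>) * W x + 1 * (\<gamma> * q x)" by (simp add: algebra_simps)
      also have "\<dots> \<le> A * W x + A * (\<gamma> * q x)" using A pos[of x] \<gamma> by (intro add_mono mult_right_mono) auto
      finally show ?thesis using True by (simp add: Z_def distrib_left)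
    next
      case False
      thus ?thesis using b0[OF False] by (simp add: D\<Phi>_def Z_def Db_def)
    qed
    have 3: "(norm (D\<Phi> x))^2 \<le> b x ^ 4 * W x * Z x" for x
    proof (cases "x \<in> cball x0 r")
      case True
      have "norm (D\<Phi> x) \<le> b x ^ 4 * norm (DW x) + W x * norm (Db x)"
        unfolding D\<Phi>_def using norm_triangle_ineq[of "b x ^ 4 *\<^sub>R DW x" "W x *\<^sub>R Db x"] b(1)[of x] pos[of x] by simp
      hence "(norm (D\<Phi> x))^2 \<le> (b x ^ 4 * norm (DW x) + W x * norm (Db x))^2" by (intro power_mono) auto
      also have "\<dots> \<le> 2 * (b x ^ 4 * norm (DW x))^2 + 2 * (W x * norm (Db x))^2"
        using sum_squares_bound[of "b x ^ 4 * norm (DW x)" "W x * norm (Db x)"] by (simp add: power2_sum)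
      also have "\<dots> = 2 * (b x ^ 4 * b x ^ 4) * (norm (DW x))^2 + 2 * (W x)^2 * (norm (Db x))^2"
        by (simp add: power_mult_distrib power2_eq_square)
      also have "\<dots> \<le> 2 * (b x ^ 4 * 1) * (\<gamma>^2 * (W x * q x)) + 2 * (W x)^2 * (64 / r^2 * (b x ^ 4 * 1))"
      proof (intro add_mono mult_mono mult_left_mono nDW b4)
        have "(norm (Db x))^2 \<le> (8 / r * b x ^ 3)^2" using nDb by (intro power_mono) auto
        also have "\<dots> = 64 / r^2 * (b x ^ 4 * (b x)^2)"
          by (simp add: power_mult_distrib power_divide power2_eq_square eval_nat_numeral)
        also have "\<dots> \<le> 64 / r^2 * (b x ^ 4 * 1)" using b[of x] r by (intro mult_left_mono power_le_one) auto
        finally show "(norm (Db x))^2 \<le> 64 / r^2 * (b x ^ 4 * 1)" .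
      qed (use b in auto)
      also have "\<dots> = b x ^ 4 * W x * ((128 / r^2) * W x + (2 * \<gamma>) * (\<gamma> * q x))"
        by (simp add: power2_eq_square algebra_simps)
      also have "\<dots> \<le> b x ^ 4 * W x * (A * W x + A * (\<gamma> * q x))"
        using A pos[of x] \<gamma> b[of x] by (intro mult_left_mono add_mono mult_right_mono) auto
      finally show ?thesis using True by (simp add: Z_def distrib_left)
    next
      case False
      thus ?thesis using b0[OF False] by (simp add: D\<Phi>_def Z_def Db_def)
    qed
    have Z0: "Z x \<ge> 0" for x using A pos[of x] \<gamma> by (simp add: Z_def)
    have Wm: "W \<in> borel_measurable borel" "q \<in> borel_measurable borel"
      using cont by (auto intro: borel_measurable_continuous_onI)
    have Zm: "Z \<in> borel_measurable lborel"
      unfolding Z_def[abs_def] using Wm by (intro borel_measurable_times borel_measurable_add borel_measurable_indicator) auto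
    define R1 R2 where "R1 x = indicator (cball y D) x * ennreal (norm (x - y) powr (-\<gamma>))"
      and "R2 x = indicator (cball y D) x * ennreal (\<gamma> * norm (x - y) powr (-(\<gamma> + 2)))" for x
    have R_meas: "R1 \<in> borel_measurable lborel" "R2 \<in> borel_measurable lborel"
      unfolding R1_def[abs_def] R2_def[abs_def]
      by (intro borel_measurable_times_ennreal borel_measurable_indicator; measurable)+
    have "(\<integral>\<^sup>+x. ennreal (Z x) \<partial>lborel) \<le> (\<integral>\<^sup>+x. ennreal A * (R1 x + R2 x) \<partial>lborel)"
    proof (rule nn_integral_mono_AE)
      show "AE x in lborel. ennreal (Z x) \<le> ennreal A * (R1 x + R2 x)"
        using AE_lborel_singleton[of y]
      proof eventually_elim
        case (elim x)
        show ?case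
        proof (cases "x \<in> cball x0 r")
          case True
          hence xy: "x \<in> cball y D" using sub by blast
          have "Z x = A * (W x + \<gamma> * q x)" using True by (simp add: Z_def)
          also have "\<dots> \<le> A * (norm (x - y) powr (-\<gamma>) + \<gamma> * norm (x - y) powr (-(\<gamma> + 2)))"
            using reg_kernel_le[OF \<tau> \<gamma>(1) elim] reg_kernel_le[OF \<tau> _ elim, of "\<gamma> + 2"] \<gamma> A
            unfolding bWq by (intro mult_left_mono add_mono) auto
          finally have "ennreal (Z x) \<le> ennreal (A * (norm (x - y) powr (-\<gamma>) + \<gamma> * norm (x - y) powr (-(\<gamma> + 2))))"
            by (rule ennreal_leI)
          also have "\<dots> = ennreal A * (R1 x + R2 x)"
            using xy A \<gamma> by (simp add: R1_def R2_def ennreal_mult ennreal_plus)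
          finally show ?thesis .
        qed (simp add: Z_def)
      qed
    qed
    also have "\<dots> = ennreal A * ((\<integral>\<^sup>+x. R1 x \<partial>lborel) + (\<integral>\<^sup>+x. R2 x \<partial>lborel))"
      using R_meas by (subst nn_integral_cmult) (auto simp: nn_integral_add)
    also have "\<dots> \<le> ennreal A * (ennreal C1 + ennreal C2)"
      unfolding R1_def R2_def by (intro mult_left_mono add_mono C1 C2) auto
    also have "\<dots> = ennreal \<kappa>" using A C1 C2 by (simp add: \<kappa>_def ennreal_mult ennreal_plus)
    finally have Zn: "(\<integral>\<^sup>+x. ennreal (Z x) \<partial>lborel) \<le> ennreal \<kappa>" .
    have "integrable lborel Z"
      using Zm Z0 Zn by (intro integrableI_nonneg) (auto intro: le_less_trans)
    moreover have "integral\<^sup>L lborel Z \<le> \<kappa>"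
      using Zn A C1 C2 by (intro integral_real_bounded) (auto simp: \<kappa>_def)
    ultimately show ?thesis using GD cD 1 2 3 unfolding bWq admissible_cutoff_def by blast
  qed
  moreover have "\<kappa> \<ge> 0" using A C1 C2 by (simp add: \<kappa>_def)
  ultimately show ?thesis by blast
qed

lemma tendsto_inv_pow:
  assumes t: "t > 0" and W: "W \<ge> 0"
  shows "(\<lambda>k. ennreal (((1 / real (Suc k))^2 + W^2) powr (- t / 2))) \<longlonglongrightarrow> inv_pow W t"
proof (cases "W = 0")
  case True
  have eq: "((1 / real (Suc k))^2 + W^2) powr (- t / 2) = real (Suc k) powr t" for k
  proof -
    have "((1 / real (Suc k))^2 + W^2) powr (- t / 2) = (1 / real (Suc k)) powr (- t)"
      using True square_powr_half[of "1 / real (Suc k)" "- t"] by (simp del: of_nat_Suc)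
    thus ?thesis by (simp add: powr_divide powr_minus_divide del: of_nat_Suc)
  qed
  have "filterlim (\<lambda>k. real (Suc k) powr t) at_top sequentially"
    by (rule filterlim_compose[OF real_powr_at_top[OF t]])
      (rule filterlim_compose[OF filterlim_real_sequentially filterlim_Suc])
  thus ?thesis using True t unfolding eq by (simp add: inv_pow_def ennreal_tendsto_top_eq_at_top)
next
  case False
  have "(\<lambda>k. ((1 / real (Suc k))^2 + W^2) powr (- t / 2)) \<longlonglongrightarrow> (0^2 + W^2) powr (- t / 2)"
    using False by (intro tendsto_intros LIMSEQ_Suc[OF lim_1_over_n]) auto
  also have "(0^2 + W^2) powr (- t / 2) = 1 / W powr t"
    using W by (simp add: square_powr_half powr_minus_divide)
  finally show ?thesis using False by (auto simp: inv_pow_def)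
qed

lemma tendsto_reg_kernel:
  assumes "x \<noteq> y"
  shows "(\<lambda>k. ennreal (reg_kernel (1 / real (Suc k)) \<gamma> y x)) \<longlonglongrightarrow> inv_pow (norm (x - y)) \<gamma>"
proof -
  have "(\<lambda>k. reg_kernel (1 / real (Suc k)) \<gamma> y x) \<longlonglongrightarrow> (0 + (x - y) \<bullet> (x - y)) powr (- \<gamma> / 2)"
    unfolding reg_kernel_def using assms by (intro tendsto_intros LIMSEQ_Suc[OF lim_1_over_n]) auto
  also have "(0 + (x - y) \<bullet> (x - y)) powr (- \<gamma> / 2) = 1 / norm (x - y) powr \<gamma>"
    using square_powr_half[OF norm_ge_zero, of "x - y" "-\<gamma>"]
    by (simp add: power2_norm_eq_inner powr_minus_divide)
  finally show ?thesis using assms by (auto simp: inv_pow_def)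
qed

lemma (in bounded_solution) small_step:
  assumes r: "r > 0" and sub: "cball x0 (3 * r) \<subseteq> \<Omega>" and \<epsilon>: "\<epsilon> > 0"
  shows "\<exists>h>0. h \<le> r \<and> (\<forall>b\<in>Basis. \<forall>x\<in>ball x0 (2 * r). norm (w (x + h *\<^sub>R b) - w x) \<le> \<epsilon> \<and>
      \<bar>(u (x + h *\<^sub>R b) - u x) / h - w x \<bullet> b\<bar> \<le> \<epsilon> / 2)"
proof -
  have "uniformly_continuous_on (cball x0 (3 * r)) w"
    by (intro compact_uniformly_continuous continuous_on_subset[OF w_cont sub]) auto
  then obtain \<delta> where \<delta>: "\<delta> > 0"
    "\<And>x x'. x \<in> cball x0 (3 * r) \<Longrightarrow> x' \<in> cball x0 (3 * r) \<Longrightarrow> dist x' x < \<delta> \<Longrightarrow> dist (w x') (w x) < \<epsilon> / 2"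
    unfolding uniformly_continuous_on_def using \<epsilon> by (meson half_gt_zero)
  define h where "h = min r (\<delta> / 2)"
  have h: "h > 0" "h \<le> r" "h < \<delta>" using r \<delta>(1) by (auto simp: h_def)
  have "norm (w (x + h *\<^sub>R b) - w x) \<le> \<epsilon> \<and> \<bar>(u (x + h *\<^sub>R b) - u x) / h - w x \<bullet> b\<bar> \<le> \<epsilon> / 2"
    if b: "b \<in> Basis" and x: "x \<in> ball x0 (2 * r)" for b x
  proof -
    have near: "x + s *\<^sub>R b \<in> cball x0 (3 * r)" "dist (x + s *\<^sub>R b) x < \<delta>" if "0 \<le> s" "s \<le> h" for s
    proof -
      have d: "dist (x + s *\<^sub>R b) x = s" using that b by (simp add: dist_norm)
      show "dist (x + s *\<^sub>R b) x < \<delta>" using d that h by simp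
      show "x + s *\<^sub>R b \<in> cball x0 (3 * r)"
        using dist_triangle[of x0 "x + s *\<^sub>R b" x] d x that h by (simp add: dist_commute)
    qed
    have xx: "x \<in> cball x0 (3 * r)" using near(1)[of 0] h by simp
    have wd: "norm (w (x + s *\<^sub>R b) - w x) < \<epsilon> / 2" if "0 \<le> s" "s \<le> h" for s
      using \<delta>(2)[OF xx near[OF that]] by (simp add: dist_norm)
    have der: "((\<lambda>s. u (x + s *\<^sub>R b)) has_real_derivative b \<bullet> w (x + s *\<^sub>R b)) (at s)" if "0 \<le> s" "s \<le> h" for s
    proof -
      have "((\<lambda>s. x + s *\<^sub>R b) has_derivative (\<lambda>y. y *\<^sub>R b)) (at s)" by (auto intro!: derivative_eq_intros)
      from has_derivative_compose[OF this u_GDERIV[of "x + s *\<^sub>R b", unfolded gderiv_def]]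
      have "((\<lambda>s. u (x + s *\<^sub>R b)) has_derivative (\<lambda>y. (y *\<^sub>R b) \<bullet> w (x + s *\<^sub>R b))) (at s)"
        using near[OF that] sub by blast
      thus ?thesis unfolding has_field_derivative_def
        by (rule has_derivative_eq_rhs) (simp add: fun_eq_iff mult.commute)
    qed
    have "\<exists>z>0. z < h \<and> u (x + h *\<^sub>R b) - u (x + 0 *\<^sub>R b) = (h - 0) * (b \<bullet> w (x + z *\<^sub>R b))"
      by (rule MVT2[of 0 h "\<lambda>s. u (x + s *\<^sub>R b)" "\<lambda>s. b \<bullet> w (x + s *\<^sub>R b)"]) (use h der in auto)
    then obtain z where z: "0 < z" "z < h" "u (x + h *\<^sub>R b) - u x = h * (b \<bullet> w (x + z *\<^sub>R b))" by auto
    have "(u (x + h *\<^sub>R b) - u x) / h - w x \<bullet> b = (w (x + z *\<^sub>R b) - w x) \<bullet> b"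
      using z(3) h by (simp add: inner_diff_left inner_commute[of b])
    hence "\<bar>(u (x + h *\<^sub>R b) - u x) / h - w x \<bullet> b\<bar> \<le> norm (w (x + z *\<^sub>R b) - w x)"
      using Basis_le_norm[OF b] by simp
    thus ?thesis using wd[of z] wd[of h] z h \<epsilon> by auto
  qed
  thus ?thesis using h by blast
qed

definition majorant :: "real \<Rightarrow> real \<Rightarrow> real \<Rightarrow> 'a::euclidean_space set \<Rightarrow> ('a \<Rightarrow> 'a) \<Rightarrow> 'a \<Rightarrow> ('a \<Rightarrow> ennreal) \<Rightarrow> bool" where
  "majorant t \<gamma> K A w y G \<longleftrightarrow> G \<in> borel_measurable lborel \<and> (\<integral>\<^sup>+x. G x \<partial>lborel) \<le> ennreal K \<and>
     (\<forall>x\<in>A. x \<noteq> y \<longrightarrow> inv_pow (norm (w x)) t * inv_pow (norm (x - y)) \<gamma> \<le> G x)"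

lemma (in stress_field) local_estimate:
  fixes f :: "real \<Rightarrow> real" and t \<gamma> r D f0 M :: real
  assumes t: "t > 0" "t < p - 1" "p - 2 < t"
    and \<gamma>: "0 \<le> \<gamma>" "\<gamma> < DIM('a)" "\<gamma> = 0 \<or> \<gamma> + 2 < DIM('a)"
    and r: "r > 0" and D: "D > 0" and f0: "f0 > 0" and M: "M > 0"
    and f_lip: "locally_lipschitz_on {0<..} f"
  shows "\<exists>K\<ge>0. \<forall>\<Omega> u w x0 y. bounded_solution a p c C f f0 M \<Omega> u w \<and> cball x0 (4 * r) \<subseteq> \<Omega> \<and>
      cball x0 r \<subseteq> cball y D \<longrightarrow>
    (\<exists>G. majorant t \<gamma> K (cball x0 (r / 2)) w y G)"
proof -
  obtain m where m: "m > 0"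
    "\<And>\<Omega> u w x0. bounded_solution a p c C f f0 M \<Omega> u w \<Longrightarrow> cball x0 r \<subseteq> \<Omega> \<Longrightarrow> m \<le> u x0"
    using positive_lower_bound[OF r f0 M] by blast
  obtain L where L: "L-lipschitz_on {m..M} f"
    using f_lip m(1) unfolding locally_lipschitz_on_def by (metis atLeastAtMost_iff compact_Icc greaterThan_iff less_le_trans subsetI)
  obtain \<kappa> where \<kappa>: "\<kappa> \<ge> 0" and cut: "\<And>(x0::'a) y \<tau>. cball x0 r \<subseteq> cball y D \<Longrightarrow> \<tau> > 0 \<Longrightarrow>
    admissible_cutoff (\<lambda>x. bump x0 r x ^ 4 * reg_kernel \<tau> \<gamma> y x) \<kappa>"
    using weighted_cutoff[OF r D \<gamma>] by blast
  define \<beta> where "\<beta> = t + 2 - p"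
  define B where "B = 2 / f0 * (C * (8 * real DIM('a)) powr ((p - 1) / 2) * (1 + M^2) powr ((p - 1 - t) / 2)
    + real DIM('a) * (t^2 * C^2 * (8 * real DIM('a)) powr (p - 1) / (4 * (f0 / (2 * real DIM('a)))) *
        (12 * real DIM('a)) powr \<bar>p - 2\<bar> / c) *
      (2 / (1 - \<beta>) * (C^2 / (2 * (1 - \<beta>) * c) * ((2 * M) powr (p - 2) * M powr (2 - \<beta>) + M powr (p - \<beta>))
        + L * M powr (2 - \<beta>)))) * \<kappa>"
  define K where "K = (4/3)^4 * \<bar>B\<bar>"
  have main: "(\<exists>G. majorant t \<gamma> K (cball x0 (r / 2)) w y G)"
    if sol: "bounded_solution a p c C f f0 M \<Omega> u w" and sub4: "cball x0 (4 * r) \<subseteq> \<Omega>"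
      and subD: "cball x0 r \<subseteq> cball y D" for \<Omega> u w x0 y
  proof -
    interpret bs: bounded_solution a p c C f f0 M \<Omega> u w by (rule sol)
    have sub3: "cball x0 (3 * r) \<subseteq> \<Omega>" using sub4 r by force
    define e where "e k = 1 / real (Suc k)" for k
    have e: "0 < e k" "e k \<le> 1" for k by (auto simp: e_def)
    define \<Phi> where "\<Phi> k x = bump x0 r x ^ 4 * reg_kernel (e k) \<gamma> y x" for k x
    define g where "g k x = ((e k)^2 + (norm (w x))^2) powr (- t / 2) * \<Phi> k x" for k x
    have \<Phi>0: "0 \<le> \<Phi> k x" for k x using bump_bounds by (auto simp: \<Phi>_def reg_kernel_def)
    have u_in: "u x \<in> {m..M}" if "x \<in> cball x0 (3 * r)" for x
    proof -
      have "cball x r \<subseteq> cball x0 (4 * r)"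
        using that dist_triangle[of x0 _ x] by (intro subsetI) (smt (verit, best) mem_cball)
      hence "m \<le> u x" using m(2)[OF sol] sub4 by blast
      thus ?thesis using bs.u_bound that sub3 by auto
    qed
    have g_bound: "integrable lborel (g k) \<and> integral\<^sup>L lborel (g k) \<le> B" for k
    proof -
      obtain D\<Phi> Z where DZ: "\<And>x. GDERIV (\<Phi> k) x :> D\<Phi> x" "continuous_on UNIV D\<Phi>" "\<And>x. \<Phi> k x \<le> Z x"
        "\<And>x. norm (D\<Phi> x) \<le> Z x" "\<And>x. (norm (D\<Phi> x))^2 \<le> \<Phi> k x * Z x" "integrable lborel Z" "integral\<^sup>L lborel Z \<le> \<kappa>"
        using cut[OF subD e(1)[of k]] unfolding \<Phi>_def[abs_def] admissible_cutoff_def by blast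
      obtain h where h: "h > 0" "h \<le> r" "\<And>b x. b \<in> Basis \<Longrightarrow> x \<in> ball x0 (2 * r) \<Longrightarrow> norm (w (x + h *\<^sub>R b) - w x) \<le> e k"
        "\<And>b x. b \<in> Basis \<Longrightarrow> x \<in> ball x0 (2 * r) \<Longrightarrow> \<bar>(u (x + h *\<^sub>R b) - u x) / h - w x \<bullet> b\<bar> \<le> e k / 2"
        using bs.small_step[OF r sub3 e(1)[of k]] by blast
      interpret dq: difference_quotients a p c C f f0 M \<Omega> u w "\<Phi> k" D\<Phi> x0 r Z \<kappa> L \<beta> "e k" h
      proof
        show "ball x0 (2 * r) \<subseteq> \<Omega>" using sub3 r by force
        show "\<Phi> k x = 0" if "x \<notin> cball x0 r" for x using bump_outside[OF r that] by (simp add: \<Phi>_def)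
        show "0 \<le> L" using L by (rule lipschitz_on_nonneg)
        show "\<bar>f (u x) - f (u y)\<bar> \<le> L * \<bar>u x - u y\<bar>" if "x \<in> cball x0 (3 * r)" "y \<in> cball x0 (3 * r)" for x y
          using lipschitz_onD[OF L u_in[OF that(1)] u_in[OF that(2)]] by (simp add: dist_real_def)
        show "0 \<le> \<beta>" "\<beta> < 1" using t by (auto simp: \<beta>_def)
      qed (use DZ \<Phi>0 e h r sub3 in auto)
      have "integral\<^sup>L lborel (g k) \<le> B"
        using dq.negative_power_estimate[OF less_imp_le[OF t(1)] t(2) \<beta>_def]
        unfolding g_def[abs_def] B_def dq.K4_def dq.K5_def dq.C1_def dq.K3_def .
      moreover have "integrable lborel (g k)"
      proof (rule dq.integrable_local)
        have "(e k)^2 + (norm (w x))^2 \<noteq> 0" for x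
          using regularised_pos[OF e(1)[of k], of "norm (w x)"] by linarith
        thus "continuous_on (ball x0 (2 * r)) (g k)" unfolding g_def[abs_def]
          using sub3 r by (intro continuous_intros dq.\<Phi>_cont continuous_on_subset[OF bs.w_cont]) auto
      qed (use dq.\<Phi>_0 in \<open>simp add: g_def\<close>)
      ultimately show ?thesis by blast
    qed
    have g0: "0 \<le> g k x" for k x using \<Phi>0 by (simp add: g_def)
    define G where "G x = liminf (\<lambda>k. ennreal ((4/3)^4 * g k x))" for x
    have gi: "integrable lborel (\<lambda>x. (4/3)^4 * g k x)" for k using g_bound[of k] by simp
    have gm: "(\<lambda>x. ennreal ((4/3)^4 * g k x)) \<in> borel_measurable lborel" for k
      using gi[of k] by (intro measurable_compose[OF _ measurable_ennreal]) (rule borel_measurable_integrable)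
    have Gm: "G \<in> borel_measurable lborel" unfolding G_def[abs_def] using gm by (rule borel_measurable_liminf)
    have "(\<integral>\<^sup>+x. G x \<partial>lborel) \<le> liminf (\<lambda>k. \<integral>\<^sup>+x. ennreal ((4/3)^4 * g k x) \<partial>lborel)"
      unfolding G_def by (rule nn_integral_liminf[OF gm])
    also have "\<dots> \<le> liminf (\<lambda>k::nat. ennreal K)"
    proof (intro Liminf_mono always_eventually allI)
      fix k
      have "(\<integral>\<^sup>+x. ennreal ((4/3)^4 * g k x) \<partial>lborel) = ennreal ((4/3)^4 * integral\<^sup>L lborel (g k))"
        using gi[of k] g0 by (subst nn_integral_eq_integral) auto
      also have "\<dots> \<le> ennreal K"
        using g_bound[of k] unfolding K_def by (intro ennreal_leI mult_left_mono) auto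
      finally show "(\<integral>\<^sup>+x. ennreal ((4/3)^4 * g k x) \<partial>lborel) \<le> ennreal K" .
    qed
    also have "\<dots> = ennreal K" by (simp add: Liminf_const)
    finally have GK: "(\<integral>\<^sup>+x. G x \<partial>lborel) \<le> ennreal K" .
    have "inv_pow (norm (w x)) t * inv_pow (norm (x - y)) \<gamma> \<le> G x"
      if x: "x \<in> cball x0 (r / 2)" and xy: "x \<noteq> y" for x
    proof -
      have "(\<lambda>k. ennreal (((e k)^2 + (norm (w x))^2) powr (- t / 2)) * ennreal (reg_kernel (e k) \<gamma> y x))
          \<longlonglongrightarrow> inv_pow (norm (w x)) t * inv_pow (norm (x - y)) \<gamma>"
        unfolding e_def
      proof (intro tendsto_mult_ennreal tendsto_inv_pow tendsto_reg_kernel t xy norm_ge_zero)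
        have "inv_pow (norm (w x)) t \<noteq> 0" "inv_pow (norm (x - y)) \<gamma> \<noteq> 0" "inv_pow (norm (x - y)) \<gamma> \<noteq> \<infinity>"
          using xy t by (auto simp: inv_pow_def)
        thus "\<not> (inv_pow (norm (w x)) t = 0 \<and> inv_pow (norm (x - y)) \<gamma> = \<infinity> \<or>
            inv_pow (norm (w x)) t = \<infinity> \<and> inv_pow (norm (x - y)) \<gamma> = 0)" by blast
      qed
      hence "inv_pow (norm (w x)) t * inv_pow (norm (x - y)) \<gamma> =
          liminf (\<lambda>k. ennreal (((e k)^2 + (norm (w x))^2) powr (- t / 2)) * ennreal (reg_kernel (e k) \<gamma> y x))"
        by (intro lim_imp_Liminf[symmetric]) auto
      also have "\<dots> \<le> G x"
        unfolding G_def
      proof (intro Liminf_mono always_eventually allI)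
        fix k
        have "(3/4)^4 \<le> bump x0 r x ^ 4" using bump_inside[OF r x] by (intro power_mono) auto
        hence "1 \<le> (4/3)^4 * bump x0 r x ^ 4" by (simp add: power_divide)
        hence "1 * (((e k)^2 + (norm (w x))^2) powr (- t / 2) * reg_kernel (e k) \<gamma> y x)
            \<le> ((4/3)^4 * bump x0 r x ^ 4) * (((e k)^2 + (norm (w x))^2) powr (- t / 2) * reg_kernel (e k) \<gamma> y x)"
          by (intro mult_right_mono) (auto simp: reg_kernel_def)
        hence "((e k)^2 + (norm (w x))^2) powr (- t / 2) * reg_kernel (e k) \<gamma> y x \<le> (4/3)^4 * g k x"
          by (simp add: g_def \<Phi>_def mult_ac)
        from ennreal_leI[OF this]
        show "ennreal (((e k)^2 + (norm (w x))^2) powr (- t / 2)) * ennreal (reg_kernel (e k) \<gamma> y x)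
            \<le> ennreal ((4/3)^4 * g k x)"
          by (subst ennreal_mult[symmetric]) (auto simp: reg_kernel_def)
      qed
      finally show ?thesis .
    qed
    thus ?thesis using Gm GK unfolding majorant_def by blast
  qed
  have "K \<ge> 0" by (simp add: K_def)
  thus ?thesis using main by blast
qed

section \<open>The integral estimate\<close>

lemma le_esssup_continuous:
  fixes g :: "'a::euclidean_space \<Rightarrow> real"
  assumes \<Omega>: "open \<Omega>" and g: "continuous_on \<Omega> g" "\<And>x. x \<in> \<Omega> \<Longrightarrow> 0 \<le> g x" "\<And>x. x \<in> \<Omega> \<Longrightarrow> g x \<le> K"
    and x: "x \<in> \<Omega>"
  shows "g x \<le> real_of_ereal (esssup (lebesgue_on \<Omega>) (\<lambda>x. ereal (g x)))"
proof -
  define E where "E = esssup (lebesgue_on \<Omega>) (\<lambda>x. ereal (g x))"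
  have L: "\<Omega> \<in> sets lebesgue" using \<Omega> by simp
  have "g \<in> borel_measurable (lebesgue_on \<Omega>)" using g(1) L by (rule continuous_imp_measurable_on_sets_lebesgue)
  hence "(\<lambda>x. ereal (g x)) \<in> borel_measurable (lebesgue_on \<Omega>)" by simp
  hence "E \<le> ereal K" unfolding E_def
    by (rule esssup_I) (use g(3) in \<open>auto intro!: AE_I2 simp: space_restrict_space\<close>)
  have le: "ereal (g x) \<le> E"
  proof (rule ccontr)
    assume "\<not> ereal (g x) \<le> E"
    hence "E < ereal (g x)" by (simp add: not_le)
    from ereal_dense2[OF this] obtain c where c: "E < ereal c" "ereal c < ereal (g x)" by blast
    define S where "S = {z \<in> \<Omega>. c < g z}"
    have "S = \<Omega> \<inter> g -` {c<..}" by (auto simp: S_def)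
    hence "open S" using continuous_open_preimage[OF g(1) \<Omega> open_greaterThan] by simp
    moreover have "S \<noteq> {}" using c x by (auto simp: S_def)
    moreover have "negligible S"
    proof -
      have "AE z in lebesgue_on \<Omega>. ereal (g z) \<le> E" unfolding E_def by (rule esssup_AE)
      hence "AE z in lebesgue. z \<in> \<Omega> \<longrightarrow> ereal (g z) \<le> E" 
        using AE_restrict_space_iff[of \<Omega> lebesgue "\<lambda>z. ereal (g z) \<le> E"] L by simp
      hence "AE z in lebesgue. z \<notin> S"
      proof eventually_elim
        case (elim z)
        show ?case
        proof
          assume "z \<in> S"
          hence "ereal (g z) \<le> E" "ereal c < ereal (g z)" using elim by (auto simp: S_def)
          thus False using c(1) by (metis less_trans not_less)
        qed
      qed
      moreover have "S \<in> sets lebesgue" using \<open>open S\<close> by simp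
      ultimately have "S \<in> null_sets lebesgue" using AE_iff_null_sets by blast
      thus ?thesis by (simp add: negligible_iff_null_sets)
    qed
    ultimately show False using open_not_negligible by blast
  qed
  have "E \<noteq> \<infinity>" "E \<noteq> -\<infinity>" using \<open>E \<le> ereal K\<close> le by auto
  thus ?thesis using le unfolding E_def[symmetric] by (cases E) auto
qed

lemma C1_closure_bounds:
  fixes u :: "'a::euclidean_space \<Rightarrow> real"
  assumes \<Omega>: "open \<Omega>" "bounded \<Omega>" and u: "C1_closure \<Omega> u" and x: "x \<in> \<Omega>"
  shows "\<bar>u x\<bar> \<le> W1inf_norm \<Omega> u" "norm (gradient u x) \<le> W1inf_norm \<Omega> u"
proof -
  have comp: "compact (closure \<Omega>)" using \<Omega>(2) by (simp add: compact_closure)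
  obtain w where w: "continuous_on (closure \<Omega>) w" "\<And>x. x \<in> \<Omega> \<Longrightarrow> w x = gradient u x"
    using u unfolding C1_closure_def by blast
  have uc: "continuous_on (closure \<Omega>) u" using u unfolding C1_closure_def by blast
  obtain K1 where K1: "\<And>x. x \<in> closure \<Omega> \<Longrightarrow> norm (u x) \<le> K1"
    using compact_imp_bounded[OF compact_continuous_image[OF uc comp]] unfolding bounded_iff by blast
  obtain K2 where K2: "\<And>x. x \<in> closure \<Omega> \<Longrightarrow> norm (w x) \<le> K2"
    using compact_imp_bounded[OF compact_continuous_image[OF w(1) comp]] unfolding bounded_iff by blast
  have sub: "\<Omega> \<subseteq> closure \<Omega>" by (rule closure_subset)
  have gc: "continuous_on \<Omega> (gradient u)"
    using continuous_on_subset[OF w(1) sub] w(2) by (subst continuous_on_cong[OF refl, of _ _ w]) auto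
  have 1: "\<bar>u x\<bar> \<le> real_of_ereal (esssup (lebesgue_on \<Omega>) (\<lambda>x. ereal \<bar>u x\<bar>))"
  proof (rule le_esssup_continuous[OF \<Omega>(1) _ _ _ x])
    show "continuous_on \<Omega> (\<lambda>x. \<bar>u x\<bar>)" by (intro continuous_intros continuous_on_subset[OF uc sub])
    show "\<bar>u x\<bar> \<le> K1" if "x \<in> \<Omega>" for x using K1[of x] that sub by auto
  qed auto
  have 2: "norm (gradient u x) \<le> real_of_ereal (esssup (lebesgue_on \<Omega>) (\<lambda>x. ereal (norm (gradient u x))))"
  proof (rule le_esssup_continuous[OF \<Omega>(1) _ _ _ x])
    show "continuous_on \<Omega> (\<lambda>x. norm (gradient u x))" by (intro continuous_intros gc)
    show "norm (gradient u x) \<le> K2" if "x \<in> \<Omega>" for x using K2[of x] w(2)[OF that] that sub by auto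
  qed auto
  show "\<bar>u x\<bar> \<le> W1inf_norm \<Omega> u" "norm (gradient u x) \<le> W1inf_norm \<Omega> u"
    using 1 2 abs_ge_zero[of "u x"] norm_ge_zero[of "gradient u x"] unfolding W1inf_norm_def by linarith+
qed

lemma inv_pow_mono:
  assumes "0 \<le> a" "a \<le> A" "0 < A" "s \<le> s'" "0 < a \<or> 0 < s'"
  shows "inv_pow a s \<le> ennreal (A powr (s' - s)) * inv_pow a s'"
proof (cases "a = 0")
  case True
  thus ?thesis using assms by (simp add: inv_pow_def ennreal_mult_top)
next
  case False
  hence a: "a > 0" using assms by simp
  have "1 / a powr s = a powr (s' - s) * (1 / a powr s')" using a by (simp add: powr_diff)
  also have "\<dots> \<le> A powr (s' - s) * (1 / a powr s')"
    using assms by (intro mult_right_mono powr_mono2) auto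
  finally show ?thesis using False by (simp add: inv_pow_def flip: ennreal_mult)
qed

lemma (in stress_field) bounded_solutionI:
  fixes B f :: "real \<Rightarrow> real"
  assumes a: "a = stress B H" and \<Omega>: "open \<Omega>" "bounded \<Omega>" and u: "C1_closure \<Omega> u" "\<And>x. x \<in> \<Omega> \<Longrightarrow> u x > 0"
    and weak: "weak_solution B H f \<Omega> u"
    and f: "continuous_on {0..} f" "f0 > 0" "\<And>s. 0 \<le> s \<Longrightarrow> s \<le> W1inf_norm \<Omega> u \<Longrightarrow> f0 \<le> f s"
    and M: "W1inf_norm \<Omega> u > 0"
  shows "bounded_solution a p c C f f0 (W1inf_norm \<Omega> u) \<Omega> u (gradient u)"
proof
  obtain w where w: "continuous_on (closure \<Omega>) w" "\<And>x. x \<in> \<Omega> \<Longrightarrow> w x = gradient u x"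
    using u unfolding C1_closure_def by blast
  show gd: "GDERIV u x :> gradient u x" if "x \<in> \<Omega>" for x
    using u(1) that unfolding C1_closure_def by (simp add: differentiable_iff_GDERIV_gradient)
  show gc: "continuous_on \<Omega> (gradient u)"
    using continuous_on_subset[OF w(1) closure_subset] w(2) by (subst continuous_on_cong[OF refl, of _ _ w]) auto
  have uc: "continuous_on \<Omega> u" using gd by (rule GDERIV_imp_continuous_on)
  have fu: "continuous_on \<Omega> (\<lambda>x. f (u x))"
    by (rule continuous_on_compose2[OF f(1) uc]) (use u(2) in force)
  fix \<psi> D K
  assume \<psi>: "\<And>x. GDERIV \<psi> x :> D x" "continuous_on UNIV D" "compact K" "K \<subseteq> \<Omega>" "\<And>x. x \<notin> K \<Longrightarrow> \<psi> x = 0"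
  have D0: "D x = 0" if "x \<notin> K" for x
    using GDERIV_eq_0[OF compact_imp_closed[OF \<psi>(3)] \<psi>(5) \<psi>(1) that] .
  have "C1c \<Omega> \<psi>" using C1c_GDERIV[OF \<psi>] .
  hence eq: "(LINT x:\<Omega>|lebesgue. a (gradient u x) \<bullet> gradient \<psi> x) = (LINT x:\<Omega>|lebesgue. f (u x) * \<psi> x)"
    using weak unfolding weak_solution_def a by blast
  have l: "(\<lambda>x. indicator \<Omega> x *\<^sub>R (a (gradient u x) \<bullet> gradient \<psi> x)) = (\<lambda>x. a (gradient u x) \<bullet> D x)"
  proof
    fix x show "indicator \<Omega> x *\<^sub>R (a (gradient u x) \<bullet> gradient \<psi> x) = a (gradient u x) \<bullet> D x"
      using D0[of x] \<psi>(4) gradient_eq[OF \<psi>(1)] by (cases "x \<in> K") (auto simp: indicator_def)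
  qed
  have r: "(\<lambda>x. indicator \<Omega> x *\<^sub>R (f (u x) * \<psi> x)) = (\<lambda>x. f (u x) * \<psi> x)"
  proof
    fix x show "indicator \<Omega> x *\<^sub>R (f (u x) * \<psi> x) = f (u x) * \<psi> x"
      using \<psi>(4) \<psi>(5)[of x] by (cases "x \<in> K") (auto simp: indicator_def)
  qed
  have \<psi>c: "continuous_on UNIV \<psi>" using \<psi>(1) by (rule GDERIV_imp_continuous_on)
  have "continuous_on UNIV (\<lambda>x. a (gradient u x) \<bullet> D x)"
    using D0 by (intro continuous_on_zero_extension[OF \<Omega>(1) \<psi>(3,4)] continuous_intros continuous_on_a gc
        continuous_on_subset[OF \<psi>(2)]) auto
  moreover have "continuous_on UNIV (\<lambda>x. f (u x) * \<psi> x)"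
    using \<psi>(5) by (intro continuous_on_zero_extension[OF \<Omega>(1) \<psi>(3,4)] continuous_intros fu
        continuous_on_subset[OF \<psi>c]) auto
  ultimately show "(LBINT x. a (gradient u x) \<bullet> D x) = (LBINT x. f (u x) * \<psi> x)"
    using eq unfolding set_lebesgue_integral_def l r
    by (simp add: integral_completion borel_measurable_continuous_onI)
qed (use C1_closure_bounds[OF \<Omega> u(1)] u(2) \<Omega> f M in \<open>auto intro: order_trans[OF abs_ge_self]\<close>)

lemma compactly_contained_cover:
  fixes \<Omega> \<Omega>' :: "'a::euclidean_space set"
  assumes "open \<Omega>" "compactly_contained \<Omega>' \<Omega>"
  obtains r F where "r > 0" "finite F" "\<And>x. x \<in> F \<Longrightarrow> cball x (4 * r) \<subseteq> \<Omega>" "\<Omega>' \<subseteq> (\<Union>x\<in>F. cball x (r / 2))"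
proof -
  have K: "compact (closure \<Omega>')" "closure \<Omega>' \<subseteq> \<Omega>" using assms(2) by (auto simp: compactly_contained_def)
  obtain d where d: "d > 0" "\<And>x y. x \<in> closure \<Omega>' \<Longrightarrow> y \<in> - \<Omega> \<Longrightarrow> d \<le> dist x y"
    using separate_compact_closed[OF K(1), of "- \<Omega>"] assms(1) K(2) by (metis (no_types, lifting) Compl_disjoint closed_Compl disjoint_eq_subset_Compl double_complement)
  define r where "r = d / 8"
  have r: "r > 0" using d by (simp add: r_def)
  obtain F where F: "finite F" "F \<subseteq> closure \<Omega>'" "closure \<Omega>' \<subseteq> (\<Union>x\<in>F. ball x (r / 2))"
    using seq_compact_imp_totally_bounded[OF compact_imp_seq_compact[OF K(1)]] r by (metis half_gt_zero)
  show ?thesis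
  proof (rule that[OF r F(1)])
    show "cball x (4 * r) \<subseteq> \<Omega>" if "x \<in> F" for x
    proof
      fix y assume "y \<in> cball x (4 * r)"
      hence "dist x y < d" using d(1) by (simp add: r_def)
      thus "y \<in> \<Omega>" using d(2)[of x y] F(2) that by force
    qed
    have "(\<Union>x\<in>F. ball x (r / 2)) \<subseteq> (\<Union>x\<in>F. cball x (r / 2))"
      by (intro UN_mono ball_subset_cball order_refl)
    thus "\<Omega>' \<subseteq> (\<Union>x\<in>F. cball x (r / 2))"
      using F(3) closure_subset[of \<Omega>'] by blast
  qed
qed

lemma set_nn_integral_le_majorant:
  fixes F R :: "'a::euclidean_space \<Rightarrow> ennreal"
  assumes R: "R \<in> borel_measurable lborel" "(\<integral>\<^sup>+x. R x \<partial>lborel) \<le> ennreal K" and A: "A \<ge> 0"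
    and le: "\<And>x. x \<in> S \<Longrightarrow> x \<noteq> y \<Longrightarrow> F x \<le> ennreal A * R x"
  shows "(\<integral>\<^sup>+x\<in>S. F x \<partial>lebesgue) \<le> ennreal (A * K)"
proof -
  have "AE x in lebesgue. x \<noteq> y" by (rule AE_completion[OF AE_lborel_singleton])
  hence "AE x in lebesgue. F x * indicator S x \<le> ennreal A * R x"
    by eventually_elim (use le in \<open>auto simp: indicator_def\<close>)
  hence "(\<integral>\<^sup>+x\<in>S. F x \<partial>lebesgue) \<le> (\<integral>\<^sup>+x. ennreal A * R x \<partial>lebesgue)" by (rule nn_integral_mono_AE)
  also have "\<dots> = ennreal A * (\<integral>\<^sup>+x. R x \<partial>lborel)"
    unfolding nn_integral_completion using R(1) by (rule nn_integral_cmult)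
  also have "\<dots> \<le> ennreal A * ennreal K" by (intro mult_left_mono R) auto
  also have "\<dots> = ennreal (A * K)" using A by (simp add: ennreal_mult')
  finally show ?thesis .
qed

theorem proposition3p5:
  fixes \<Omega> \<Omega>' :: "(real ^ 'n) set"
    and B f :: "real \<Rightarrow> real"
    and H :: "real ^ 'n \<Rightarrow> real"
    and \<beta>\<^sub>0 p k \<gamma>\<^sub>0 \<Gamma>\<^sub>0 t \<gamma> :: real
  assumes dim: "CARD('n) \<ge> 2"
    and \<Omega>: "smooth_bounded_domain \<Omega>"
    and \<beta>\<^sub>0: "0 < \<beta>\<^sub>0" "\<beta>\<^sub>0 < 1"
    and B_regular: "Ck_holder_loc 3 \<beta>\<^sub>0 {0<..} B" "C1_halfline B"
    and B_zero: "B 0 = 0" "hderiv B 0 = 0"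
    and B_pos: "\<And>s. s > 0 \<Longrightarrow> B s > 0 \<and> hderiv B s > 0 \<and> hderiv (hderiv B) s > 0"
    and growth_param: "p > 1" "0 \<le> k" "k \<le> 1" "\<gamma>\<^sub>0 > 0" "\<Gamma>\<^sub>0 > 0"
    and B_growth1: "\<And>s. s > 0 \<Longrightarrow>
          \<gamma>\<^sub>0 * (k + s) powr (p - 2) * s \<le> hderiv B s \<and>
          hderiv B s \<le> \<Gamma>\<^sub>0 * (k + s) powr (p - 2) * s"
    and B_growth2: "\<And>s. s > 0 \<Longrightarrow>
          \<gamma>\<^sub>0 * (k + s) powr (p - 2) \<le> hderiv (hderiv B) s \<and>
          hderiv (hderiv B) s \<le> \<Gamma>\<^sub>0 * (k + s) powr (p - 2)"
    and H_regular: "Ck_holder_loc 3 \<beta>\<^sub>0 (UNIV - {0}) H"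
    and H_even: "\<And>\<xi>. H (- \<xi>) = H \<xi>"
    and H_pos: "\<And>\<xi>. \<xi> \<noteq> 0 \<Longrightarrow> H \<xi> > 0" "H 0 = 0"
    and H_homogeneous: "\<And>\<xi> s. \<xi> \<noteq> 0 \<Longrightarrow> s > 0 \<Longrightarrow> H (s *\<^sub>R \<xi>) = s * H \<xi>"
    and H_convex: "uniformly_convex_unit_ball H"
    and f_pos: "\<And>s. s \<ge> 0 \<Longrightarrow> f s > 0"
    and f_regular: "continuous_on {0..} f" "locally_lipschitz_on {0<..} f"
    and f_lower: "admissible_lower_bound B f"
    and t: "0 \<le> t" "t < p - 1"
    and \<gamma>: "CARD('n) \<ge> 3 \<Longrightarrow> \<gamma> < real CARD('n) - 2" "CARD('n) = 2 \<Longrightarrow> \<gamma> = 0"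
    and \<Omega>': "compactly_contained \<Omega>' \<Omega>" "\<Omega>' \<in> sets lebesgue"
  shows "\<exists>C :: real \<Rightarrow> real. \<forall>u.
           C1_closure \<Omega> u \<and> (\<forall>x\<in>\<Omega>. u x > 0) \<and> weak_solution B H f \<Omega> u \<longrightarrow>
           (SUP y\<in>\<Omega>. \<integral>\<^sup>+x\<in>\<Omega>'.
              (inv_pow (k + norm (gradient u x)) t * inv_pow (norm (x - y)) \<gamma>) \<partial>lebesgue)
           \<le> ennreal (C (W1inf_norm \<Omega> u))"
proof -
  have \<Omega>_prop: "open \<Omega>" "bounded \<Omega>" "\<Omega> \<noteq> {}" using \<Omega> by (auto simp: smooth_bounded_domain_def)
  have \<Omega>'_sub: "\<Omega>' \<subseteq> \<Omega>" using \<Omega>'(1) closure_subset unfolding compactly_contained_def by blast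
  define n where "n = real DIM(real ^ 'n)"
  have n: "n = real CARD('n)" by (simp add: n_def)
  define \<gamma>' where "\<gamma>' = max \<gamma> 0"
  have \<gamma>': "0 \<le> \<gamma>'" "\<gamma> \<le> \<gamma>'" "\<gamma>' < n" "\<gamma>' = 0 \<or> \<gamma>' + 2 < n"
    using \<gamma> dim unfolding \<gamma>'_def n by (cases "CARD('n) = 2"; force)+
  define D where "D = diameter \<Omega> + 1"
  have D: "D > 0" using diameter_ge_0[OF \<Omega>_prop(2)] by (simp add: D_def)
  have dist_D: "norm (x - y) \<le> D" if "x \<in> \<Omega>" "y \<in> \<Omega>" for x y
    using diameter_bounded_bound[OF \<Omega>_prop(2) that] by (simp add: D_def dist_norm)
  define bnd where "bnd u K \<longleftrightarrow> (SUP y\<in>\<Omega>. \<integral>\<^sup>+x\<in>\<Omega>'.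
      (inv_pow (k + norm (gradient u x)) t * inv_pow (norm (x - y)) \<gamma>) \<partial>lebesgue) \<le> ennreal K" for u :: "real ^ 'n \<Rightarrow> real" and K
  have kernel: "inv_pow (norm (x - y)) \<gamma> \<le> ennreal (D powr (\<gamma>' - \<gamma>)) * inv_pow (norm (x - y)) \<gamma>'"
    if "x \<in> \<Omega>" "y \<in> \<Omega>" "x \<noteq> y" for x y
    using that D \<gamma>' by (intro inv_pow_mono dist_D) auto
  define sol where "sol u \<longleftrightarrow> C1_closure \<Omega> u \<and> (\<forall>x\<in>\<Omega>. u x > 0) \<and> weak_solution B H f \<Omega> u" for u
  have "\<exists>K. \<forall>u. sol u \<and> W1inf_norm \<Omega> u = M \<longrightarrow> bnd u K" for M
  proof (cases "k = 0")
    case k: False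
    obtain C1 where C1: "C1 \<ge> 0" "\<And>y::real ^ 'n. (\<integral>\<^sup>+x. indicator (cball y D) x * ennreal (norm (x - y) powr (-\<gamma>')) \<partial>lborel) \<le> ennreal C1"
      using riesz_kernel_bound[OF D \<gamma>'(3)[unfolded n_def]] by blast
    define A where "A = 1 / k powr t * D powr (\<gamma>' - \<gamma>)"
    have A: "A \<ge> 0" by (simp add: A_def)
    have "bnd u (A * C1)" for u
      unfolding bnd_def
    proof (rule SUP_least)
      fix y assume y: "y \<in> \<Omega>"
      show "(\<integral>\<^sup>+x\<in>\<Omega>'. (inv_pow (k + norm (gradient u x)) t * inv_pow (norm (x - y)) \<gamma>) \<partial>lebesgue) \<le> ennreal (A * C1)"
      proof (rule set_nn_integral_le_majorant[OF _ C1(2)[of y] A, of _ y])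
        show "(\<lambda>x. indicator (cball y D) x * ennreal (norm (x - y) powr (-\<gamma>'))) \<in> borel_measurable lborel"
          by (intro borel_measurable_times_ennreal borel_measurable_indicator; measurable)
        fix x assume "x \<in> \<Omega>'" and xy: "x \<noteq> y"
        hence x: "x \<in> \<Omega>" using \<Omega>'_sub by blast
        have "inv_pow (k + norm (gradient u x)) t \<le> ennreal (1 / k powr t)"
        proof -
          have "k powr t \<le> (k + norm (gradient u x)) powr t" using growth_param t by (intro powr_mono2) auto
          hence "1 / (k + norm (gradient u x)) powr t \<le> 1 / k powr t"
            using k growth_param by (intro divide_left_mono) (auto simp: add_nonneg_eq_0_iff)
          thus ?thesis using k growth_param by (auto simp: inv_pow_def add_nonneg_eq_0_iff intro: ennreal_leI)
        qed
        hence "inv_pow (k + norm (gradient u x)) t * inv_pow (norm (x - y)) \<gamma>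
            \<le> ennreal (1 / k powr t) * (ennreal (D powr (\<gamma>' - \<gamma>)) * inv_pow (norm (x - y)) \<gamma>')"
          using kernel[OF x y xy] by (intro mult_mono) auto
        also have "\<dots> = ennreal A * (indicator (cball y D) x * ennreal (norm (x - y) powr (-\<gamma>')))"
        proof -
          have "ennreal A = ennreal (1 / k powr t) * ennreal (D powr (\<gamma>' - \<gamma>))"
            unfolding A_def by (rule ennreal_mult) auto
          moreover have "indicator (cball y D) x * ennreal (norm (x - y) powr (-\<gamma>')) = inv_pow (norm (x - y)) \<gamma>'"
            using xy dist_D[OF x y] by (simp add: inv_pow_def powr_minus_divide dist_norm norm_minus_commute)
          ultimately show ?thesis by (simp only: mult.assoc)
        qed
        finally show "inv_pow (k + norm (gradient u x)) t * inv_pow (norm (x - y)) \<gamma>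
          \<le> ennreal A * (indicator (cball y D) x * ennreal (norm (x - y) powr (-\<gamma>')))" .
      qed
    qed
    thus ?thesis by blast
  next
    case k: True
    show ?thesis
    proof (cases "M > 0")
      case False
      have "\<not> (sol u \<and> W1inf_norm \<Omega> u = M)" for u
        unfolding sol_def using C1_closure_bounds(1)[OF \<Omega>_prop(1,2), of u] \<Omega>_prop(3) False by fastforce
      thus ?thesis by blast
    next
      case M: True
      interpret smooth_gauge H \<beta>\<^sub>0
        by standard (use H_regular H_pos H_homogeneous H_convex in auto)
      obtain c C where cC: "c > 0" "C > 0" "\<And>\<xi> \<eta>.
          c * (norm \<xi> + norm \<eta>) powr (p - 2) * (norm (\<xi> - \<eta>))^2 \<le> (stress B H \<xi> - stress B H \<eta>) \<bullet> (\<xi> - \<eta>) \<and>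
          norm (stress B H \<xi> - stress B H \<eta>) \<le> C * (norm \<xi> + norm \<eta>) powr (p - 2) * norm (\<xi> - \<eta>)"
        using stress_bounds[OF growth_param(1,4,5) B_regular(1)] B_growth1 B_growth2 unfolding k by (simp, blast)
      interpret stress_field "stress B H" p c C
        by standard (use growth_param(1) cC in \<open>auto simp: stress_def[of B H 0]\<close>)
      obtain r F where F: "r > 0" "finite F" "\<And>x. x \<in> F \<Longrightarrow> cball x (4 * r) \<subseteq> \<Omega>" "\<Omega>' \<subseteq> (\<Union>x\<in>F. cball x (r / 2))"
        using compactly_contained_cover[OF \<Omega>_prop(1) \<Omega>'(1)] by blast
      obtain s0 where s0: "s0 \<in> {0..M}" "\<And>s. s \<in> {0..M} \<Longrightarrow> f s0 \<le> f s"
        using continuous_attains_inf[of "{0..M}" f] continuous_on_subset[OF f_regular(1), of "{0..M}"] M by auto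
      obtain t' where t': "max t (p - 2) < t'" "t' < p - 1" using dense[of "max t (p - 2)" "p - 1"] t by auto
      have "\<exists>K\<ge>0. \<forall>\<Omega> u w x0 y. bounded_solution (stress B H) p c C f (f s0) M \<Omega> u w \<and>
          cball x0 (4 * r) \<subseteq> \<Omega> \<and> cball x0 r \<subseteq> cball y D \<longrightarrow>
          (\<exists>G. majorant t' \<gamma>' K (cball x0 (r / 2)) w y G)"
        using t' t \<gamma>' F(1) D f_pos[of s0] s0(1) M f_regular(2) unfolding n_def
        by (intro local_estimate) auto
      then obtain K where K: "K \<ge> 0" "\<forall>\<Omega> u w x0 y. bounded_solution (stress B H) p c C f (f s0) M \<Omega> u w \<and>
          cball x0 (4 * r) \<subseteq> \<Omega> \<and> cball x0 r \<subseteq> cball y D \<longrightarrow>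
          (\<exists>G. majorant t' \<gamma>' K (cball x0 (r / 2)) w y G)"
        by (elim exE conjE) (rule that)
      define A where "A = M powr (t' - t) * D powr (\<gamma>' - \<gamma>)"
      have A: "A \<ge> 0" by (simp add: A_def)
      have "bnd u (A * (real (card F) * K))"
        if "sol u \<and> W1inf_norm \<Omega> u = M" for u
        unfolding bnd_def
      proof (rule SUP_least)
        have u: "C1_closure \<Omega> u" "\<forall>x\<in>\<Omega>. u x > 0" "weak_solution B H f \<Omega> u" "W1inf_norm \<Omega> u = M"
          using that by (simp_all add: sol_def)
        fix y assume y: "y \<in> \<Omega>"
        have bs: "bounded_solution (stress B H) p c C f (f s0) M \<Omega> u (gradient u)"
          using bounded_solutionI[OF refl \<Omega>_prop(1,2) u(1) _ u(3) f_regular(1), of "f s0"] u(2,4) f_pos[of s0] s0 M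
          by auto
        have "\<exists>G. majorant t' \<gamma>' K (cball x0 (r / 2)) (gradient u) y G" if x0: "x0 \<in> F" for x0
        proof -
          have "cball x0 r \<subseteq> \<Omega>" using F(3)[OF x0] F(1) by force
          hence "cball x0 r \<subseteq> cball y D" using dist_D[OF _ y] by (auto simp: dist_norm norm_minus_commute subset_iff)
          with bs F(3)[OF x0] show ?thesis by (intro K(2)[rule_format] conjI)
        qed
        then obtain G where dom: "\<And>x0. x0 \<in> F \<Longrightarrow> majorant t' \<gamma>' K (cball x0 (r / 2)) (gradient u) y (G x0)" by metis
        have G: "x0 \<in> F \<Longrightarrow> G x0 \<in> borel_measurable lborel"
          "x0 \<in> F \<Longrightarrow> (\<integral>\<^sup>+x. G x0 x \<partial>lborel) \<le> ennreal K"
          "x0 \<in> F \<Longrightarrow> x \<in> cball x0 (r / 2) \<Longrightarrow> x \<noteq> y \<Longrightarrow>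
            inv_pow (norm (gradient u x)) t' * inv_pow (norm (x - y)) \<gamma>' \<le> G x0 x" for x0 x
          using dom[of x0] unfolding majorant_def by blast+
        show "(\<integral>\<^sup>+x\<in>\<Omega>'. (inv_pow (k + norm (gradient u x)) t * inv_pow (norm (x - y)) \<gamma>) \<partial>lebesgue)
            \<le> ennreal (A * (real (card F) * K))"
        proof (rule set_nn_integral_le_majorant[of "\<lambda>x. \<Sum>x0\<in>F. G x0 x" _ _ _ y])
          show "(\<lambda>x. \<Sum>x0\<in>F. G x0 x) \<in> borel_measurable lborel" using G(1) by (rule borel_measurable_sum)
          have "(\<integral>\<^sup>+x. (\<Sum>x0\<in>F. G x0 x) \<partial>lborel) \<le> (\<Sum>x0\<in>F. ennreal K)"
            using G(1,2) by (subst nn_integral_sum) (auto intro: sum_mono simp del: sum_constant)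
          thus "(\<integral>\<^sup>+x. (\<Sum>x0\<in>F. G x0 x) \<partial>lborel) \<le> ennreal (real (card F) * K)"
            using K(1) by (simp add: ennreal_mult ennreal_of_nat_eq_real_of_nat)
          fix x assume True: "x \<in> \<Omega>'" and xy: "x \<noteq> y"
          hence x: "x \<in> \<Omega>" using \<Omega>'_sub by blast
          obtain x0 where x0: "x0 \<in> F" "x \<in> cball x0 (r / 2)" using F(4) True by blast
          have "inv_pow (norm (gradient u x)) t \<le> ennreal (M powr (t' - t)) * inv_pow (norm (gradient u x)) t'"
            using C1_closure_bounds(2)[OF \<Omega>_prop(1,2) u(1) x] u(4) M t' t by (intro inv_pow_mono) auto
          hence "inv_pow (norm (gradient u x)) t * inv_pow (norm (x - y)) \<gamma>
            \<le> (ennreal (M powr (t' - t)) * inv_pow (norm (gradient u x)) t') * (ennreal (D powr (\<gamma>' - \<gamma>)) * inv_pow (norm (x - y)) \<gamma>')"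
            using kernel[OF x y xy] by (intro mult_mono) auto
          also have "\<dots> = ennreal A * (inv_pow (norm (gradient u x)) t' * inv_pow (norm (x - y)) \<gamma>')"
            by (simp add: A_def ennreal_mult mult_ac)
          also have "\<dots> \<le> ennreal A * (\<Sum>x0\<in>F. G x0 x)"
          proof (rule mult_left_mono)
            have "inv_pow (norm (gradient u x)) t' * inv_pow (norm (x - y)) \<gamma>' \<le> G x0 x" using G(3)[OF x0 xy] .
            also have "\<dots> \<le> (\<Sum>x0\<in>F. G x0 x)" using F(2) x0(1) by (intro member_le_sum) auto
            finally show "inv_pow (norm (gradient u x)) t' * inv_pow (norm (x - y)) \<gamma>' \<le> (\<Sum>x0\<in>F. G x0 x)" .
          qed simp
          finally show "inv_pow (k + norm (gradient u x)) t * inv_pow (norm (x - y)) \<gamma> \<le> ennreal A * (\<Sum>x0\<in>F. G x0 x)"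
            using k by simp
        qed (rule A)
      qed
      thus ?thesis by blast
    qed
  qed
  then obtain C where "\<And>M u. sol u \<and> W1inf_norm \<Omega> u = M \<Longrightarrow> bnd u (C M)" by metis
  hence "\<forall>u. sol u \<longrightarrow> bnd u (C (W1inf_norm \<Omega> u))" by simp
  thus ?thesis unfolding sol_def bnd_def by (rule exI[of _ C])
qed

end
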